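(* Let $\mathbb{k}$ be a field and let $\mathcal{G}^2=\{0,\dots,a-1\}\times\{0,\dots,b-1\}\subseteq\mathbb{Z}^2$ ($a,b\ge 1$) be a finite two-dimensional grid poset. As functions from the finite dimensional representations $\mathrm{rep}(\mathcal{G}^2)$ to $\mathbb{Z}$, we have $$\mathcal{N}^2=\mathcal{N}^{\mathrm{gen.pers.diag.}}=\mathcal{N}^{\mathrm{sign.barc.}}=\mathcal{N}^{\mathrm{hook.dec.}}=\mathcal{N}^{\mathrm{int.Eul.char.}}=\mathcal{N}^{\mathrm{int.dec.repl.}}=\mathcal{N}^{\mathrm{Bth}}=\mathcal{N}^{\mathrm{Dth}},$$ where $\mathcal{N}^{\mathrm{int.dec.repl.}}$ is defined using any fixed choice of $\ast\in\{\mathrm{ss},\mathrm{cc},\mathrm{tot}\}$.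
   Context: For a poset $\mathscr{P}$, $\mathrm{rep}(\mathscr{P})$ is the category of functors $\mathscr{P}\to\mathrm{vec}$ (finite dimensional $\mathbb{k}$-vector spaces). $\mathrm{rep}(\mathbb{Z}^2)$ (product order) is identified with pointwise finite dimensional bigraded $\mathbb{k}[\mathbf{x},\mathbf{y}]$-modules, where $\mathbf{x}:M_i\to M_{i+(1,0)}$ and $\mathbf{y}:M_i\to M_{i+(0,1)}$ are structure maps; $M[a]_i=M_{i+a}$. $\mathrm{rep}_0(\mathbb{Z}^2)$ is the full subcategory of representations with finite support. Padding by zeros gives a fully faithful embedding $\mathrm{rep}(\mathcal{G}^2)\hookrightarrow\mathrm{rep}_0(\mathbb{Z}^2)$, which is used implicitly. Spreads: a subset $I\subseteq\mathscr{P}$ is a spread if it is non-empty, poset-connected (any two elements are joined by a sequence in $I$ whose consecutive elements are comparable) and poset-convex ($x\le y\le z$, $x,z\in I$ implies $y\in I$). The spread representation $\mathbb{k}_I$ is $\mathbb{k}$ on $I$, $0$ elsewhere, with identity structure maps within $I$. Segments are the spreads $[x,y]=\{z:x\le z\le y\}$, $x\le y$. Hooks are the spreads $\langle x,y\langle\,=\{z\in\mathscr{P}: x\le z\not\ge y\}$, for $x<y\in\mathscr{P}\cup\{\infty\}$, where $\infty$ is an added element larger than all others. Additive invariants and counts: an additive invariant on an additive category $\mathcal{A}$ is an isomorphism-invariant function $\alpha$ from objects to an abelian group with $\alpha(X\oplus Y)=\alpha(X)+\alpha(Y)$. A basis for $\alpha$ is an indexed collection $\mathcal{B}=\{M_i\}_{i\in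 I}$ of objects such that for each $M\in\mathcal{A}$ there are unique integers $c_i^M$, finitely many nonzero, with $\alpha(M)=\sum_i c_i^M\alpha(M_i)$. Then define $\mathcal{N}^{(\alpha,\mathcal{B})}(M)=\sum_i c_i^M$. The counts on $\mathrm{rep}(\mathcal{G}^2)$ (all the collections mentioned below are known to be bases): - $\mathcal{N}^2(M)=\dim M-\dim\mathbf{x}M-\dim\mathbf{y}M+\dim\mathbf{x}\mathbf{y}M$ (total dimensions over $\mathbb{k}$, computed after padding by zeros). - $\mathcal{N}^{\mathrm{gen.pers.diag.}}$: $\alpha(M)(I)=\mathrm{rank}(\lim M|_I\to\mathrm{colim}\, M|_I)$ for $I$ ranging over all spreads of $\mathcal{G}^2$; basis $\{\mathbb{k}_I\}$, $I$ ranging over all spreads. - $\mathcal{N}^{\mathrm{sign.barc.}}$: $\alpha(M)([p,q])=\mathrm{rank}(M_p\to M_q)$ for $p\le q$; basis $\{\mathbb{k}_I\}$, $I$ ranging over all segments. - $\mathcal{N}^{\mathrm{hook.dec.}}$: $\alpha(M)(I)=\dim\mathrm{Hom}(\mathbb{k}_I,M)$ for $I$ ranging over all hooks; basis $\{\mathbb{k}_I\}$, $I$ ranging over all hooks. - $\mathcal{N}^{\mathrm{int.Eul.char.}}$: $\alpha(M)(I)=\dim\mathrm{Hom}(\mathbb{k}_I,M)$ for $I$ ranging over all spreads; basis $\{\mathbb{k}_I\}$, $I$ ranging over all spreads. - $\mathcal{N}^{\mathrm{int.dec.repl.}}$: for a spread $I$, let $I^{\mathrm{tot}}=I$, let $I^{\mathrm{ss}}$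 be the set of minimal and maximal elements of $I$, and let $I^{\mathrm{cc}}=\big(\mathrm{pr}_1(I^{\mathrm{ss}})\times\mathrm{pr}_2(I^{\mathrm{ss}})\big)\cap I$. Fix $\ast\in\{\mathrm{ss},\mathrm{cc},\mathrm{tot}\}$. The compressed multiplicity invariant $\alpha(M)(I)$ is the multiplicity of the indecomposable representation $\mathbb{k}_I|_{I^\ast}$ as a direct summand of $M|_{I^\ast}$, where $I^\ast$ is regarded as a full subposet; basis $\{\mathbb{k}_I\}$, $I$ ranging over all spreads. - $\mathcal{N}^{\mathrm{Bth}}$ and $\mathcal{N}^{\mathrm{Dth}}$: a spread curve is a spread $I\subseteq\mathbb{Z}^2$ such that $p\in I$ implies $p+(1,1)\notin I$. For $M\in\mathrm{rep}(\mathbb{Z}^2)$, the cokernel and the kernel of $\mathbf{x}\mathbf{y}:M[-1,-1]\to M$ decompose, essentially uniquely, as direct sums of spread curve representations. $\mathcal{N}^{\mathrm{Bth}}(M)$ is the number (with multiplicity) of summands $\mathbb{k}_I$ of the cokernel (birth-curves), and $\mathcal{N}^{\mathrm{Dth}}(M)$ is the number of summands of the kernel (death-curves). *)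

theory Defs
  imports
    Complex_Main
    "HOL-Library.Product_Order"
    "HOL-Library.Product_Plus"
    "HOL-Library.Function_Algebras"
    "HOL-Library.Groups_Big_Fun"
begin

section \<open>Representations of posets\<close>

text \<open>
  The vector spaces of a representation are finite dimensional subspaces of an ambient vector
  space, given by a scalar multiplication \<open>s\<close> with \<^prop>\<open>vector_space s\<close>. The ambient space is
  arbitrary, so this covers every family of finite dimensional spaces (embed it into its direct
  sum). The poset is a subset \<open>P\<close> of an ordered type and is passed separately, so that the
  restriction of \<open>M\<close> to a full subposet \<open>Q\<close> is \<open>M\<close> itself, regarded over \<open>Q\<close>. The order on pairs is
  the product order.
\<close>

record ('p, 'v) poset_rep =
  vs_at :: "'p \<Rightarrow> 'v set"
  map_at :: "'p \<Rightarrow> 'p \<Rightarrow> 'v \<Rightarrow> 'v"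

definition linear_on ::
    "('k::field \<Rightarrow> 'v::ab_group_add \<Rightarrow> 'v) \<Rightarrow> ('k \<Rightarrow> 'w::ab_group_add \<Rightarrow> 'w) \<Rightarrow> 'v set \<Rightarrow> ('v \<Rightarrow> 'w) \<Rightarrow> bool"
  where
  "linear_on s t V f \<longleftrightarrow>
     (\<forall>x\<in>V. \<forall>y\<in>V. f (x + y) = f x + f y) \<and> (\<forall>c. \<forall>x\<in>V. f (s c x) = t c (f x))"

definition is_rep ::
    "('k::field \<Rightarrow> 'v::ab_group_add \<Rightarrow> 'v) \<Rightarrow> 'p::order set \<Rightarrow> ('p, 'v) poset_rep \<Rightarrow> bool" where
  "is_rep s P M \<longleftrightarrow>
     (\<forall>p\<in>P. module.subspace s (vs_at M p) \<and> (\<exists>B. finite B \<and> module.span s B = vs_at M p)) \<and>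
     (\<forall>p\<in>P. \<forall>q\<in>P. p \<le> q \<longrightarrow>
        map_at M p q ` vs_at M p \<subseteq> vs_at M q \<and> linear_on s s (vs_at M p) (map_at M p q)) \<and>
     (\<forall>p\<in>P. \<forall>v\<in>vs_at M p. map_at M p p v = v) \<and>
     (\<forall>p\<in>P. \<forall>q\<in>P. \<forall>r\<in>P. p \<le> q \<longrightarrow> q \<le> r \<longrightarrow>
        (\<forall>v\<in>vs_at M p. map_at M q r (map_at M p q v) = map_at M p r v))"

text \<open>
  Components of a morphism are set to 0 off their domain, so that a natural transformation is
  represented by exactly one function and the set of morphisms is a vector space under the
  pointwise operations.
\<close>

definition rep_hom ::
    "('k::field \<Rightarrow> 'v::ab_group_add \<Rightarrow> 'v) \<Rightarrow> ('k \<Rightarrow> 'w::ab_group_add \<Rightarrow> 'w) \<Rightarrow> 'p::order set \<Rightarrow>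
     ('p, 'v) poset_rep \<Rightarrow> ('p, 'w) poset_rep \<Rightarrow> ('p \<Rightarrow> 'v \<Rightarrow> 'w) set" where
  "rep_hom s t P M N =
     {\<phi>. (\<forall>p\<in>P. \<phi> p ` vs_at M p \<subseteq> vs_at N p \<and> linear_on s t (vs_at M p) (\<phi> p)) \<and>
         (\<forall>p\<in>P. \<forall>q\<in>P. p \<le> q \<longrightarrow>
            (\<forall>v\<in>vs_at M p. \<phi> q (map_at M p q v) = map_at N p q (\<phi> p v))) \<and>
         (\<forall>p v. p \<notin> P \<or> v \<notin> vs_at M p \<longrightarrow> \<phi> p v = 0)}"

definition hom_dim ::
    "('k::field \<Rightarrow> 'v::ab_group_add \<Rightarrow> 'v) \<Rightarrow> ('k \<Rightarrow> 'w::ab_group_add \<Rightarrow> 'w) \<Rightarrow> 'p::order set \<Rightarrow>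
     ('p, 'v) poset_rep \<Rightarrow> ('p, 'w) poset_rep \<Rightarrow> nat" where
  "hom_dim s t P M N = vector_space.dim (\<lambda>c \<phi> p v. t c (\<phi> p v)) (rep_hom s t P M N)"

definition rep_iso ::
    "('k::field \<Rightarrow> 'v::ab_group_add \<Rightarrow> 'v) \<Rightarrow> ('k \<Rightarrow> 'w::ab_group_add \<Rightarrow> 'w) \<Rightarrow> 'p::order set \<Rightarrow>
     ('p, 'v) poset_rep \<Rightarrow> ('p, 'w) poset_rep \<Rightarrow> bool" where
  "rep_iso s t P M N \<longleftrightarrow>
     (\<exists>\<phi>\<in>rep_hom s t P M N. \<forall>p\<in>P. bij_betw (\<phi> p) (vs_at M p) (vs_at N p))"

definition rep_plus ::
    "('p, 'v) poset_rep \<Rightarrow> ('p, 'w) poset_rep \<Rightarrow> ('p, 'v \<times> 'w) poset_rep" where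
  "rep_plus M N =
     \<lparr>vs_at = (\<lambda>p. vs_at M p \<times> vs_at N p),
      map_at = (\<lambda>p q (v, w). (map_at M p q v, map_at N p q w))\<rparr>"

definition scale_prod ::
    "('k \<Rightarrow> 'v \<Rightarrow> 'v) \<Rightarrow> ('k \<Rightarrow> 'w \<Rightarrow> 'w) \<Rightarrow> 'k \<Rightarrow> 'v \<times> 'w \<Rightarrow> 'v \<times> 'w" where
  "scale_prod s t c = map_prod (s c) (t c)"

definition scale_fun :: "('k \<Rightarrow> 'v \<Rightarrow> 'v) \<Rightarrow> 'k \<Rightarrow> ('i \<Rightarrow> 'v) \<Rightarrow> 'i \<Rightarrow> 'v" where
  "scale_fun s c f = (\<lambda>i. s c (f i))"

text \<open>The direct sum of the representations \<open>N 0, \<dots>, N (n - 1)\<close>.\<close>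

definition rep_sum ::
    "nat \<Rightarrow> (nat \<Rightarrow> ('p, 'v::ab_group_add) poset_rep) \<Rightarrow> ('p, nat \<Rightarrow> 'v) poset_rep" where
  "rep_sum n N =
     \<lparr>vs_at = (\<lambda>p. {f. (\<forall>j<n. f j \<in> vs_at (N j) p) \<and> (\<forall>j\<ge>n. f j = 0)}),
      map_at = (\<lambda>p q f j. if j < n then map_at (N j) p q (f j) else 0)\<rparr>"

text \<open>
  For indecomposable \<open>N \<noteq> 0\<close>, the multiplicity of \<open>N\<close> as a direct summand of \<open>M\<close> is the largest \<open>m\<close>
  such that \<open>M\<close> is isomorphic to \<open>N^m \<oplus> M'\<close> for some \<open>M'\<close>. A complement \<open>M'\<close> can always be chosen
  in the ambient space of \<open>M\<close>.
\<close>

definition summand_multiplicity ::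
    "('k::field \<Rightarrow> 'v::ab_group_add \<Rightarrow> 'v) \<Rightarrow> ('k \<Rightarrow> 'w::ab_group_add \<Rightarrow> 'w) \<Rightarrow> 'p::order set \<Rightarrow>
     ('p, 'v) poset_rep \<Rightarrow> ('p, 'w) poset_rep \<Rightarrow> nat" where
  "summand_multiplicity s t P N M =
     (GREATEST m. \<exists>M'. is_rep t P M' \<and>
        rep_iso t (scale_prod (scale_fun s) t) P M (rep_plus (rep_sum m (\<lambda>_. N)) M'))"

section \<open>Quotients, limits, colimits\<close>

text \<open>
  The quotient of the ambient space by a subspace \<open>U\<close> is realised as the image of a linear
  projection \<open>\<pi>\<close> with kernel \<open>U\<close>; \<open>\<pi>\<close> is the quotient map. For a subspace \<open>V\<close> containing \<open>U\<close>, the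
  image of \<open>V\<close> is contained in \<open>V\<close> and is isomorphic to \<open>V / U\<close>.
\<close>

definition quot_map :: "('k::field \<Rightarrow> 'v::ab_group_add \<Rightarrow> 'v) \<Rightarrow> 'v set \<Rightarrow> 'v \<Rightarrow> 'v" where
  "quot_map s U = (SOME \<pi>. Vector_Spaces.linear s s \<pi> \<and> (\<forall>v. \<pi> (\<pi> v) = \<pi> v) \<and> {v. \<pi> v = 0} = U)"

definition lim_space :: "'p::order set \<Rightarrow> ('p, 'v::ab_group_add) poset_rep \<Rightarrow> ('p \<Rightarrow> 'v) set" where
  "lim_space I M =
     {f. (\<forall>p\<in>I. f p \<in> vs_at M p) \<and> (\<forall>p. p \<notin> I \<longrightarrow> f p = 0) \<and>
         (\<forall>p\<in>I. \<forall>q\<in>I. p \<le> q \<longrightarrow> map_at M p q (f p) = f q)}"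

text \<open>
  The colimit is the quotient of the direct sum of the spaces \<open>vs_at M p\<close> (finitely supported
  families) by the subspace \<open>colim_relations\<close>; \<open>colim_inj s I M p\<close> is the canonical map from
  \<open>vs_at M p\<close> to it.
\<close>

definition single :: "'p \<Rightarrow> 'v::zero \<Rightarrow> 'p \<Rightarrow> 'v" where
  "single p v = (\<lambda>q. if q = p then v else 0)"

definition colim_relations ::
    "('k::field \<Rightarrow> 'v::ab_group_add \<Rightarrow> 'v) \<Rightarrow> 'p::order set \<Rightarrow> ('p, 'v) poset_rep \<Rightarrow> ('p \<Rightarrow> 'v) set" where
  "colim_relations s I M =
     module.span (scale_fun s)
       {single p v - single q (map_at M p q v) | p q v. p \<in> I \<and> q \<in> I \<and> p \<le> q \<and> v \<in> vs_at M p}"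

definition colim_inj ::
    "('k::field \<Rightarrow> 'v::ab_group_add \<Rightarrow> 'v) \<Rightarrow> 'p::order set \<Rightarrow> ('p, 'v) poset_rep \<Rightarrow>
     'p \<Rightarrow> 'v \<Rightarrow> 'p \<Rightarrow> 'v" where
  "colim_inj s I M p v = quot_map (scale_fun s) (colim_relations s I M) (single p v)"

text \<open>
  The canonical map from the limit to the colimit factors through \<open>vs_at M p\<close> for any \<open>p \<in> I\<close>; for
  connected \<open>I\<close> it does not depend on the choice of \<open>p\<close>.
\<close>

definition lim_to_colim ::
    "('k::field \<Rightarrow> 'v::ab_group_add \<Rightarrow> 'v) \<Rightarrow> 'p::order set \<Rightarrow> ('p, 'v) poset_rep \<Rightarrow>
     ('p \<Rightarrow> 'v) \<Rightarrow> 'p \<Rightarrow> 'v" where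
  "lim_to_colim s I M f = (let p = (SOME p. p \<in> I) in colim_inj s I M p (f p))"

definition generalized_rank ::
    "('k::field \<Rightarrow> 'v::ab_group_add \<Rightarrow> 'v) \<Rightarrow> 'p::order set \<Rightarrow> ('p, 'v) poset_rep \<Rightarrow> nat" where
  "generalized_rank s I M =
     vector_space.dim (scale_fun s) (lim_to_colim s I M ` lim_space I M)"

section \<open>Spreads\<close>

definition poset_connected :: "'p::order set \<Rightarrow> bool" where
  "poset_connected I \<longleftrightarrow>
     (\<forall>x\<in>I. \<forall>y\<in>I. (x, y) \<in> {(u, v). u \<in> I \<and> v \<in> I \<and> (u \<le> v \<or> v \<le> u)}\<^sup>*)"

definition poset_convex :: "'p::order set \<Rightarrow> 'p set \<Rightarrow> bool" where
  "poset_convex P I \<longleftrightarrow> (\<forall>x\<in>I. \<forall>z\<in>I. \<forall>y\<in>P. x \<le> y \<and> y \<le> z \<longrightarrow> y \<in> I)"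

definition spreads :: "'p::order set \<Rightarrow> 'p set set" where
  "spreads P = {I. I \<subseteq> P \<and> I \<noteq> {} \<and> poset_connected I \<and> poset_convex P I}"

definition spread_rep :: "'p set \<Rightarrow> ('p, 'k::field) poset_rep" where
  "spread_rep I =
     \<lparr>vs_at = (\<lambda>p. if p \<in> I then UNIV else {0}),
      map_at = (\<lambda>p q v. if p \<in> I \<and> q \<in> I then v else 0)\<rparr>"

definition segment :: "'p::order set \<Rightarrow> 'p \<Rightarrow> 'p \<Rightarrow> 'p set" where
  "segment P x y = {z\<in>P. x \<le> z \<and> z \<le> y}"

definition segments :: "'p::order set \<Rightarrow> 'p set set" where
  "segments P = {segment P x y | x y. x \<in> P \<and> y \<in> P \<and> x \<le> y}"

text \<open>The hooks in the second set are those whose second endpoint is the added element \<open>\<infinity>\<close>.\<close>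

definition hooks :: "'p::order set \<Rightarrow> 'p set set" where
  "hooks P = {{z\<in>P. x \<le> z \<and> \<not> y \<le> z} | x y. x \<in> P \<and> y \<in> P \<and> x < y} \<union>
             {{z\<in>P. x \<le> z} | x. x \<in> P}"

section \<open>Counts associated with additive invariants and bases\<close>

text \<open>
  Here \<open>\<alpha>M\<close> is the value of an additive invariant at an object \<open>M\<close>, an integer-valued function on
  the index set \<open>T\<close>, and \<open>\<alpha>B i\<close> is its value at the member with index \<open>i \<in> B\<close> of a basis. Values
  are passed instead of the invariant itself because \<open>M\<close> and the basis members have different
  types.
\<close>

definition basis_expansion ::
    "'i set \<Rightarrow> 'x set \<Rightarrow> ('i \<Rightarrow> 'x \<Rightarrow> int) \<Rightarrow> ('x \<Rightarrow> int) \<Rightarrow> ('i \<Rightarrow> int) \<Rightarrow> bool" where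
  "basis_expansion B T \<alpha>B \<alpha>M c \<longleftrightarrow>
     {i. c i \<noteq> 0} \<subseteq> B \<and> finite {i. c i \<noteq> 0} \<and>
     (\<forall>x\<in>T. \<alpha>M x = (\<Sum>i | c i \<noteq> 0. c i * \<alpha>B i x))"

definition basis_count ::
    "'i set \<Rightarrow> 'x set \<Rightarrow> ('i \<Rightarrow> 'x \<Rightarrow> int) \<Rightarrow> ('x \<Rightarrow> int) \<Rightarrow> int" where
  "basis_count B T \<alpha>B \<alpha>M =
     (let c = (THE c. basis_expansion B T \<alpha>B \<alpha>M c) in \<Sum>i | c i \<noteq> 0. c i)"

definition N_gen_pers_diag ::
    "('k::field \<Rightarrow> 'v::ab_group_add \<Rightarrow> 'v) \<Rightarrow> 'p::order set \<Rightarrow> ('p, 'v) poset_rep \<Rightarrow> int" where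
  "N_gen_pers_diag s P M =
     basis_count (spreads P) (spreads P)
       (\<lambda>J I. int (generalized_rank ((*) :: 'k \<Rightarrow> 'k \<Rightarrow> 'k) I (spread_rep J)))
       (\<lambda>I. int (generalized_rank s I M))"

definition map_rank ::
    "('k::field \<Rightarrow> 'v::ab_group_add \<Rightarrow> 'v) \<Rightarrow> ('p, 'v) poset_rep \<Rightarrow> 'p \<Rightarrow> 'p \<Rightarrow> nat" where
  "map_rank s M p q = vector_space.dim s (map_at M p q ` vs_at M p)"

text \<open>In the rank invariant, the segment \<open>[p, q]\<close> is encoded by the pair of its endpoints.\<close>

definition N_sign_barc ::
    "('k::field \<Rightarrow> 'v::ab_group_add \<Rightarrow> 'v) \<Rightarrow> 'p::order set \<Rightarrow> ('p, 'v) poset_rep \<Rightarrow> int" where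
  "N_sign_barc s P M =
     basis_count (segments P) {(p, q). p \<in> P \<and> q \<in> P \<and> p \<le> q}
       (\<lambda>J (p, q). int (map_rank ((*) :: 'k \<Rightarrow> 'k \<Rightarrow> 'k) (spread_rep J) p q))
       (\<lambda>(p, q). int (map_rank s M p q))"

definition N_hook_dec ::
    "('k::field \<Rightarrow> 'v::ab_group_add \<Rightarrow> 'v) \<Rightarrow> 'p::order set \<Rightarrow> ('p, 'v) poset_rep \<Rightarrow> int" where
  "N_hook_dec s P M =
     basis_count (hooks P) (hooks P)
       (\<lambda>J I. int (hom_dim ((*) :: 'k \<Rightarrow> 'k \<Rightarrow> 'k) ((*) :: 'k \<Rightarrow> 'k \<Rightarrow> 'k) P
                    (spread_rep I) (spread_rep J)))
       (\<lambda>I. int (hom_dim ((*) :: 'k \<Rightarrow> 'k \<Rightarrow> 'k) s P (spread_rep I) M))"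

definition N_int_Eul_char ::
    "('k::field \<Rightarrow> 'v::ab_group_add \<Rightarrow> 'v) \<Rightarrow> 'p::order set \<Rightarrow> ('p, 'v) poset_rep \<Rightarrow> int" where
  "N_int_Eul_char s P M =
     basis_count (spreads P) (spreads P)
       (\<lambda>J I. int (hom_dim ((*) :: 'k \<Rightarrow> 'k \<Rightarrow> 'k) ((*) :: 'k \<Rightarrow> 'k \<Rightarrow> 'k) P
                    (spread_rep I) (spread_rep J)))
       (\<lambda>I. int (hom_dim ((*) :: 'k \<Rightarrow> 'k \<Rightarrow> 'k) s P (spread_rep I) M))"

datatype compression = SS | CC | TOT

definition extremal_points :: "'p::order set \<Rightarrow> 'p set" where
  "extremal_points I = {x\<in>I. \<not> (\<exists>y\<in>I. y < x)} \<union> {x\<in>I. \<not> (\<exists>y\<in>I. x < y)}"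

fun compress :: "compression \<Rightarrow> (int \<times> int) set \<Rightarrow> (int \<times> int) set" where
  "compress SS I = extremal_points I"
| "compress CC I = (fst ` extremal_points I \<times> snd ` extremal_points I) \<inter> I"
| "compress TOT I = I"

definition N_int_dec_repl ::
    "('k::field \<Rightarrow> 'v::ab_group_add \<Rightarrow> 'v) \<Rightarrow> compression \<Rightarrow> (int \<times> int) set \<Rightarrow>
     (int \<times> int, 'v) poset_rep \<Rightarrow> int" where
  "N_int_dec_repl s star P M =
     basis_count (spreads P) (spreads P)
       (\<lambda>J I. int (summand_multiplicity ((*) :: 'k \<Rightarrow> 'k \<Rightarrow> 'k) ((*) :: 'k \<Rightarrow> 'k \<Rightarrow> 'k)
                    (compress star I) (spread_rep I) (spread_rep J)))
       (\<lambda>I. int (summand_multiplicity ((*) :: 'k \<Rightarrow> 'k \<Rightarrow> 'k) s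
                    (compress star I) (spread_rep I) M))"

section \<open>Bigraded modules\<close>

definition grid :: "nat \<Rightarrow> nat \<Rightarrow> (int \<times> int) set" where
  "grid a b = {0..<int a} \<times> {0..<int b}"

definition pad :: "'p set \<Rightarrow> ('p, 'v::ab_group_add) poset_rep \<Rightarrow> ('p, 'v) poset_rep" where
  "pad P M =
     \<lparr>vs_at = (\<lambda>p. if p \<in> P then vs_at M p else {0}),
      map_at = (\<lambda>p q v. if p \<in> P \<and> q \<in> P then map_at M p q v else 0)\<rparr>"

definition total_dim ::
    "('k::field \<Rightarrow> 'v::ab_group_add \<Rightarrow> 'v) \<Rightarrow> (int \<times> int \<Rightarrow> 'v set) \<Rightarrow> nat" where
  "total_dim s V = Sum_any (\<lambda>p. vector_space.dim s (V p))"

text \<open>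
  Multiplication by the monomial of degree \<open>e \<ge> 0\<close> is given in each degree by a structure map;
  \<open>mult_image M e\<close> is the bigraded submodule which is its image.
\<close>

definition mult_image ::
    "(int \<times> int, 'v) poset_rep \<Rightarrow> int \<times> int \<Rightarrow> int \<times> int \<Rightarrow> 'v set" where
  "mult_image M e = (\<lambda>p. map_at M (p - e) p ` vs_at M (p - e))"

definition N_sq ::
    "('k::field \<Rightarrow> 'v::ab_group_add \<Rightarrow> 'v) \<Rightarrow> (int \<times> int) set \<Rightarrow>
     (int \<times> int, 'v) poset_rep \<Rightarrow> int" where
  "N_sq s P M =
     (let M' = pad P M in
        int (total_dim s (vs_at M'))
        - int (total_dim s (mult_image M' (1, 0)))
        - int (total_dim s (mult_image M' (0, 1)))
        + int (total_dim s (mult_image M' (1, 1))))"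

definition shift_rep ::
    "(int \<times> int, 'v) poset_rep \<Rightarrow> int \<times> int \<Rightarrow> (int \<times> int, 'v) poset_rep" where
  "shift_rep M e =
     \<lparr>vs_at = (\<lambda>p. vs_at M (p + e)), map_at = (\<lambda>p q. map_at M (p + e) (q + e))\<rparr>"

definition ker_rep ::
    "('p, 'v) poset_rep \<Rightarrow> ('p \<Rightarrow> 'v \<Rightarrow> 'w::zero) \<Rightarrow> ('p, 'v) poset_rep" where
  "ker_rep M \<phi> = \<lparr>vs_at = (\<lambda>p. {v\<in>vs_at M p. \<phi> p v = 0}), map_at = map_at M\<rparr>"

text \<open>The cokernel of \<open>\<phi> : M \<rightarrow> N\<close>.\<close>

definition coker_rep ::
    "('k::field \<Rightarrow> 'w::ab_group_add \<Rightarrow> 'w) \<Rightarrow> ('p, 'v) poset_rep \<Rightarrow> ('p, 'w) poset_rep \<Rightarrow>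
     ('p \<Rightarrow> 'v \<Rightarrow> 'w) \<Rightarrow> ('p, 'w) poset_rep" where
  "coker_rep t M N \<phi> =
     \<lparr>vs_at = (\<lambda>p. quot_map t (\<phi> p ` vs_at M p) ` vs_at N p),
      map_at = (\<lambda>p q w. quot_map t (\<phi> q ` vs_at M q) (map_at N p q w))\<rparr>"

text \<open>The morphism \<open>xy : M[-1,-1] \<rightarrow> M\<close>.\<close>

definition mult_xy :: "(int \<times> int, 'v) poset_rep \<Rightarrow> int \<times> int \<Rightarrow> 'v \<Rightarrow> 'v" where
  "mult_xy M p = map_at M (p + (- 1, - 1)) p"

definition spread_curves :: "(int \<times> int) set set" where
  "spread_curves = {I\<in>spreads UNIV. \<forall>p\<in>I. p + (1, 1) \<notin> I}"

text \<open>
  The number of summands in a decomposition into spread curve representations; it is unique by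
  the Krull-Schmidt property.
\<close>

definition curve_count ::
    "('k::field \<Rightarrow> 'v::ab_group_add \<Rightarrow> 'v) \<Rightarrow> (int \<times> int, 'v) poset_rep \<Rightarrow> nat" where
  "curve_count s M =
     (THE n. \<exists>C. (\<forall>j<n. C j \<in> spread_curves) \<and>
        rep_iso s (scale_fun ((*) :: 'k \<Rightarrow> 'k \<Rightarrow> 'k)) UNIV M (rep_sum n (\<lambda>j. spread_rep (C j))))"

definition N_Bth ::
    "('k::field \<Rightarrow> 'v::ab_group_add \<Rightarrow> 'v) \<Rightarrow> (int \<times> int) set \<Rightarrow>
     (int \<times> int, 'v) poset_rep \<Rightarrow> int" where
  "N_Bth s P M =
     (let M' = pad P M
      in int (curve_count s (coker_rep s (shift_rep M' (- 1, - 1)) M' (mult_xy M'))))"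

definition N_Dth ::
    "('k::field \<Rightarrow> 'v::ab_group_add \<Rightarrow> 'v) \<Rightarrow> (int \<times> int) set \<Rightarrow>
     (int \<times> int, 'v) poset_rep \<Rightarrow> int" where
  "N_Dth s P M =
     (let M' = pad P M
      in int (curve_count s (ker_rep (shift_rep M' (- 1, - 1)) (mult_xy M'))))"

end

theory Submission
  imports Defs
begin

text \<open>
  Put $L(r) = \sum_p r(p,p) - r(p-(1,0),p) - r(p-(0,1),p) + r(p-(1,1),p)$ for a function $r$ of
  pairs of grid points. All eight counts equal $L$ of the rank function of $M$. For $N^2$ this is
  the definition. If $r$ is the rank function of a spread representation, then $L(r) = 1$, because
  $L(r)$ counts the nonempty columns minus the adjacent pairs of nonempty columns. Since the
  rank function is a linear function of each of the additive invariants, the sum of the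
  coefficients of an expansion is $L$ of the rank function; that the expansion exists and is
  unique follows from unitriangularity of a square integer matrix. For Hom dimensions between
  spreads the matrix is a product of two unitriangular ones, since the images of
  morphisms from $k_I$ to $k_J$ are the spreads that are closed downwards in $I$ and upwards in $J$.

  The cokernel and the kernel of $xy$ are annihilated by $xy$ and have the same value of $L$ as $M$, by
  rank-nullity. A finite representation annihilated by $xy$ has bases that $x$ and $y$
  map injectively into each other up to zeros; these are constructed along the levels $p_1 - p_2$, and
  their connected components are the spread curves. Hence the number of curves is $L$.
\<close>

text \<open>The obstacle is the decomposition of a representation with xy = 0. Bases chosen vertex
  by vertex do not fit together: a change of basis on one level has to respect the images and
  kernels that come from all lower levels. These conditions accumulate into families of subspaces,
  and compatible bases are available because every family is a chain. Chains survive the passage to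
  the next level since images under x lie in the kernel of y and hence below every preimage under y.
  Moreover, following x forwards and y backwards strictly raises the level, so strings cannot close
  up and every component is a curve.

  On the side of the invariants, the object itself is evaluated only at segments or hooks. The ranks
  can be recovered from these values, and every expansion of the ranks in spreads has coefficient
  sum L. In the same way the number of curves is unique because L computes it for every
  decomposition.\<close>

section \<open>Linear algebra on subspaces\<close>

text \<open>The same conjunction as in \<open>is_rep\<close>, so that it can be folded
  there.\<close>

definition fin_dim :: "('k::field \<Rightarrow> 'v::ab_group_add \<Rightarrow> 'v) \<Rightarrow> 'v set \<Rightarrow> bool" where
  "fin_dim s V \<longleftrightarrow> module.subspace s V \<and> (\<exists>B. finite B \<and> module.span s B = V)"

context vector_space
begin

lemma fin_dim_basis:
  assumes "fin_dim scale V"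
  obtains B where "finite B" "independent B" "span B = V"
proof -
  obtain B where B: "finite B" "span B = V" using assms unfolding fin_dim_def by auto
  obtain C where "C \<subseteq> B" "independent C" "B \<subseteq> span C" using maximal_independent_subset by blast
  then have "span C = span B" by (meson span_mono span_minimal subspace_span subset_antisym)
  with B \<open>C \<subseteq> B\<close> \<open>independent C\<close> show ?thesis by (intro that[of C]) (auto intro: finite_subset)
qed

lemma fin_dim_subspace: "fin_dim scale V \<Longrightarrow> subspace V"
  by (simp add: fin_dim_def)

lemma fin_dim_span: "finite B \<Longrightarrow> fin_dim scale (span B)"
  by (auto simp: fin_dim_def)

lemma fin_dim_zero: "fin_dim scale {0}"
  using fin_dim_span[of "{}"] by simp

lemma fin_dim_independent:
  assumes "fin_dim scale V" "independent A" "A \<subseteq> V"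
  shows "finite A" "card A \<le> dim V"
proof -
  obtain B where B: "finite B" "independent B" "span B = V" using assms(1) by (rule fin_dim_basis)
  then have "finite A \<and> card A \<le> card B" using assms by (intro independent_span_bound) auto
  moreover have "dim V = card B" using B by (metis dim_span_eq_card_independent)
  ultimately show "finite A" "card A \<le> dim V" by auto
qed

lemma fin_dim_subset:
  assumes "fin_dim scale V" "subspace U" "U \<subseteq> V"
  shows "fin_dim scale U"
proof -
  obtain B where B: "B \<subseteq> U" "independent B" "U \<subseteq> span B" by (rule basis_exists)
  have "finite B" using fin_dim_independent(1)[OF assms(1) B(2)] B(1) assms(3) by (meson subset_trans)
  moreover have "span B = U" using B assms(2) by (meson span_minimal subset_antisym)
  ultimately show ?thesis using assms(2) by (auto simp: fin_dim_def)
qed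

lemma fin_dim_dim_mono:
  assumes "fin_dim scale V" "U \<subseteq> V"
  shows "dim U \<le> dim V"
proof -
  obtain B where B: "B \<subseteq> U" "independent B" "U \<subseteq> span B" "card B = dim U" by (rule basis_exists)
  then show ?thesis using fin_dim_independent(2)[OF assms(1) B(2)] assms(2) by (metis subset_trans)
qed

text \<open>The expansions of \<open>v\<close> in \<open>A\<close> and in \<open>C\<close> both
  coincide with its expansion in \<open>B\<close>, whose support is therefore empty.\<close>

lemma span_disjoint_zero:
  assumes "independent B" "A \<subseteq> B" "C \<subseteq> B" "A \<inter> C = {}" "v \<in> span A" "v \<in> span C"
  shows "v = 0"
proof -
  have eq: "representation B v = representation A v"
    by (rule representation_extend[OF assms(1,5,2)])
  have eq': "representation B v = representation C v"
    by (rule representation_extend[OF assms(1,6,3)])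
  have "representation B v b = 0" for b
    using representation_ne_zero[of A v b] representation_ne_zero[of C v b] eq eq' assms(4) by auto
  moreover have "v \<in> span B" using assms(2,5) span_mono[of A B] by auto
  ultimately show ?thesis using sum_nonzero_representation_eq[OF assms(1), of v] by simp
qed

text \<open>The choice in \<open>quot_map\<close> is legitimate because every subspace
  \<open>U\<close> admits a linear retraction \<open>g\<close> of the whole space onto it; then
  \<open>v - g v\<close> is a projection with kernel \<open>U\<close>.\<close>

lemma quot_map:
  assumes "subspace U"
  shows "Vector_Spaces.linear scale scale (quot_map scale U)"
    and "quot_map scale U (quot_map scale U v) = quot_map scale U v"
    and "quot_map scale U v = 0 \<longleftrightarrow> v \<in> U"
proof -
  interpret vector_space_pair scale scale by unfold_locales
  obtain g where g: "g ` UNIV \<subseteq> U" "Vector_Spaces.linear scale scale g" "\<forall>v\<in>U. g v = v"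
    using linear_exists_left_inverse_on[OF linear_id assms] by auto
  let ?h = "\<lambda>v. v - g v"
  have "Vector_Spaces.linear scale scale ?h"
    by (intro linear_compose_sub linear_ident g)
  moreover have "?h (?h v) = ?h v" for v using g(1,3) linear_diff[OF g(2)] by (metis (no_types, lifting) diff_self diff_zero rangeI subsetD)
  moreover have "{v. ?h v = 0} = U" using g by auto
  ultimately have "\<exists>\<pi>. Vector_Spaces.linear scale scale \<pi> \<and> (\<forall>v. \<pi> (\<pi> v) = \<pi> v) \<and> {v. \<pi> v = 0} = U"
    by (intro exI[of _ ?h] conjI allI)
  from someI_ex[OF this, folded quot_map_def]
  show "Vector_Spaces.linear scale scale (quot_map scale U)"
    "quot_map scale U (quot_map scale U v) = quot_map scale U v"
    "quot_map scale U v = 0 \<longleftrightarrow> v \<in> U" by auto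
qed

lemma dim_zero_space: "dim {0} = 0"
  by (metis card.empty dim_span_eq_card_independent independent_empty span_empty)

end

lemma linear_on_linear: "Vector_Spaces.linear s t f \<Longrightarrow> linear_on s t V f"
  unfolding linear_on_def by (simp add: Vector_Spaces.linear_iff)

lemma linear_on_subset: "linear_on s t V f \<Longrightarrow> U \<subseteq> V \<Longrightarrow> linear_on s t U f"
  unfolding linear_on_def by blast

lemma linear_on_compose:
  "linear_on s t V f \<Longrightarrow> f ` V \<subseteq> W \<Longrightarrow> linear_on t u W g \<Longrightarrow> linear_on s u V (\<lambda>x. g (f x))"
  unfolding linear_on_def image_subset_iff by simp

section \<open>Linear maps that are controlled only on a subspace\<close>

context vector_space_pair
begin

text \<open>Structure maps are controlled only on the space at a vertex. Extending them linearly
  from a basis of that space makes facts about globally linear maps applicable.\<close>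

lemma linear_on_extend:
  assumes f: "linear_on (*a) (*b) V f" and V: "vs1.subspace V"
  shows "\<exists>g. Vector_Spaces.linear (*a) (*b) g \<and> (\<forall>v\<in>V. g v = f v)"
proof -
  obtain B where B: "B \<subseteq> V" "vs1.independent B" "V \<subseteq> vs1.span B" by (rule vs1.basis_exists)
  obtain g where g: "Vector_Spaces.linear (*a) (*b) g" "\<And>x. x \<in> B \<Longrightarrow> g x = f x"
    using linear_independent_extend[OF B(2), of f] by blast
  have "v \<in> V \<and> g v = f v" if "v \<in> vs1.span B" for v
    using that
  proof (induction rule: vs1.span_induct_alt)
    case base
    have "0 \<in> V" using V vs1.subspace_0 by blast
    then have "f (0 *a 0) = 0 *b f 0" using f unfolding linear_on_def by blast
    then have "f 0 = 0" by simp
    then show ?case using V vs1.subspace_0 linear_0[OF g(1)] by auto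
  next
    case (step c x y)
    then have x: "x \<in> V" "c *a x \<in> V" using B V vs1.subspace_scale by auto
    have "f (c *a x + y) = c *b f x + f y" using f x step B unfolding linear_on_def by auto
    then show ?case using step x g V by (simp add: linear_add linear_scale vs1.subspace_add)
  qed
  then show ?thesis using B g by blast
qed

lemma linear_on_eq:
  assumes "linear_on (*a) (*b) (vs1.span A) f" "linear_on (*a) (*b) (vs1.span A) g"
    "\<And>a. a \<in> A \<Longrightarrow> f a = g a" "v \<in> vs1.span A"
  shows "f v = g v"
proof -
  obtain f' where f': "Vector_Spaces.linear (*a) (*b) f'" "\<And>v. v \<in> vs1.span A \<Longrightarrow> f' v = f v"
    using linear_on_extend[OF assms(1)] by blast
  obtain g' where g': "Vector_Spaces.linear (*a) (*b) g'" "\<And>v. v \<in> vs1.span A \<Longrightarrow> g' v = g v"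
    using linear_on_extend[OF assms(2)] by blast
  have "f' v = g' v"
    by (rule linear_eq_on[OF f'(1) g'(1) assms(4)]) (simp add: f'(2) g'(2) vs1.span_base assms(3))
  then show ?thesis using f'(2) g'(2) assms(4) by simp
qed

lemma linear_on_zero: "linear_on (*a) (*b) V f \<Longrightarrow> vs1.subspace V \<Longrightarrow> f 0 = 0"
  using linear_on_extend linear_0 vs1.subspace_0 by metis

lemma linear_on_add: "linear_on (*a) (*b) V f \<Longrightarrow> x \<in> V \<Longrightarrow> y \<in> V \<Longrightarrow> f (x + y) = f x + f y"
  by (simp add: linear_on_def)

lemma linear_on_scale: "linear_on (*a) (*b) V f \<Longrightarrow> x \<in> V \<Longrightarrow> f (c *a x) = c *b f x"
  by (simp add: linear_on_def)

lemma linear_on_diff: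
  assumes "linear_on (*a) (*b) V f" "vs1.subspace V" "x \<in> V" "y \<in> V"
  shows "f (x - y) = f x - f y"
  using linear_on_extend[OF assms(1,2)] assms vs1.subspace_diff linear_diff by metis

lemma linear_on_sum:
  assumes "linear_on (*a) (*b) V f" "vs1.subspace V" "\<And>i. i \<in> I \<Longrightarrow> x i \<in> V"
  shows "f (\<Sum>i\<in>I. x i) = (\<Sum>i\<in>I. f (x i))"
proof -
  obtain g where g: "Vector_Spaces.linear (*a) (*b) g" "\<And>v. v \<in> V \<Longrightarrow> g v = f v"
    using linear_on_extend[OF assms(1,2)] by blast
  have "f (\<Sum>i\<in>I. x i) = g (\<Sum>i\<in>I. x i)" using assms by (simp add: g(2) vs1.subspace_sum)
  also have "\<dots> = (\<Sum>i\<in>I. g (x i))" by (rule linear_sum[OF g(1)])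
  also have "\<dots> = (\<Sum>i\<in>I. f (x i))" using assms(3) g(2) by simp
  finally show ?thesis .
qed

lemma linear_on_inj_iff:
  assumes "linear_on (*a) (*b) V f" "vs1.subspace V"
  shows "inj_on f V \<longleftrightarrow> (\<forall>v\<in>V. f v = 0 \<longrightarrow> v = 0)"
proof
  assume "inj_on f V"
  then show "\<forall>v\<in>V. f v = 0 \<longrightarrow> v = 0"
    using linear_on_zero[OF assms] vs1.subspace_0[OF assms(2)] by (metis inj_onD)
next
  assume *: "\<forall>v\<in>V. f v = 0 \<longrightarrow> v = 0"
  show "inj_on f V"
  proof (rule inj_onI)
    fix x y assume "x \<in> V" "y \<in> V" "f x = f y"
    then have "f (x - y) = 0" "x - y \<in> V"
      using linear_on_diff[OF assms] vs1.subspace_diff[OF assms(2)] by auto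
    then show "x = y" using * by auto
  qed
qed

lemma subspace_image_on:
  assumes "linear_on (*a) (*b) V f" "vs1.subspace V" "vs1.subspace U" "U \<subseteq> V"
  shows "vs2.subspace (f ` U)"
proof -
  obtain g where g: "Vector_Spaces.linear (*a) (*b) g" "\<And>v. v \<in> V \<Longrightarrow> g v = f v"
    using linear_on_extend[OF assms(1,2)] by blast
  have "g ` U = f ` U" using g assms by (auto intro!: image_cong)
  then show ?thesis using linear_subspace_image[OF g(1) assms(3)] by simp
qed

lemma subspace_preimage_on:
  assumes "linear_on (*a) (*b) V f" "vs1.subspace V" "vs2.subspace W"
  shows "vs1.subspace {v \<in> V. f v \<in> W}"
proof -
  obtain g where g: "Vector_Spaces.linear (*a) (*b) g" "\<And>v. v \<in> V \<Longrightarrow> g v = f v"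
    using linear_on_extend[OF assms(1,2)] by blast
  have "{v \<in> V. f v \<in> W} = V \<inter> {v. g v \<in> W}" using g by auto
  then show ?thesis using linear_subspace_linear_preimage[OF g(1) assms(3)] assms(2) vs1.subspace_inter
    by simp
qed

lemma subspace_kernel_on:
  assumes "linear_on (*a) (*b) V f" "vs1.subspace V"
  shows "vs1.subspace {v \<in> V. f v = 0}"
  using subspace_preimage_on[OF assms vs2.subspace_single_0] by simp

lemma span_image_on:
  assumes "linear_on (*a) (*b) V f" "vs1.subspace V" "A \<subseteq> V"
  shows "vs2.span (f ` A) = f ` vs1.span A"
proof -
  obtain g where g: "Vector_Spaces.linear (*a) (*b) g" "\<And>v. v \<in> V \<Longrightarrow> g v = f v"
    using linear_on_extend[OF assms(1,2)] by blast
  have "vs1.span A \<subseteq> V" using assms vs1.span_minimal by blast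
  then have "g ` A = f ` A" "g ` vs1.span A = f ` vs1.span A" using g assms by (auto intro!: image_cong)
  then show ?thesis using linear_span_image[OF g(1), of A] by simp
qed

lemma fin_dim_image:
  assumes "linear_on (*a) (*b) V f" "fin_dim (*a) V"
  shows "fin_dim (*b) (f ` V)"
proof -
  obtain B where B: "finite B" "vs1.independent B" "vs1.span B = V" using assms(2) by (rule vs1.fin_dim_basis)
  then have "B \<subseteq> V" using vs1.span_superset by blast
  then have "vs2.span (f ` B) = f ` V" using span_image_on[OF assms(1) vs1.fin_dim_subspace[OF assms(2)]] B by auto
  then show ?thesis using B vs2.fin_dim_span[of "f ` B"] by simp
qed

lemma independent_image_on:
  assumes "linear_on (*a) (*b) V f" "vs1.subspace V" "vs1.independent A" "A \<subseteq> V"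
    "inj_on f (vs1.span A)"
  shows "vs2.independent (f ` A)"
proof -
  obtain g where g: "Vector_Spaces.linear (*a) (*b) g" "\<And>v. v \<in> V \<Longrightarrow> g v = f v"
    using linear_on_extend[OF assms(1,2)] by blast
  have sp: "vs1.span A \<subseteq> V" using assms vs1.span_minimal by blast
  have "inj_on g (vs1.span A)" using assms(5) g sp by (metis inj_on_cong subsetD)
  then have "vs2.independent (g ` A)" by (rule linear_independent_injective_image[OF g(1) assms(3)])
  then show ?thesis using g assms(4) by (metis image_cong subsetD)
qed

lemma dim_image_inj_on:
  assumes "linear_on (*a) (*b) V f" "vs1.subspace V" "inj_on f V" "U \<subseteq> V"
  shows "vs2.dim (f ` U) = vs1.dim U"
proof -
  obtain B where B: "B \<subseteq> U" "vs1.independent B" "U \<subseteq> vs1.span B" "card B = vs1.dim U"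
    by (rule vs1.basis_exists)
  have sp: "vs1.span B \<subseteq> V" using assms vs1.span_minimal B by blast
  have "vs2.independent (f ` B)"
    using B sp assms by (intro independent_image_on[OF assms(1,2)]) (auto intro: inj_on_subset)
  moreover have "f ` U \<subseteq> vs2.span (f ` B)" using B span_image_on[OF assms(1,2), of B] assms(4) by auto
  moreover have "card (f ` B) = vs1.dim U" using B assms by (metis card_image inj_on_subset)
  ultimately show ?thesis using B by (intro vs2.dim_unique[of "f ` B"]) auto
qed

text \<open>Rank-nullity. The vectors that extend a basis of the kernel to a basis of
  \<open>V\<close> span a complement of the kernel, on which \<open>f\<close> is injective.\<close>

lemma dim_image_kernel:
  assumes f: "linear_on (*a) (*b) V f" and V: "fin_dim (*a) V"
  shows "vs1.dim V = vs2.dim (f ` V) + vs1.dim {v \<in> V. f v = 0}"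
proof -
  note sV = vs1.fin_dim_subspace[OF V]
  let ?K = "{v \<in> V. f v = 0}"
  have K: "vs1.subspace ?K" by (rule subspace_kernel_on[OF f sV])
  obtain A where A: "A \<subseteq> ?K" "vs1.independent A" "?K \<subseteq> vs1.span A" "card A = vs1.dim ?K"
    by (rule vs1.basis_exists)
  obtain B where B: "A \<subseteq> B" "B \<subseteq> V" "vs1.independent B" "V \<subseteq> vs1.span B"
    using vs1.maximal_independent_subset_extend[of A V] A by auto
  have fB: "finite B" by (rule vs1.fin_dim_independent(1)[OF V B(3,2)])
  have spA: "vs1.span A \<subseteq> ?K" using K A vs1.span_minimal by blast
  have inj: "inj_on f (vs1.span (B - A))"
  proof -
    have sub: "vs1.span (B - A) \<subseteq> V" using vs1.span_minimal[OF _ sV] B by blast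
    have "v = 0" if v: "v \<in> vs1.span (B - A)" "f v = 0" for v
      using vs1.span_disjoint_zero[OF B(3), of "B - A" A v] B(1) v sub A(3) by auto
    then show ?thesis
      by (subst linear_on_inj_iff[OF linear_on_subset[OF f sub]]) auto
  qed
  have ind: "vs2.independent (f ` (B - A))"
    using B(2) vs1.independent_mono[OF B(3), of "B - A"] by (intro independent_image_on[OF f sV _ _ inj]) auto
  have "f ` V \<subseteq> vs2.span (f ` B)" using span_image_on[OF f sV B(2)] B by auto
  also have "\<dots> = vs2.span (f ` (B - A))"
  proof -
    have "f b \<in> vs2.span (f ` (B - A))" if "b \<in> B" for b
    proof (cases "b \<in> A")
      case True
      then have "f b = 0" using A by blast
      then show ?thesis using vs2.span_zero by simp
    next
      case False then show ?thesis using that by (intro vs2.span_base) blast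
    qed
    then have "vs2.span (f ` B) \<subseteq> vs2.span (f ` (B - A))" by (intro vs2.span_minimal) auto
    moreover have "vs2.span (f ` (B - A)) \<subseteq> vs2.span (f ` B)" by (intro vs2.span_mono) auto
    ultimately show ?thesis by blast
  qed
  finally have "vs2.dim (f ` V) = card (f ` (B - A))"
    using B ind by (intro vs2.dim_unique[of "f ` (B - A)"]) auto
  also have "\<dots> = card (B - A)" using inj by (metis card_image inj_on_subset vs1.span_superset)
  also have "\<dots> = card B - card A" using B fB by (intro card_Diff_subset) (auto intro: finite_subset)
  finally show ?thesis using vs1.dim_unique[OF B(2,4,3) refl] A(4) card_mono[OF fB B(1)] by simp
qed

end

section \<open>Function spaces, products and coordinate spaces\<close>

lemma sum_fun_apply: "(\<Sum>j\<in>J. f j) i = (\<Sum>j\<in>J. f j i)"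
  by (induction J rule: infinite_finite_induct) auto

lemma vector_space_scale_fun: "vector_space s \<Longrightarrow> vector_space (scale_fun s)"
  unfolding vector_space_def scale_fun_def by (auto simp: fun_eq_iff)

lemma vector_space_scale_prod: "vector_space s \<Longrightarrow> vector_space t \<Longrightarrow> vector_space (scale_prod s t)"
  unfolding vector_space_def scale_prod_def by auto

lemma vector_space_scale_fun2: "vector_space s \<Longrightarrow> vector_space (\<lambda>c \<phi> p v. s c (\<phi> p v))"
  unfolding vector_space_def by (auto simp: fun_eq_iff)

lemma vector_space_field: "vector_space ((*) :: 'k::field \<Rightarrow> 'k \<Rightarrow> 'k)"
  by unfold_locales (auto simp: algebra_simps)

lemma subspace_funs:
  "module.subspace (scale_fun ((*) :: 'k::field \<Rightarrow> 'k \<Rightarrow> 'k)) {f :: 'i \<Rightarrow> 'k. \<forall>i. i \<notin> J \<longrightarrow> f i = 0}"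
proof -
  interpret vector_space "scale_fun ((*) :: 'k \<Rightarrow> 'k \<Rightarrow> 'k)"
    by (intro vector_space_scale_fun vector_space_field)
  show ?thesis by (auto simp: subspace_def scale_fun_def)
qed

text \<open>Images in sums of spread representations and Hom spaces between spreads are identified
  with such coordinate spaces, so that dimensions become cardinalities.\<close>

lemma fin_dim_funs:
  fixes J :: "'i set"
  assumes "finite J"
  shows "fin_dim (scale_fun ((*) :: 'k::field \<Rightarrow> 'k \<Rightarrow> 'k)) {f. \<forall>i. i \<notin> J \<longrightarrow> f i = 0}" (is "fin_dim ?s ?V")
    and "vector_space.dim (scale_fun ((*) :: 'k::field \<Rightarrow> 'k \<Rightarrow> 'k)) {f. \<forall>i. i \<notin> J \<longrightarrow> f i = 0} = card J"
proof -
  interpret vector_space ?s by (intro vector_space_scale_fun vector_space_field)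
  let ?e = "\<lambda>j. single j (1::'k)"
  have inj: "inj_on ?e J" by (auto simp: inj_on_def single_def fun_eq_iff split: if_splits)
  have expand: "(\<Sum>j\<in>J. ?s (f j) (?e j)) = f" if "f \<in> ?V" for f
  proof
    fix i
    have "(\<Sum>j\<in>J. ?s (f j) (?e j)) i = (\<Sum>j\<in>J. if j = i then f i else 0)"
      unfolding sum_fun_apply by (intro sum.cong) (auto simp: scale_fun_def single_def)
    then show "(\<Sum>j\<in>J. ?s (f j) (?e j)) i = f i" using that assms by auto
  qed
  have sub: "?e ` J \<subseteq> ?V" by (auto simp: single_def)
  have sp: "?V \<subseteq> span (?e ` J)"
  proof
    fix f assume "f \<in> ?V"
    then show "f \<in> span (?e ` J)"
      by (subst expand[symmetric]) (auto intro!: span_sum span_scale intro: span_base)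
  qed
  have "independent (?e ` J)"
  proof (rule independent_if_scalars_zero)
    fix c x assume *: "(\<Sum>x\<in>?e ` J. ?s (c x) x) = 0" "x \<in> ?e ` J"
    then obtain i where i: "i \<in> J" "x = ?e i" by auto
    let ?f = "\<lambda>j. if j \<in> J then c (?e j) else 0"
    have "0 = (\<Sum>j\<in>J. ?s (c (?e j)) (?e j))" using * by (simp add: sum.reindex[OF inj])
    also have "\<dots> = (\<Sum>j\<in>J. ?s (?f j) (?e j))" by (intro sum.cong) auto
    also have "\<dots> = ?f" by (rule expand) auto
    finally have "?f i = 0" by (simp add: fun_eq_iff)
    then show "c x = 0" using i by simp
  qed (use assms in auto)
  then show "vector_space.dim ?s ?V = card J"
    by (intro dim_unique[OF sub sp]) (auto simp: card_image inj)
  have "span (?e ` J) = ?V" by (intro subset_antisym span_minimal sp sub subspace_funs)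
  then show "fin_dim ?s ?V" using assms fin_dim_span[of "?e ` J"] by auto
qed

section \<open>Bases adapted to a chain of subspaces\<close>

text \<open>A set rather than a sequence, so that images, preimages and intersections of the members
  can be collected without renumbering or deleting repetitions.\<close>

definition flag :: "('k::field \<Rightarrow> 'v::ab_group_add \<Rightarrow> 'v) \<Rightarrow> 'v set \<Rightarrow> 'v set set \<Rightarrow> bool" where
  "flag s V \<F> \<longleftrightarrow> finite \<F> \<and> (\<forall>F\<in>\<F>. module.subspace s F \<and> F \<subseteq> V) \<and>
     (\<forall>F\<in>\<F>. \<forall>G\<in>\<F>. F \<subseteq> G \<or> G \<subseteq> F) \<and> {0} \<in> \<F> \<and> V \<in> \<F>"

definition adapted_basis ::
    "('k::field \<Rightarrow> 'v::ab_group_add \<Rightarrow> 'v) \<Rightarrow> 'v set \<Rightarrow> 'v set set \<Rightarrow> 'v set \<Rightarrow> bool" where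
  "adapted_basis s V \<F> B \<longleftrightarrow> \<not> module.dependent s B \<and> module.span s B = V \<and>
     (\<forall>F\<in>\<F>. module.span s (B \<inter> F) = F)"

context vector_space
begin

text \<open>
  Greedy extension: as long as the basis does not span, a vector outside its span can be taken
  from a smallest member of the chain that is not yet spanned.
\<close>

lemma adapted_extend:
  assumes V: "fin_dim scale V" and flag: "flag scale V \<F>"
    and A: "A \<subseteq> V" "independent A" "\<And>F. F \<in> \<F> \<Longrightarrow> span A \<inter> F \<subseteq> span (A \<inter> F)"
  obtains B where "A \<subseteq> B" "adapted_basis scale V \<F> B"
proof -
  note sV = fin_dim_subspace[OF V]
  \<comment> \<open>For a \<open>B\<close> that does not span yet, adaptedness takes this form; once
    \<open>B\<close> spans \<open>V\<close>, it says that \<open>B\<close> contains a basis of each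
    member.\<close>
  define P where "P B \<longleftrightarrow> A \<subseteq> B \<and> B \<subseteq> V \<and> independent B \<and> (\<forall>F\<in>\<F>. span B \<inter> F \<subseteq> span (B \<inter> F))" for B
  have "P A" using A by (auto simp: P_def)
  moreover have "\<forall>B. P B \<longrightarrow> card B \<le> dim V"
    using fin_dim_independent(2)[OF V] by (simp add: P_def)
  ultimately obtain B where PB: "P B" and max: "\<And>C. P C \<Longrightarrow> card C \<le> card B"
    using ex_has_greatest_nat[of P A card "Suc (dim V)"] by (auto simp: less_Suc_eq_le)
  have B: "A \<subseteq> B" "B \<subseteq> V" "independent B" and adB: "\<And>F. F \<in> \<F> \<Longrightarrow> span B \<inter> F \<subseteq> span (B \<inter> F)"
    using PB by (auto simp: P_def)
  have finB: "finite B" by (rule fin_dim_independent(1)[OF V B(3,2)])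
  have "V \<subseteq> span B"
  proof (rule ccontr)
    assume "\<not> V \<subseteq> span B"
    let ?N = "{F \<in> \<F>. \<not> F \<subseteq> span B}"
    have "finite ?N" "?N \<noteq> {}" using flag \<open>\<not> V \<subseteq> span B\<close> by (auto simp: flag_def)
    then obtain F where F: "F \<in> ?N" "\<And>G. G \<in> ?N \<Longrightarrow> G \<subseteq> F \<Longrightarrow> F = G"
      using finite_has_minimal[of ?N] by blast
    then obtain v where v: "v \<in> F" "v \<notin> span B" by auto
    have "v \<in> V" using v F flag by (auto simp: flag_def)
    \<comment> \<open>Members that contain \<open>F\<close> also contain \<open>v\<close>, while
      smaller members are already contained in \<open>span B\<close> by minimality of
      \<open>F\<close>, so the new vector does no harm there.\<close>
    have "span (insert v B) \<inter> G \<subseteq> span (insert v B \<inter> G)" if G: "G \<in> \<F>" for G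
    proof
      fix w assume w: "w \<in> span (insert v B) \<inter> G"
      then obtain k where k: "w - k *s v \<in> span B" by (auto simp: span_breakdown_eq)
      have sG: "subspace G" using flag G by (auto simp: flag_def)
      show "w \<in> span (insert v B \<inter> G)"
      proof (cases "F \<subseteq> G")
        case True
        then have vG: "v \<in> G" using v by auto
        then have "w - k *s v \<in> span B \<inter> G" using k w sG subspace_diff subspace_scale by auto
        then have "w - k *s v \<in> span (insert v B \<inter> G)"
          using adB[OF G] span_mono[of "B \<inter> G" "insert v B \<inter> G"] by auto
        moreover have "k *s v \<in> span (insert v B \<inter> G)" using vG by (intro span_scale span_base) auto
        ultimately have "(w - k *s v) + k *s v \<in> span (insert v B \<inter> G)" by (rule span_add)
        then show ?thesis by simp
      next
        case False
        then have "G \<subseteq> F" "G \<noteq> F" using flag G F(1) unfolding flag_def by blast+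
        then have "G \<subseteq> span B" using F(2)[of G] G by blast
        then have "w \<in> span B \<inter> G" using w by auto
        then show ?thesis using adB[OF G] span_mono[of "B \<inter> G" "insert v B \<inter> G"] by auto
      qed
    qed
    then have "P (insert v B)"
      using B \<open>v \<in> V\<close> v(2) independent_insertI[OF v(2) B(3)] by (auto simp: P_def)
    then have "card (insert v B) \<le> card B" by (rule max)
    moreover have "v \<notin> B" using v(2) span_base by auto
    ultimately show False using finB by simp
  qed
  then have "span B = V" using B(2) sV span_minimal by (intro subset_antisym) auto
  moreover have "span (B \<inter> F) = F" if "F \<in> \<F>" for F
  proof
    show "span (B \<inter> F) \<subseteq> F" using flag that by (intro span_minimal) (auto simp: flag_def)
    show "F \<subseteq> span (B \<inter> F)" using adB[OF that] flag that \<open>span B = V\<close> by (auto simp: flag_def)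
  qed
  ultimately show ?thesis using that[of B] B by (simp add: adapted_basis_def)
qed

text \<open>
  The inductive step of the construction of string bases, at one vertex: the images of \<open>BU\<close> are
  completed inside the kernel of \<open>g\<close>, and the elements of \<open>BW\<close> in the image of \<open>g\<close> are lifted into
  members of the chain that are as small as possible.
\<close>

lemma adapted_lift:
  assumes V: "fin_dim scale V" and flag: "flag scale V \<F>"
    and f: "linear_on scale scale U f" "f ` U \<subseteq> V" and U: "fin_dim scale U"
    and g: "linear_on scale scale V g" "g ` V \<subseteq> W"
    and gf: "\<And>u. u \<in> U \<Longrightarrow> g (f u) = 0"
    and BU: "independent BU" "span BU = U" "\<And>F. F \<in> \<F> \<Longrightarrow> span (BU \<inter> {u \<in> U. f u \<in> F}) = {u \<in> U. f u \<in> F}"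
    and BW: "independent BW" "\<And>F. F \<in> \<F> \<Longrightarrow> span (BW \<inter> g ` F) = g ` F"
  obtains B where "adapted_basis scale V \<F> B"
    "\<forall>b\<in>BU. f b = 0 \<or> f b \<in> B" "inj_on f {b \<in> BU. f b \<noteq> 0}"
    "\<forall>b\<in>B. g b = 0 \<or> g b \<in> BW" "inj_on g {b \<in> B. g b \<noteq> 0}"
proof -
  interpret P: vector_space_pair scale scale by unfold_locales
  note sV = fin_dim_subspace[OF V] and sU = fin_dim_subspace[OF U]
  define K where "K = {v \<in> V. g v = 0}"
  have sK: "subspace K" unfolding K_def by (rule P.subspace_kernel_on[OF g(1) sV])
  have finK: "fin_dim scale K" by (rule fin_dim_subset[OF V sK]) (auto simp: K_def)
  have fF: "finite \<F>" and sF: "\<And>F. F \<in> \<F> \<Longrightarrow> subspace F \<and> F \<subseteq> V"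
    and chain: "\<And>F G. F \<in> \<F> \<Longrightarrow> G \<in> \<F> \<Longrightarrow> F \<subseteq> G \<or> G \<subseteq> F"
    and zF: "{0} \<in> \<F>" and VF: "V \<in> \<F>" using flag by (auto simp: flag_def)
  have BUU: "BU \<subseteq> U" using BU(2) span_superset by blast
  define N where "N = {b \<in> BU. f b \<noteq> 0}"
  define A where "A = f ` BU - {0}"
  have AN: "A = f ` N" by (auto simp: A_def N_def)
  have spN: "span N \<subseteq> U" using BU(2) span_mono[of N BU] by (auto simp: N_def)
  \<comment> \<open>Since {0} is in the chain, \<open>BU\<close> is adapted to the kernel of
    \<open>f\<close>; hence its elements with nonzero image span a complement of that
    kernel.\<close>
  have ker: "v = 0" if "v \<in> span N" "f v = 0" for v
  proof (rule span_disjoint_zero[OF BU(1)])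
    show "v \<in> span (BU \<inter> {u \<in> U. f u \<in> {0}})" unfolding BU(3)[OF zF] using that spN by auto
  qed (use that in \<open>auto simp: N_def\<close>)
  have injN: "inj_on f (span N)"
    by (subst P.linear_on_inj_iff[OF linear_on_subset[OF f(1) spN]]) (auto intro: ker)
  have indA: "independent A"
    unfolding AN using BUU independent_mono[OF BU(1)]
    by (intro P.independent_image_on[OF f(1) sU _ _ injN]) (auto simp: N_def)
  have spA: "span A = f ` U"
    using P.span_image_on[OF f(1) sU BUU] BU(2) by (simp add: A_def)
  have AK: "A \<subseteq> K" using BUU f(2) gf by (auto simp: A_def K_def)
  have flagK: "flag scale K ((\<lambda>F. F \<inter> K) ` \<F>)"
    unfolding flag_def
  proof (intro conjI ballI)
    show "{0} \<in> (\<lambda>F. F \<inter> K) ` \<F>" using zF subspace_0[OF sK] by (auto intro!: image_eqI[of _ _ "{0}"])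
    show "K \<in> (\<lambda>F. F \<inter> K) ` \<F>" using VF by (auto simp: K_def intro!: image_eqI[of _ _ V])
    fix F assume F: "F \<in> (\<lambda>F. F \<inter> K) ` \<F>"
    then show "subspace F" using sF sK subspace_inter by auto
    show "F \<subseteq> K" using F by auto
    fix G assume "G \<in> (\<lambda>F. F \<inter> K) ` \<F>"
    then obtain F' G' where "F = F' \<inter> K" "G = G' \<inter> K" "F' \<in> \<F>" "G' \<in> \<F>" using F by auto
    then show "F \<subseteq> G \<or> G \<subseteq> F" using chain[of F' G'] by auto
  qed (use fF in auto)
  have adA: "span A \<inter> F \<subseteq> span (A \<inter> F)" if F': "F \<in> (\<lambda>F. F \<inter> K) ` \<F>" for F
  proof
    obtain G where G: "G \<in> \<F>" "F = G \<inter> K" using F' by auto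
    fix v assume v: "v \<in> span A \<inter> F"
    then obtain u where u: "u \<in> U" "v = f u" using spA by auto
    then have "u \<in> span (BU \<inter> {u \<in> U. f u \<in> G})" unfolding BU(3)[OF G(1)] using v G by auto
    then have "v \<in> span (f ` (BU \<inter> {u \<in> U. f u \<in> G}))"
      using P.span_image_on[OF f(1) sU, of "BU \<inter> {u \<in> U. f u \<in> G}"] u by auto
    also have "\<dots> = span (f ` (BU \<inter> {u \<in> U. f u \<in> G}) - {0})" by simp
    also have "\<dots> \<subseteq> span (A \<inter> F)"
      using AK G BUU by (intro span_mono) (auto simp: A_def)
    finally show "v \<in> span (A \<inter> F)" .
  qed
  obtain BK where BK: "A \<subseteq> BK" "adapted_basis scale K ((\<lambda>F. F \<inter> K) ` \<F>) BK"
    by (rule adapted_extend[OF finK flagK AK indA adA])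
  then have indK: "independent BK" and spK: "span BK = K"
    and adK: "\<And>F. F \<in> \<F> \<Longrightarrow> span (BK \<inter> (F \<inter> K)) = F \<inter> K" by (auto simp: adapted_basis_def)
  define C where "C = BW \<inter> g ` V"
  have C0: "c \<noteq> 0" if "c \<in> C" for c using that BW(1) dependent_zero by (auto simp: C_def)
  have "\<exists>v\<in>V. g v = c \<and> (\<forall>F\<in>\<F>. c \<in> g ` F \<longrightarrow> v \<in> F)" if "c \<in> C" for c
  proof -
    let ?N = "{F \<in> \<F>. c \<in> g ` F}"
    have "finite ?N" "?N \<noteq> {}" using fF VF that by (auto simp: C_def)
    then obtain F where F: "F \<in> ?N" "\<And>G. G \<in> ?N \<Longrightarrow> G \<subseteq> F \<Longrightarrow> F = G"
      using finite_has_minimal[of ?N] by blast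
    then obtain v where v: "v \<in> F" "c = g v" by auto
    have "v \<in> G" if "G \<in> \<F>" "c \<in> g ` G" for G
      using chain[of F G] F(1) F(2)[of G] that v by auto
    moreover have "v \<in> V" using v F sF by auto
    ultimately show ?thesis using v by blast
  qed
  then obtain l where l: "\<And>c. c \<in> C \<Longrightarrow> l c \<in> V" "\<And>c. c \<in> C \<Longrightarrow> g (l c) = c"
    "\<And>c F. c \<in> C \<Longrightarrow> F \<in> \<F> \<Longrightarrow> c \<in> g ` F \<Longrightarrow> l c \<in> F" by metis
  define B where "B = BK \<union> l ` C"
  have BKV: "BK \<subseteq> K" using spK span_superset by blast
  have BV: "B \<subseteq> V" using BKV l(1) by (auto simp: B_def K_def)
  \<comment> \<open>Subtracting the lifts that represent \<open>g v\<close> leaves a vector of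
    \<open>F\<close> in the kernel \<open>K\<close>, where \<open>BK\<close> is adapted.\<close>
  have adB: "F \<subseteq> span (B \<inter> F)" if F: "F \<in> \<F>" for F
  proof
    fix v assume v: "v \<in> F"
    let ?C = "BW \<inter> g ` F"
    have CC: "?C \<subseteq> C" using sF[OF F] by (auto simp: C_def)
    have lF: "l ` ?C \<subseteq> B \<inter> F" using CC l(3)[OF _ F] by (auto simp: B_def)
    have "g ` l ` ?C = ?C" using CC l(2) by (force simp: image_image)
    then have "g v \<in> span (g ` l ` ?C)" using BW(2)[OF F] v by auto
    also have "\<dots> = g ` span (l ` ?C)" using CC l(1) by (intro P.span_image_on[OF g(1) sV]) auto
    finally obtain w where w: "w \<in> span (l ` ?C)" "g v = g w" by auto
    have wB: "w \<in> span (B \<inter> F)" using w(1) span_mono[OF lF] by auto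
    have wF: "w \<in> F" using wB sF[OF F] span_minimal[of "B \<inter> F" F] by auto
    have "v - w \<in> F \<inter> K"
      using v wF sF[OF F] subspace_diff P.linear_on_diff[OF g(1) sV, of v w] w(2) by (auto simp: K_def)
    then have "v - w \<in> span (B \<inter> F)"
      using adK[OF F] span_mono[of "BK \<inter> (F \<inter> K)" "B \<inter> F"] by (auto simp: B_def)
    then have "(v - w) + w \<in> span (B \<inter> F)" using wB by (rule span_add)
    then show "v \<in> span (B \<inter> F)" by simp
  qed
  have spB: "V \<subseteq> span B" using adB[OF VF] span_mono[of "B \<inter> V" B] by auto
  have finBK: "finite BK" by (rule fin_dim_independent(1)[OF finK indK BKV])
  have imC: "C \<subseteq> g ` V" "independent C" "g ` V \<subseteq> span C"
    using BW(2)[OF VF] independent_mono[OF BW(1)] by (auto simp: C_def)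
  have finC: "finite C" by (rule fin_dim_independent(1)[OF P.fin_dim_image[OF g(1) V] imC(2,1)])
  \<comment> \<open>By counting: \<open>B\<close> spans \<open>V\<close> and, by rank-nullity, has
    at most \<open>dim V\<close> elements, so it equals any basis extracted from it.\<close>
  have "independent B"
  proof -
    obtain B' where B': "B' \<subseteq> B" "independent B'" "B \<subseteq> span B'" using maximal_independent_subset[of B] by blast
    have "V \<subseteq> span B'" using spB B' span_minimal subspace_span by blast
    then have "card B' = dim V" using B' BV by (intro basis_card_eq_dim) auto
    also have "\<dots> = dim (g ` V) + dim K" unfolding K_def by (rule P.dim_image_kernel[OF g(1) V])
    also have "\<dots> = card C + card BK"
      using basis_card_eq_dim[OF imC(1,3,2)] dim_span_eq_card_independent[OF indK] spK by simp
    also have "\<dots> \<ge> card B" unfolding B_def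
      using card_Un_le[of BK "l ` C"] card_image_le[OF finC, of l] by linarith
    finally have "B' = B" using B'(1) finBK finC by (intro card_seteq) (auto simp: B_def)
    then show ?thesis using B' by simp
  qed
  moreover have "span B = V" using spB BV sV span_minimal by (intro subset_antisym) auto
  moreover have "span (B \<inter> F) = F" if "F \<in> \<F>" for F
    using adB[OF that] sF[OF that] span_minimal[of "B \<inter> F" F] by (intro subset_antisym) auto
  ultimately have "adapted_basis scale V \<F> B" by (simp add: adapted_basis_def)
  moreover have "\<forall>b\<in>BU. f b = 0 \<or> f b \<in> B"
    using BK(1) by (auto simp: A_def B_def)
  moreover have "inj_on f {b \<in> BU. f b \<noteq> 0}"
    using injN span_superset[of N] by (auto simp: N_def intro: inj_on_subset)
  moreover have "\<forall>b\<in>B. g b = 0 \<or> g b \<in> BW"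
    using BKV l(2) by (auto simp: B_def K_def C_def)
  moreover have "inj_on g {b \<in> B. g b \<noteq> 0}"
    using BKV l(2) by (auto simp: B_def K_def inj_on_def)
  ultimately show ?thesis by (rule that)
qed

end

section \<open>String bases of representations with xy = 0\<close>

declare split_paired_All [simp del] split_paired_Ex [simp del]

lemma is_repD:
  assumes "is_rep s P M"
  shows "p \<in> P \<Longrightarrow> fin_dim s (vs_at M p)"
    and "p \<in> P \<Longrightarrow> q \<in> P \<Longrightarrow> p \<le> q \<Longrightarrow> map_at M p q ` vs_at M p \<subseteq> vs_at M q"
    and "p \<in> P \<Longrightarrow> q \<in> P \<Longrightarrow> p \<le> q \<Longrightarrow> linear_on s s (vs_at M p) (map_at M p q)"
    and "p \<in> P \<Longrightarrow> v \<in> vs_at M p \<Longrightarrow> map_at M p p v = v"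
    and "p \<in> P \<Longrightarrow> q \<in> P \<Longrightarrow> r \<in> P \<Longrightarrow> p \<le> q \<Longrightarrow> q \<le> r \<Longrightarrow> v \<in> vs_at M p \<Longrightarrow>
      map_at M q r (map_at M p q v) = map_at M p r v"
  using assms unfolding is_rep_def fin_dim_def[symmetric] by simp_all

lemma is_repI:
  assumes "\<And>p. p \<in> P \<Longrightarrow> fin_dim s (vs_at M p)"
    and "\<And>p q v. p \<in> P \<Longrightarrow> q \<in> P \<Longrightarrow> p \<le> q \<Longrightarrow> v \<in> vs_at M p \<Longrightarrow> map_at M p q v \<in> vs_at M q"
    and "\<And>p q. p \<in> P \<Longrightarrow> q \<in> P \<Longrightarrow> p \<le> q \<Longrightarrow> linear_on s s (vs_at M p) (map_at M p q)"
    and "\<And>p v. p \<in> P \<Longrightarrow> v \<in> vs_at M p \<Longrightarrow> map_at M p p v = v"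
    and "\<And>p q r v. p \<in> P \<Longrightarrow> q \<in> P \<Longrightarrow> r \<in> P \<Longrightarrow> p \<le> q \<Longrightarrow> q \<le> r \<Longrightarrow> v \<in> vs_at M p \<Longrightarrow>
      map_at M q r (map_at M p q v) = map_at M p r v"
  shows "is_rep s P M"
  unfolding is_rep_def fin_dim_def[symmetric] image_subset_iff
  by (intro conjI ballI impI assms)

locale fin_rep = vector_space s
  for s :: "'k::field \<Rightarrow> 'v::ab_group_add \<Rightarrow> 'v" +
  fixes W :: "(int \<times> int, 'v) poset_rep"
  assumes rep: "is_rep s UNIV W"
    and fin: "finite {p. vs_at W p \<noteq> {0}}"
begin

sublocale P: vector_space_pair s s
  by unfold_locales

abbreviation V where "V \<equiv> vs_at W"
abbreviation m where "m p q \<equiv> map_at W p q"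

lemma fin_dim_V: "fin_dim s (V p)"
  by (rule is_repD(1)[OF rep]) simp

lemma sub_V: "subspace (V p)"
  by (rule fin_dim_subspace[OF fin_dim_V])

lemma lin: "p \<le> q \<Longrightarrow> linear_on s s (V p) (m p q)"
  by (rule is_repD(3)[OF rep]) auto

lemma m_in: "p \<le> q \<Longrightarrow> v \<in> V p \<Longrightarrow> m p q v \<in> V q"
  using is_repD(2)[OF rep, of p q] by auto

lemma m_comp: "p \<le> q \<Longrightarrow> q \<le> r \<Longrightarrow> v \<in> V p \<Longrightarrow> m q r (m p q v) = m p r v"
  by (rule is_repD(5)[OF rep]) auto

lemma m_refl: "v \<in> V p \<Longrightarrow> m p p v = v"
  by (rule is_repD(4)[OF rep]) auto

end

locale thin_rep = fin_rep s W
  for s :: "'k::field \<Rightarrow> 'v::ab_group_add \<Rightarrow> 'v" and W :: "(int \<times> int, 'v) poset_rep" +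
  assumes thin: "v \<in> V p \<Longrightarrow> m p (p + (1, 1)) v = 0"
begin

definition X where "X p = m p (p + (1, 0))"
definition Y where "Y p = m p (p + (0, 1))"
text \<open>\<open>X\<close> raises the level by one and \<open>Y\<close> lowers it by one, while
  the direction (1,1) preserves it.\<close>

definition lev :: "int \<times> int \<Rightarrow> int" where "lev p = fst p - snd p"

lemma linear_X: "linear_on s s (V p) (X p)" and X_in: "X p ` V p \<subseteq> V (p + (1, 0))"
  and linear_Y: "linear_on s s (V p) (Y p)" and Y_in: "Y p ` V p \<subseteq> V (p + (0, 1))"
  unfolding X_def Y_def by (intro lin image_subsetI m_in; simp add: less_eq_prod_def)+

lemma XY: "v \<in> V p \<Longrightarrow> X (p + (0, 1)) (Y p v) = 0"
  using m_comp[of p "p + (0, 1)" "p + (1, 1)" v] thin[of v p]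
  by (simp add: X_def Y_def less_eq_prod_def add.assoc)

lemma YX: "v \<in> V p \<Longrightarrow> Y (p + (1, 0)) (X p v) = 0"
  using m_comp[of p "p + (1, 0)" "p + (1, 1)" v] thin[of v p]
  by (simp add: X_def Y_def less_eq_prod_def add.assoc)

text \<open>The condition on \<open>X\<close> stops one level earlier than that on \<open>Y\<close>,
  because \<open>X\<close> leads from level \<open>d\<close> to level \<open>d + 1\<close>, where no
  basis has been fixed yet.\<close>

definition string_basis :: "int \<Rightarrow> (int \<times> int \<Rightarrow> 'v set) \<Rightarrow> bool" where
  "string_basis d B \<longleftrightarrow>
     (\<forall>p. lev p \<le> d \<longrightarrow> independent (B p) \<and> span (B p) = V p \<and>
        (\<forall>b\<in>B p. Y p b = 0 \<or> Y p b \<in> B (p + (0, 1))) \<and> inj_on (Y p) {b \<in> B p. Y p b \<noteq> 0}) \<and>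
     (\<forall>p. lev p < d \<longrightarrow>
        (\<forall>b\<in>B p. X p b = 0 \<or> X p b \<in> B (p + (1, 0))) \<and> inj_on (X p) {b \<in> B p. X p b \<noteq> 0})"

text \<open>
  The chains describe which changes of basis on level \<open>d\<close> extend to the lower levels; only their
  existence matters.
\<close>

lemma string_basis_upto:
  assumes "\<And>p. lev p \<le> d0 \<Longrightarrow> V p = {0}" "d0 \<le> d"
  shows "\<exists>\<F>. (\<forall>p. lev p = d \<longrightarrow> flag s (V p) (\<F> p)) \<and>
           (\<forall>B. (\<forall>p. lev p = d \<longrightarrow> adapted_basis s (V p) (\<F> p) (B p)) \<longrightarrow>
              (\<exists>B'. (\<forall>p. lev p = d \<longrightarrow> B' p = B p) \<and> string_basis d B'))"
  using assms(2)
proof (induction rule: int_ge_induct)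
  case base
  have "flag s (V p) {{0}}" if "lev p = d0" for p
    using assms(1)[of p] that by (simp add: flag_def)
  moreover have "\<exists>B'. (\<forall>p. lev p = d0 \<longrightarrow> B' p = B p) \<and> string_basis d0 B'"
    if B: "\<forall>p. lev p = d0 \<longrightarrow> adapted_basis s (V p) {{0}} (B p)" for B
  proof -
    have "B p = {}" if "lev p = d0" for p
    proof -
      have "independent (B p)" "span (B p) = {0}"
        using B assms(1)[of p] that by (auto simp: adapted_basis_def)
      then show ?thesis using span_superset[of "B p"] dependent_zero[of "B p"] by auto
    qed
    then show ?thesis
      using assms(1) by (intro exI[of _ "\<lambda>_. {}"]) (auto simp: string_basis_def independent_empty)
  qed
  ultimately show ?case by (intro exI[of _ "\<lambda>_. {{0}}"]) blast
next
  case (step d)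
  then obtain \<F> where flagF: "\<And>p. lev p = d \<Longrightarrow> flag s (V p) (\<F> p)"
    and ext: "\<And>B. (\<forall>p. lev p = d \<longrightarrow> adapted_basis s (V p) (\<F> p) (B p)) \<Longrightarrow>
              (\<exists>B'. (\<forall>p. lev p = d \<longrightarrow> B' p = B p) \<and> string_basis d B')" by blast
  \<comment> \<open>The two neighbours of \<open>q\<close> on the previous level: \<open>X\<close>
    arrives from \<open>L q\<close>, and \<open>Y\<close> leaves for \<open>U q\<close>. Their
    chains are pushed forward and pulled back to \<open>q\<close>.\<close>
  define L :: "int \<times> int \<Rightarrow> int \<times> int" where "L q = q - (1, 0)" for q
  define U :: "int \<times> int \<Rightarrow> int \<times> int" where "U q = q + (0, 1)" for q
  define G where "G q = (\<lambda>F. X (L q) ` F) ` \<F> (L q) \<union> (\<lambda>F. {u \<in> V q. Y q u \<in> F}) ` \<F> (U q)" for q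
  have lev: "lev (L q) = d" "lev (U q) = d" if "lev q = d + 1" for q
    using that by (auto simp: L_def U_def lev_def)
  have LR: "L q + (1, 0) = q" for q by (simp add: L_def)
  have flagG: "flag s (V q) (G q)" if q: "lev q = d + 1" for q
  proof -
    note fL = flagF[OF lev(1)[OF q]] and fU = flagF[OF lev(2)[OF q]]
    note linL = linear_X[of "L q"] and linU = linear_Y[of q, folded U_def]
    have inL: "X (L q) ` V (L q) \<subseteq> V q" using X_in[of "L q"] by (simp add: LR)
    have inU: "Y q ` V q \<subseteq> V (U q)" using Y_in[of q] by (simp add: U_def)
    have subL: "subspace (X (L q) ` F)" if "F \<in> \<F> (L q)" for F
      using fL that by (intro P.subspace_image_on[OF linL sub_V]) (auto simp: flag_def)
    have subU: "subspace {u \<in> V q. Y q u \<in> F}" if "F \<in> \<F> (U q)" for F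
      using fU that by (intro P.subspace_preimage_on[OF linear_Y sub_V]) (auto simp: flag_def)
    \<comment> \<open>The decisive use of xy = 0: every image lies in the kernel of
      \<open>Y\<close>, hence in every preimage, and the two chains combine into one.\<close>
    have LU: "X (L q) ` F \<subseteq> {u \<in> V q. Y q u \<in> F'}" if "F \<in> \<F> (L q)" "F' \<in> \<F> (U q)" for F F'
    proof -
      have "F \<subseteq> V (L q)" "0 \<in> F'" using fL fU that subspace_0 by (auto simp: flag_def)
      then show ?thesis using inL YX[of _ "L q"] by (auto simp: LR)
    qed
    have chL: "X (L q) ` F \<subseteq> X (L q) ` F' \<or> X (L q) ` F' \<subseteq> X (L q) ` F"
      if "F \<in> \<F> (L q)" "F' \<in> \<F> (L q)" for F F'
    proof -
      have "F \<subseteq> F' \<or> F' \<subseteq> F" using fL that by (auto simp: flag_def)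
      then show ?thesis by (auto dest: image_mono)
    qed
    have chU: "{u \<in> V q. Y q u \<in> F} \<subseteq> {u \<in> V q. Y q u \<in> F'} \<or> {u \<in> V q. Y q u \<in> F'} \<subseteq> {u \<in> V q. Y q u \<in> F}"
      if "F \<in> \<F> (U q)" "F' \<in> \<F> (U q)" for F F'
    proof -
      have "F \<subseteq> F' \<or> F' \<subseteq> F" using fU that by (auto simp: flag_def)
      then show ?thesis by auto
    qed
    have "{0} = X (L q) ` {0}" using P.linear_on_zero[OF linL sub_V] by simp
    moreover have "{0} \<in> \<F> (L q)" using fL by (simp add: flag_def)
    ultimately have z: "{0} \<in> G q" unfolding G_def by blast
    have "V q = {u \<in> V q. Y q u \<in> V (U q)}" using inU by auto
    moreover have "V (U q) \<in> \<F> (U q)" using fU by (simp add: flag_def)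
    ultimately have t: "V q \<in> G q" unfolding G_def by blast
    show ?thesis
      unfolding flag_def
    proof (intro conjI ballI z t)
      show "finite (G q)" using fL fU by (simp add: G_def flag_def)
      fix F assume F: "F \<in> G q"
      show "subspace F" using F subL subU by (auto simp: G_def)
      have "F' \<subseteq> V (L q)" if "F' \<in> \<F> (L q)" for F' using fL that by (simp add: flag_def)
      then show "F \<subseteq> V q" using F inL by (fastforce simp: G_def)
      fix F' assume F': "F' \<in> G q"
      show "F \<subseteq> F' \<or> F' \<subseteq> F"
        using F F' unfolding G_def
        by (elim UnE imageE; hypsubst) (rule chL chU LU disjI1 [OF LU] disjI2 [OF LU]; assumption)+
    qed
  qed
  have "\<exists>B'. (\<forall>q. lev q = d + 1 \<longrightarrow> B' q = B q) \<and> string_basis (d + 1) B'"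
    if B: "\<forall>q. lev q = d + 1 \<longrightarrow> adapted_basis s (V q) (G q) (B q)" for B
  proof -
    \<comment> \<open>The vertices of level \<open>d\<close> can be treated separately: each is
      linked to level \<open>d + 1\<close> only through \<open>?D\<close> and \<open>?R\<close>,
      whose chains were built from the chain at \<open>p\<close>. Adaptedness to the latter is then
      what the induction hypothesis asks for.\<close>
    have "\<exists>A. adapted_basis s (V p) (\<F> p) A \<and>
       (\<forall>b\<in>B (p - (0, 1)). Y (p - (0, 1)) b = 0 \<or> Y (p - (0, 1)) b \<in> A) \<and>
       inj_on (Y (p - (0, 1))) {b \<in> B (p - (0, 1)). Y (p - (0, 1)) b \<noteq> 0} \<and>
       (\<forall>b\<in>A. X p b = 0 \<or> X p b \<in> B (p + (1, 0))) \<and> inj_on (X p) {b \<in> A. X p b \<noteq> 0}"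
      if p: "lev p = d" for p
    proof -
      let ?D = "p - (0, 1)" and ?R = "p + (1, 0)"
      have l: "lev ?D = d + 1" "lev ?R = d + 1" using p by (auto simp: lev_def)
      have UD: "U ?D = p" and LRp: "L ?R = p" by (auto simp: U_def L_def)
      have BD: "adapted_basis s (V ?D) (G ?D) (B ?D)" and BR: "adapted_basis s (V ?R) (G ?R) (B ?R)"
        using B l by auto
      have indep: "independent (B ?D)" "independent (B ?R)" and spD: "span (B ?D) = V ?D"
        using BD BR by (auto simp: adapted_basis_def)
      have aD: "span (B ?D \<inter> {u \<in> V ?D. Y ?D u \<in> F}) = {u \<in> V ?D. Y ?D u \<in> F}" if "F \<in> \<F> p" for F
        using BD that UD by (auto simp: adapted_basis_def G_def)
      have aR: "span (B ?R \<inter> X p ` F) = X p ` F" if "F \<in> \<F> p" for F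
        using BR that LRp by (auto simp: adapted_basis_def G_def)
      have YD: "Y ?D ` V ?D \<subseteq> V p" using Y_in[of ?D] by simp
      have XYD: "X p (Y ?D u) = 0" if "u \<in> V ?D" for u using XY[of u ?D] that by simp
      obtain A where "adapted_basis s (V p) (\<F> p) A"
        "\<forall>b\<in>B ?D. Y ?D b = 0 \<or> Y ?D b \<in> A" "inj_on (Y ?D) {b \<in> B ?D. Y ?D b \<noteq> 0}"
        "\<forall>b\<in>A. X p b = 0 \<or> X p b \<in> B ?R" "inj_on (X p) {b \<in> A. X p b \<noteq> 0}"
        by (rule adapted_lift[OF fin_dim_V flagF[OF p] linear_Y YD fin_dim_V linear_X X_in XYD indep(1) spD aD indep(2) aR])
      then show ?thesis by blast
    qed
    then have "\<exists>A. \<forall>p. lev p = d \<longrightarrow> adapted_basis s (V p) (\<F> p) (A p) \<and>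
       (\<forall>b\<in>B (p - (0, 1)). Y (p - (0, 1)) b = 0 \<or> Y (p - (0, 1)) b \<in> A p) \<and>
       inj_on (Y (p - (0, 1))) {b \<in> B (p - (0, 1)). Y (p - (0, 1)) b \<noteq> 0} \<and>
       (\<forall>b\<in>A p. X p b = 0 \<or> X p b \<in> B (p + (1, 0))) \<and> inj_on (X p) {b \<in> A p. X p b \<noteq> 0}"
      by (intro choice) blast
    then obtain A where A: "\<And>p. lev p = d \<Longrightarrow> adapted_basis s (V p) (\<F> p) (A p)"
      "\<And>p b. lev p = d \<Longrightarrow> b \<in> B (p - (0, 1)) \<Longrightarrow> Y (p - (0, 1)) b = 0 \<or> Y (p - (0, 1)) b \<in> A p"
      "\<And>p. lev p = d \<Longrightarrow> inj_on (Y (p - (0, 1))) {b \<in> B (p - (0, 1)). Y (p - (0, 1)) b \<noteq> 0}"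
      "\<And>p b. lev p = d \<Longrightarrow> b \<in> A p \<Longrightarrow> X p b = 0 \<or> X p b \<in> B (p + (1, 0))"
      "\<And>p. lev p = d \<Longrightarrow> inj_on (X p) {b \<in> A p. X p b \<noteq> 0}"
      by blast
    obtain A' where A': "\<And>p. lev p = d \<Longrightarrow> A' p = A p" "string_basis d A'"
      using ext[of A] A(1) by blast
    define B' where "B' p = (if lev p \<le> d then A' p else B p)" for p
    have "string_basis (d + 1) B'"
      unfolding string_basis_def
    proof (intro conjI allI impI)
      fix p assume p: "lev p \<le> d + 1"
      have "independent (B' p) \<and> span (B' p) = V p \<and>
        (\<forall>b\<in>B' p. Y p b = 0 \<or> Y p b \<in> B' (p + (0, 1))) \<and> inj_on (Y p) {b \<in> B' p. Y p b \<noteq> 0}"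
      proof (cases "lev p \<le> d")
        case True
        then have "B' p = A' p" "B' (p + (0, 1)) = A' (p + (0, 1))" by (auto simp: B'_def lev_def)
        then show ?thesis using A'(2) True by (simp add: string_basis_def)
      next
        case False
        then have l: "lev p = d + 1" "lev (p + (0, 1)) = d" using p by (auto simp: lev_def)
        then have "B' p = B p" "B' (p + (0, 1)) = A (p + (0, 1))" using A'(1) by (auto simp: B'_def)
        then show ?thesis using B l A(2,3)[OF l(2)] by (simp add: adapted_basis_def)
      qed
      then show "independent (B' p)" "span (B' p) = V p"
        "\<forall>b\<in>B' p. Y p b = 0 \<or> Y p b \<in> B' (p + (0, 1))" "inj_on (Y p) {b \<in> B' p. Y p b \<noteq> 0}"
        by auto
    next
      fix p assume p: "lev p < d + 1"
      have "(\<forall>b\<in>B' p. X p b = 0 \<or> X p b \<in> B' (p + (1, 0))) \<and> inj_on (X p) {b \<in> B' p. X p b \<noteq> 0}"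
      proof (cases "lev p < d")
        case True
        then have "B' p = A' p" "B' (p + (1, 0)) = A' (p + (1, 0))" by (auto simp: B'_def lev_def)
        then show ?thesis using A'(2) True by (simp add: string_basis_def)
      next
        case False
        then have l: "lev p = d" "lev (p + (1, 0)) = d + 1" using p by (auto simp: lev_def)
        then have "B' p = A p" "B' (p + (1, 0)) = B (p + (1, 0))" using A'(1) by (auto simp: B'_def)
        then show ?thesis using A(4,5)[OF l(1)] by simp
      qed
      then show "\<forall>b\<in>B' p. X p b = 0 \<or> X p b \<in> B' (p + (1, 0))" "inj_on (X p) {b \<in> B' p. X p b \<noteq> 0}"
        by auto
    qed
    then show ?thesis by (intro exI[of _ B']) (auto simp: B'_def)
  qed
  then show ?case using flagG by (intro exI[of _ G]) blast
qed

lemma string_basis_exists: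
  obtains B where
    "\<And>p. independent (B p)" "\<And>p. span (B p) = V p"
    "\<And>p b. b \<in> B p \<Longrightarrow> X p b \<noteq> 0 \<Longrightarrow> X p b \<in> B (p + (1, 0))"
    "\<And>p. inj_on (X p) {b \<in> B p. X p b \<noteq> 0}"
    "\<And>p b. b \<in> B p \<Longrightarrow> Y p b \<noteq> 0 \<Longrightarrow> Y p b \<in> B (p + (0, 1))"
    "\<And>p. inj_on (Y p) {b \<in> B p. Y p b \<noteq> 0}"
proof -
  \<comment> \<open>The inserted 0 keeps the minimum and maximum meaningful for the zero
    representation and gives \<open>d0 \<le> d1\<close>.\<close>
  define S where "S = insert 0 (lev ` {p. V p \<noteq> {0}})"
  have S: "finite S" "S \<noteq> {}" using fin by (auto simp: S_def)
  define d0 where "d0 = Min S - 1"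
  define d1 where "d1 = Max S + 1"
  have low: "V p = {0}" if "lev p \<le> d0" for p
  proof (rule ccontr)
    assume "V p \<noteq> {0}"
    then have "lev p \<in> S" by (auto simp: S_def)
    then have "Min S \<le> lev p" using S by simp
    then show False using that by (simp add: d0_def)
  qed
  have high: "V p = {0}" if "lev p \<ge> d1" for p
  proof (rule ccontr)
    assume "V p \<noteq> {0}"
    then have "lev p \<in> S" by (auto simp: S_def)
    then have "lev p \<le> Max S" using S by simp
    then show False using that by (simp add: d1_def)
  qed
  have "d0 \<le> d1"
  proof -
    have "0 \<in> S" by (simp add: S_def)
    then have "Min S \<le> 0" "0 \<le> Max S" using S(1) by auto
    then show ?thesis by (simp add: d0_def d1_def)
  qed
  from string_basis_upto[OF low this] obtain \<F> where
    F: "\<And>p. lev p = d1 \<Longrightarrow> flag s (V p) (\<F> p)"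
    and ext: "\<And>B. (\<forall>p. lev p = d1 \<longrightarrow> adapted_basis s (V p) (\<F> p) (B p)) \<Longrightarrow>
              (\<exists>B'. (\<forall>p. lev p = d1 \<longrightarrow> B' p = B p) \<and> string_basis d1 B')" by blast
  have "adapted_basis s (V p) (\<F> p) {}" if "lev p = d1" for p
  proof -
    have "F = {0}" if "F \<in> \<F> p" for F
      using F[OF \<open>lev p = d1\<close>] that high[of p] \<open>lev p = d1\<close> subspace_0[of F] by (auto simp: flag_def)
    then show ?thesis using high[of p] that by (simp add: adapted_basis_def independent_empty)
  qed
  then obtain A where A: "\<And>p. lev p = d1 \<Longrightarrow> A p = {}" "string_basis d1 A"
    using ext[of "\<lambda>_. {}"] by blast
  define B where "B p = (if lev p < d1 then A p else {})" for p
  have 1: "independent (B p)" "span (B p) = V p" for p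
    using A(2) high[of p] by (auto simp: B_def string_basis_def independent_empty)
  \<comment> \<open>No step enters level \<open>d1\<close>, where \<open>A\<close> is empty, so
    cutting the bases off there loses no image.\<close>
  have 2: "X p b \<in> B (p + (1, 0))" if "b \<in> B p" "X p b \<noteq> 0" for p b
  proof -
    have "lev p < d1" "b \<in> A p" using that by (auto simp: B_def split: if_splits)
    then have "X p b \<in> A (p + (1, 0))" using A(2) that unfolding string_basis_def by blast
    moreover from this have "lev (p + (1, 0)) \<noteq> d1" using A(1)[of "p + (1, 0)"] by auto
    then have "lev (p + (1, 0)) < d1" using \<open>lev p < d1\<close> by (simp add: lev_def)
    ultimately show ?thesis by (simp add: B_def)
  qed
  have 3: "Y p b \<in> B (p + (0, 1))" if "b \<in> B p" "Y p b \<noteq> 0" for p b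
  proof -
    have "lev p < d1" "b \<in> A p" using that by (auto simp: B_def split: if_splits)
    then have "Y p b \<in> A (p + (0, 1))" using A(2) that unfolding string_basis_def by (meson less_imp_le)
    then show ?thesis using \<open>lev p < d1\<close> by (auto simp: B_def lev_def)
  qed
  have 4: "inj_on (X p) {b \<in> B p. X p b \<noteq> 0}" "inj_on (Y p) {b \<in> B p. Y p b \<noteq> 0}" for p
    using A(2) by (auto simp: B_def string_basis_def)
  show ?thesis by (rule that[OF 1 2 4(1) 3 4(2)])
qed

end

section \<open>Decomposition into spread curves\<close>

lemma grid_induct [consumes 1, case_names base right up]:
  fixes p q :: "int \<times> int"
  assumes "p \<le> q" "Q p"
    "\<And>r. p \<le> r \<Longrightarrow> Q r \<Longrightarrow> Q (r + (1, 0))" "\<And>r. p \<le> r \<Longrightarrow> Q r \<Longrightarrow> Q (r + (0, 1))"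
  shows "Q q"
proof -
  have right: "Q (p + (int k, 0))" for k
  proof (induction k)
    case 0
    have "p + (int 0, 0) = p" by (simp add: prod_eq_iff)
    then show ?case using assms(2) by (simp only:)
  next
    case (Suc k)
    have "p + (int (Suc k), 0) = (p + (int k, 0)) + (1, 0)" by (simp add: prod_eq_iff)
    then show ?case using assms(3)[OF _ Suc] by (simp only:) (simp add: less_eq_prod_def)
  qed
  have up: "Q (p + (int k, int l))" for k l
  proof (induction l)
    case 0 show ?case using right by simp
  next
    case (Suc l)
    have "p + (int k, int (Suc l)) = (p + (int k, int l)) + (0, 1)" by (simp add: prod_eq_iff)
    then show ?case using assms(4)[OF _ Suc] by (simp only:) (simp add: less_eq_prod_def)
  qed
  have "q = p + (int (nat (fst q - fst p)), int (nat (snd q - snd p)))"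
    using assms(1) by (simp add: less_eq_prod_def prod_eq_iff)
  then show ?thesis using up by metis
qed

locale string_rep = thin_rep +
  fixes B
  assumes indep: "independent (B p)" and spanB: "span (B p) = V p"
    and XB: "b \<in> B p \<Longrightarrow> X p b \<noteq> 0 \<Longrightarrow> X p b \<in> B (p + (1, 0))"
    and injX: "inj_on (X p) {b \<in> B p. X p b \<noteq> 0}"
    and YB: "b \<in> B p \<Longrightarrow> Y p b \<noteq> 0 \<Longrightarrow> Y p b \<in> B (p + (0, 1))"
    and injY: "inj_on (Y p) {b \<in> B p. Y p b \<noteq> 0}"
begin

text \<open>Steps along \<open>X\<close> and against \<open>Y\<close>. Both raise the level by one,
  so a string, whose arrows alternate in direction, becomes a directed path that runs to the right
  and down.\<close>

definition nxt :: "(((int \<times> int) \<times> 'b) \<times> (int \<times> int) \<times> 'b) set" where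
  "nxt = {((p, b), (p + (1, 0), X p b)) | p b. b \<in> B p \<and> X p b \<noteq> 0} \<union>
     {((p + (0, 1), Y p b), (p, b)) | p b. b \<in> B p \<and> Y p b \<noteq> 0}"

lemma nxtX: "b \<in> B p \<Longrightarrow> X p b \<noteq> 0 \<Longrightarrow> ((p, b), (p + (1, 0), X p b)) \<in> nxt"
  and nxtY: "b \<in> B p \<Longrightarrow> Y p b \<noteq> 0 \<Longrightarrow> ((p + (0, 1), Y p b), (p, b)) \<in> nxt"
  unfolding nxt_def by blast+

lemma nxt_cases [consumes 1, case_names nxtX nxtY]:
  assumes "(e, e') \<in> nxt"
  obtains b p where "e = (p, b)" "e' = (p + (1, 0), X p b)" "b \<in> B p" "X p b \<noteq> 0"
  | b p where "e = (p + (0, 1), Y p b)" "e' = (p, b)" "b \<in> B p" "Y p b \<noteq> 0"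
  using assms unfolding nxt_def by blast

definition E where "E = {(p, b). b \<in> B p}"

lemma B_V: "b \<in> B p \<Longrightarrow> b \<in> V p"
  using spanB span_base by blast

lemma finite_B: "finite (B p)"
  using fin_dim_independent(1)[OF fin_dim_V indep, of p] B_V by blast

lemma finite_E: "finite E"
proof -
  have "p \<in> {p. V p \<noteq> {0}}" if "b \<in> B p" for p b
    using that B_V[OF that] dependent_zero[of "B p"] indep[of p] by auto
  then have "E \<subseteq> Sigma {p. V p \<noteq> {0}} B" by (auto simp: E_def)
  then show ?thesis by (rule finite_subset) (intro finite_SigmaI fin finite_B)
qed

lemma nxt_E: "(e, e') \<in> nxt \<Longrightarrow> e \<in> E \<and> e' \<in> E"
  by (elim nxt_cases) (auto simp: E_def XB YB)

lemma nxt_steps: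
  "(e, e') \<in> nxt \<Longrightarrow> lev (fst e') = lev (fst e) + 1 \<and> fst (fst e) \<le> fst (fst e') \<and> snd (fst e') \<le> snd (fst e)"
  by (elim nxt_cases) (auto simp: lev_def)

lemma nxt_comparable: "(e, e') \<in> nxt \<Longrightarrow> fst e \<le> fst e' \<or> fst e' \<le> fst e"
  by (elim nxt_cases) (auto simp: less_eq_prod_def)

text \<open>\<open>X\<close> kills whatever \<open>Y\<close> hits, so a step along \<open>X\<close>
  and a step against \<open>Y\<close> never leave the same element. Two steps against
  \<open>Y\<close> are excluded by injectivity.\<close>

lemma single_valued_nxt: "single_valued nxt"
proof (rule single_valuedI)
  fix e e1 e2 assume 1: "(e, e1) \<in> nxt" and 2: "(e, e2) \<in> nxt"
  from 1 show "e1 = e2"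
  proof (cases rule: nxt_cases)
    case (nxtX b p)
    from 2 show ?thesis
    proof (cases rule: nxt_cases)
      case (nxtY b' p')
      then have "X p b = 0" using nxtX XY[OF B_V[OF nxtY(3)]] by auto
      with nxtX show ?thesis by simp
    qed (use nxtX in auto)
  next
    case (nxtY b p)
    from 2 show ?thesis
    proof (cases rule: nxt_cases)
      case (nxtX b' p')
      then have "X p' b' = 0" using nxtY XY[OF B_V[OF nxtY(3)]] by auto
      with nxtX show ?thesis by simp
    next
      case (nxtY b' p')
      then have "p' = p" "Y p b' = Y p b" using \<open>e = (p + (0, 1), Y p b)\<close> by auto
      then show ?thesis using nxtY \<open>e1 = (p, b)\<close> \<open>b \<in> B p\<close> \<open>Y p b \<noteq> 0\<close> injY[of p]
        by (auto dest: inj_onD)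
    qed
  qed
qed

text \<open>Dually, \<open>Y\<close> kills whatever \<open>X\<close> hits, and two steps along
  \<open>X\<close> into one element are excluded by injectivity.\<close>

lemma single_valued_nxt_converse: "single_valued (nxt\<inverse>)"
proof (rule single_valuedI, unfold converse_iff)
  fix e e1 e2 assume 1: "(e1, e) \<in> nxt" and 2: "(e2, e) \<in> nxt"
  from 1 show "e1 = e2"
  proof (cases rule: nxt_cases)
    case (nxtX b p)
    from 2 show ?thesis
    proof (cases rule: nxt_cases)
      case (nxtY b' p')
      then have "Y p' b' = 0" using nxtX YX[OF B_V[OF nxtX(3)]] by auto
      with nxtY show ?thesis by simp
    next
      case (nxtX b' p')
      then have "p' = p" "X p b' = X p b" using \<open>e = (p + (1, 0), X p b)\<close> by auto
      then show ?thesis using nxtX \<open>e1 = (p, b)\<close> \<open>b \<in> B p\<close> \<open>X p b \<noteq> 0\<close> injX[of p]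
        by (auto dest: inj_onD)
    qed
  next
    case (nxtY b p)
    from 2 show ?thesis
    proof (cases rule: nxt_cases)
      case (nxtX b' p')
      then have "Y p b = 0" using nxtY YX[OF B_V[OF nxtX(3)]] by auto
      with nxtY show ?thesis by simp
    qed (use nxtY in auto)
  qed
qed

section \<open>Paths along strings and their levels\<close>

lemma path_steps:
  assumes "(e, e') \<in> nxt\<^sup>*"
  shows "fst (fst e) \<le> fst (fst e')" "snd (fst e') \<le> snd (fst e)" "lev (fst e) \<le> lev (fst e')"
proof -
  have "fst (fst e) \<le> fst (fst e') \<and> snd (fst e') \<le> snd (fst e)"
    using assms by (induction rule: rtrancl_induct) (auto dest: nxt_steps)
  then show "fst (fst e) \<le> fst (fst e')" "snd (fst e') \<le> snd (fst e)" "lev (fst e) \<le> lev (fst e')"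
    by (auto simp: lev_def)
qed

lemma path_eq: "(e, e') \<in> nxt\<^sup>* \<Longrightarrow> lev (fst e') \<le> lev (fst e) \<Longrightarrow> e = e'"
  by (erule rtranclE) (force dest: nxt_steps path_steps(3))+

lemma path_nxt:
  assumes "(e, e') \<in> nxt\<^sup>*" "lev (fst e') = lev (fst e) + 1"
  shows "(e, e') \<in> nxt"
  using assms(1)
proof cases
  case base then show ?thesis using assms(2) by simp
next
  case (step y)
  then have "lev (fst y) = lev (fst e)" using assms(2) nxt_steps[OF step(2)] by simp
  then show ?thesis using step path_eq[of e y] by simp
qed

text \<open>Each step raises the level by exactly one, so a path skips no level.\<close>

lemma path_between:
  assumes "(e, e') \<in> nxt\<^sup>*" "lev (fst e) \<le> l" "l \<le> lev (fst e')"
  shows "\<exists>f. (e, f) \<in> nxt\<^sup>* \<and> (f, e') \<in> nxt\<^sup>* \<and> lev (fst f) = l"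
  using assms
proof (induction rule: rtrancl_induct)
  case base
  then show ?case by (intro exI[of _ e]) auto
next
  case (step y z)
  show ?case
  proof (cases "l \<le> lev (fst y)")
    case True
    then show ?thesis using step by (meson rtrancl.rtrancl_into_rtrancl)
  next
    case False
    then have "lev (fst z) = l" using nxt_steps[OF step(2)] step(5) by simp
    then show ?thesis using step(1,2) by (intro exI[of _ z]) auto
  qed
qed

definition starts where "starts = {e \<in> E. \<forall>e'. (e', e) \<notin> nxt}"

text \<open>Going backwards lowers the level, which is bounded below on the finite set
  \<open>E\<close>.\<close>

lemma start_exists:
  assumes "e \<in> E"
  shows "\<exists>s\<in>starts. (s, e) \<in> nxt\<^sup>*"
proof -
  define m where "m = Min (lev ` fst ` E)"
  have m: "m \<le> lev (fst e)" if "e \<in> E" for e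
    unfolding m_def using finite_E that by (intro Min_le) auto
  show ?thesis using assms
  proof (induction "nat (lev (fst e) - m)" arbitrary: e rule: less_induct)
    case less
    show ?case
    proof (cases "e \<in> starts")
      case False
      then obtain e' where e': "(e', e) \<in> nxt" using less(2) by (auto simp: starts_def)
      then have "e' \<in> E" using nxt_E by blast
      moreover have "nat (lev (fst e') - m) < nat (lev (fst e) - m)"
        using nxt_steps[OF e'] m[OF \<open>e' \<in> E\<close>] by simp
      ultimately show ?thesis using less(1) e' by (meson rtrancl.rtrancl_into_rtrancl)
    qed auto
  qed
qed

lemma start_path: "u \<in> starts \<Longrightarrow> (e, u) \<in> nxt\<^sup>* \<Longrightarrow> e = u"
  by (erule rtranclE) (auto simp: starts_def)

text \<open>Backward paths are deterministic, so one of the two starts is reached from the other;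
  but only the empty path leads to a start.\<close>

lemma start_unique:
  assumes "u \<in> starts" "u' \<in> starts" "(u, e) \<in> nxt\<^sup>*" "(u', e) \<in> nxt\<^sup>*"
  shows "u = u'"
  using single_valued_confluent[OF single_valued_nxt_converse, of e u u'] assms start_path[of u' u] start_path[of u u']
  by (auto simp: rtrancl_converse)

lemma path_confluent: "(u, e) \<in> nxt\<^sup>* \<Longrightarrow> (u, e') \<in> nxt\<^sup>* \<Longrightarrow> (e, e') \<in> nxt\<^sup>* \<or> (e', e) \<in> nxt\<^sup>*"
  by (rule single_valued_confluent[OF single_valued_nxt])

definition curve where "curve u = {p. \<exists>b. (u, (p, b)) \<in> nxt\<^sup>*}"

lemma path_E: "(u, e) \<in> nxt\<^sup>* \<Longrightarrow> u \<in> E \<Longrightarrow> e \<in> E"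
  by (induction rule: rtrancl_induct) (auto dest: nxt_E)

text \<open>Levels strictly increase along a string and are constant in direction (1,1); this yields
  the condition on \<open>p + (1, 1)\<close> for spread curves.\<close>

lemma curve_level_unique:
  assumes "(u, e) \<in> nxt\<^sup>*" "(u, e') \<in> nxt\<^sup>*" "lev (fst e) = lev (fst e')"
  shows "e = e'"
  using path_confluent[OF assms(1,2)] path_eq[of e e'] path_eq[of e' e] assms(3) by auto

text \<open>Comparability of neighbours gives connectedness. For convexity, two comparable points on
  a path that runs right and down lie on a common horizontal or vertical stretch; the stretch skips
  no level and so passes through every point in between.\<close>

lemma curve_spread: "curve u \<in> spread_curves"
proof -
  define R where "R = {(x, y). x \<in> curve u \<and> y \<in> curve u \<and> (x \<le> y \<or> y \<le> x)}"
  have reach: "(fst u, fst e) \<in> R\<^sup>*" if "(u, e) \<in> nxt\<^sup>*" for e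
    using that
  proof (induction rule: rtrancl_induct)
    case (step y z)
    have "fst y \<in> curve u" "fst z \<in> curve u"
      using step(1,2) unfolding curve_def
      by (metis (mono_tags) mem_Collect_eq prod.collapse rtrancl.rtrancl_into_rtrancl)+
    then have "(fst y, fst z) \<in> R" using nxt_comparable[OF step(2)] by (simp add: R_def)
    with step show ?case by (meson rtrancl.rtrancl_into_rtrancl)
  qed simp
  have "sym R" by (auto simp: R_def sym_def)
  then have symR: "sym (R\<^sup>*)" by (rule sym_rtrancl)
  have "poset_connected (curve u)"
    unfolding poset_connected_def R_def[symmetric]
  proof (intro ballI)
    fix x y assume "x \<in> curve u" "y \<in> curve u"
    then obtain b c where "(u, (x, b)) \<in> nxt\<^sup>*" "(u, (y, c)) \<in> nxt\<^sup>*" by (auto simp: curve_def)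
    from this[THEN reach] have "(fst u, x) \<in> R\<^sup>*" "(fst u, y) \<in> R\<^sup>*" by simp_all
    then show "(x, y) \<in> R\<^sup>*" using symR by (meson rtrancl_trans symE)
  qed
  moreover have "poset_convex UNIV (curve u)"
    unfolding poset_convex_def
  proof (intro ballI impI)
    fix x z y assume "x \<in> curve u" "z \<in> curve u" "x \<le> y \<and> y \<le> z"
    then obtain b c where b: "(u, (x, b)) \<in> nxt\<^sup>*" and c: "(u, (z, c)) \<in> nxt\<^sup>*" by (auto simp: curve_def)
    have le: "fst x \<le> fst y" "fst y \<le> fst z" "snd x \<le> snd y" "snd y \<le> snd z"
      using \<open>x \<le> y \<and> y \<le> z\<close> by (auto simp: less_eq_prod_def)
    from path_confluent[OF b c] show "y \<in> curve u"
    proof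
      assume xz: "((x, b), (z, c)) \<in> nxt\<^sup>*"
      have "snd z = snd x" using path_steps(2)[OF xz] le by simp
      then obtain f where f: "((x, b), f) \<in> nxt\<^sup>*" "(f, (z, c)) \<in> nxt\<^sup>*" "lev (fst f) = lev y"
        using path_between[OF xz, of "lev y"] le by (auto simp: lev_def)
      have "fst f = y"
        using path_steps[OF f(1)] path_steps[OF f(2)] f(3) le \<open>snd z = snd x\<close> by (auto simp: lev_def prod_eq_iff)
      then show ?thesis using rtrancl_trans[OF b f(1)] by (cases f) (auto simp: curve_def)
    next
      assume zx: "((z, c), (x, b)) \<in> nxt\<^sup>*"
      have "fst z = fst x" using path_steps(1)[OF zx] le by simp
      then obtain f where f: "((z, c), f) \<in> nxt\<^sup>*" "(f, (x, b)) \<in> nxt\<^sup>*" "lev (fst f) = lev y"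
        using path_between[OF zx, of "lev y"] le by (auto simp: lev_def)
      have "fst f = y"
        using path_steps[OF f(1)] path_steps[OF f(2)] f(3) le \<open>fst z = fst x\<close> by (auto simp: lev_def prod_eq_iff)
      then show ?thesis using rtrancl_trans[OF c f(1)] by (cases f) (auto simp: curve_def)
    qed
  qed
  moreover have "p + (1, 1) \<notin> curve u" if "p \<in> curve u" for p
  proof
    assume "p + (1, 1) \<in> curve u"
    with that obtain b c where "(u, (p, b)) \<in> nxt\<^sup>*" "(u, (p + (1, 1), c)) \<in> nxt\<^sup>*"
      by (auto simp: curve_def)
    then have "(p, b) = (p + (1, 1), c)" by (rule curve_level_unique) (simp add: lev_def)
    then show False by (auto simp: prod_eq_iff)
  qed
  moreover have "curve u \<noteq> {}" by (cases u) (auto simp: curve_def)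
  ultimately show ?thesis by (simp add: spread_curves_def spreads_def)
qed

section \<open>Coordinates along strings and the isomorphism\<close>

definition pt where "pt u p = (THE b. (u, (p, b)) \<in> nxt\<^sup>*)"

lemma pt_eq: "(u, (p, b)) \<in> nxt\<^sup>* \<Longrightarrow> pt u p = b"
  unfolding pt_def by (rule the_equality) (auto dest: curve_level_unique[of _ "(p, b)"])

lemma pt_path: "p \<in> curve u \<Longrightarrow> (u, (p, pt u p)) \<in> nxt\<^sup>*"
proof -
  assume "p \<in> curve u"
  then obtain b where b: "(u, (p, b)) \<in> nxt\<^sup>*" by (auto simp: curve_def)
  then show ?thesis by (simp add: pt_eq[OF b])
qed

lemma pt_B: "u \<in> E \<Longrightarrow> p \<in> curve u \<Longrightarrow> pt u p \<in> B p"
  using path_E[OF pt_path] by (auto simp: E_def)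

text \<open>The step into an element is unique and a start has none, so membership in the string of
  \<open>u\<close> cannot change along a step.\<close>

lemma curve_nxt_iff:
  assumes "u \<in> starts" "(e, e') \<in> nxt"
  shows "(u, e) \<in> nxt\<^sup>* \<longleftrightarrow> (u, e') \<in> nxt\<^sup>*"
proof
  assume "(u, e') \<in> nxt\<^sup>*"
  then show "(u, e) \<in> nxt\<^sup>*"
  proof cases
    case base then show ?thesis using assms by (auto simp: starts_def)
  next
    case (step y)
    then have "y = e" using single_valued_nxt_converse assms(2) unfolding single_valued_def by auto
    then show ?thesis using step by simp
  qed
qed (use assms(2) in auto)

text \<open>The coefficient of the only basis element of the string \<open>e\<close> over
  \<open>p\<close>. These functionals are the components of the isomorphism in
  \<open>decomposition\<close>.\<close>

definition coord where
  "coord e p v = (if p \<in> curve e then representation (B p) v (pt e p) else 0)"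

lemma linear_coord: "linear_on s (*) (V p) (coord e p)"
  unfolding linear_on_def coord_def using indep spanB
  by (simp add: representation_add representation_scale)

lemma coord_basis:
  "b \<in> B p \<Longrightarrow> coord e p b = (if (e, (p, b)) \<in> nxt\<^sup>* then 1 else 0)"
  using pt_path[of p e] pt_eq[of e p b] representation_basis[OF indep, of b p]
  by (auto simp: coord_def curve_def)

text \<open>The common part of \<open>coord_X\<close> and \<open>coord_Y\<close>, checked on basis
  elements: \<open>nz\<close> says that \<open>Z\<close> respects strings, and \<open>adj\<close>
  that \<open>Z\<close> does not kill the element of the string if its curve contains both
  points.\<close>

lemma coord_step:
  assumes e: "e \<in> starts" and Z: "linear_on s s (V p) Z" "Z ` V p \<subseteq> V q"
    and nz: "\<And>b. b \<in> B p \<Longrightarrow> Z b \<noteq> 0 \<Longrightarrow> Z b \<in> B q \<and> ((e, (p, b)) \<in> nxt\<^sup>* \<longleftrightarrow> (e, (q, Z b)) \<in> nxt\<^sup>*)"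
    and adj: "\<And>b c. b \<in> B p \<Longrightarrow> (e, (p, b)) \<in> nxt\<^sup>* \<Longrightarrow> (e, (q, c)) \<in> nxt\<^sup>* \<Longrightarrow> Z b \<noteq> 0"
    and v: "v \<in> V p"
  shows "coord e q (Z v) = (if p \<in> curve e \<and> q \<in> curve e then coord e p v else 0)"
proof -
  interpret Q: vector_space "(*) :: 'a \<Rightarrow> 'a \<Rightarrow> 'a" by (rule vector_space_field)
  interpret Q: vector_space_pair s "(*)" by unfold_locales
  let ?g = "\<lambda>v. if p \<in> curve e \<and> q \<in> curve e then coord e p v else 0"
  show ?thesis
  proof (rule Q.linear_on_eq[of "B p" "\<lambda>v. coord e q (Z v)" ?g])
    show "linear_on s (*) (span (B p)) (\<lambda>v. coord e q (Z v))"
      unfolding spanB by (rule linear_on_compose[OF Z linear_coord])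
    show "linear_on s (*) (span (B p)) ?g"
      using linear_coord[of p e] unfolding spanB linear_on_def by auto
    show "v \<in> span (B p)" using v spanB by simp
  next
    fix b assume b: "b \<in> B p"
    show "coord e q (Z b) = ?g b"
    proof (cases "Z b = 0")
      case True
      have "coord e q 0 = 0" by (simp add: coord_def representation_zero)
      then show ?thesis using True adj[OF b] coord_basis[OF b, of e] by (auto simp: curve_def)
    next
      case False
      then show ?thesis using nz[OF b False] coord_basis[OF b, of e] coord_basis[of "Z b" q e]
        by (auto simp: curve_def)
    qed
  qed
qed

lemma coord_X:
  assumes e: "e \<in> starts" and v: "v \<in> V p"
  shows "coord e (p + (1, 0)) (X p v) =
    (if p \<in> curve e \<and> p + (1, 0) \<in> curve e then coord e p v else 0)"
proof (rule coord_step[OF e linear_X X_in _ _ v])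
  fix b assume b: "b \<in> B p" "X p b \<noteq> 0"
  then show "X p b \<in> B (p + (1, 0)) \<and> ((e, (p, b)) \<in> nxt\<^sup>* \<longleftrightarrow> (e, (p + (1, 0), X p b)) \<in> nxt\<^sup>*)"
    using curve_nxt_iff[OF e nxtX[OF b]] XB by auto
next
  fix b c assume b: "b \<in> B p" "(e, (p, b)) \<in> nxt\<^sup>*" "(e, (p + (1, 0), c)) \<in> nxt\<^sup>*"
  have "((p, b), (p + (1, 0), c)) \<in> nxt"
    using path_confluent[OF b(2,3)]
  proof
    assume "((p, b), (p + (1, 0), c)) \<in> nxt\<^sup>*"
    then show ?thesis by (rule path_nxt) (simp add: lev_def)
  qed (auto dest: path_steps(3) simp: lev_def)
  then show "X p b \<noteq> 0" by (cases rule: nxt_cases) (auto simp: prod_eq_iff)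
qed

lemma coord_Y:
  assumes e: "e \<in> starts" and v: "v \<in> V p"
  shows "coord e (p + (0, 1)) (Y p v) =
    (if p \<in> curve e \<and> p + (0, 1) \<in> curve e then coord e p v else 0)"
proof (rule coord_step[OF e linear_Y Y_in _ _ v])
  fix b assume b: "b \<in> B p" "Y p b \<noteq> 0"
  then show "Y p b \<in> B (p + (0, 1)) \<and> ((e, (p, b)) \<in> nxt\<^sup>* \<longleftrightarrow> (e, (p + (0, 1), Y p b)) \<in> nxt\<^sup>*)"
    using curve_nxt_iff[OF e nxtY[OF b]] YB by auto
next
  fix b c assume b: "b \<in> B p" "(e, (p, b)) \<in> nxt\<^sup>*" "(e, (p + (0, 1), c)) \<in> nxt\<^sup>*"
  have "((p + (0, 1), c), (p, b)) \<in> nxt"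
    using path_confluent[OF b(2,3)]
  proof
    assume "((p + (0, 1), c), (p, b)) \<in> nxt\<^sup>*"
    then show ?thesis by (rule path_nxt) (simp add: lev_def)
  qed (auto dest: path_steps(3) simp: lev_def)
  then show "Y p b \<noteq> 0" by (cases rule: nxt_cases) (auto simp: prod_eq_iff)
qed

text \<open>A structure map is a composite of unit steps. Convexity of the curve reduces the
  conditions at all intermediate points to the condition at the two ends.\<close>

lemma coord_natural:
  assumes e: "e \<in> starts" and pq: "p \<le> q" and v: "v \<in> V p"
  shows "coord e q (m p q v) = (if p \<in> curve e \<and> q \<in> curve e then coord e p v else 0)"
proof -
  have cvx: "y \<in> curve e" if "x \<in> curve e" "z \<in> curve e" "x \<le> y" "y \<le> z" for x y z
    using curve_spread[of e] that unfolding spread_curves_def spreads_def poset_convex_def by blast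
  show ?thesis using pq
  proof (induction rule: grid_induct)
    case base
    show ?case using m_refl[OF v] by (simp add: coord_def)
  next
    case (right r)
    have "m p r v \<in> V r" by (rule m_in[OF right(1) v])
    moreover have "m p (r + (1, 0)) v = X r (m p r v)"
      unfolding X_def by (rule m_comp[symmetric, OF right(1) _ v]) (simp add: less_eq_prod_def)
    ultimately show ?case
      using coord_X[OF e, of "m p r v" r] right cvx[of p "r + (1, 0)" r] by (auto simp: less_eq_prod_def)
  next
    case (up r)
    have "m p r v \<in> V r" by (rule m_in[OF up(1) v])
    moreover have "m p (r + (0, 1)) v = Y r (m p r v)"
      unfolding Y_def by (rule m_comp[symmetric, OF up(1) _ v]) (simp add: less_eq_prod_def)
    ultimately show ?case
      using coord_Y[OF e, of "m p r v" r] up cvx[of p "r + (0, 1)" r] by (auto simp: less_eq_prod_def)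
  qed
qed

text \<open>Every basis element over \<open>p\<close> lies on the string of exactly one start, so
  the functionals \<open>coord\<close> of the strings through \<open>p\<close> form the dual basis
  at \<open>p\<close>.\<close>

lemma decomposition:
  "\<exists>n c. (\<forall>j<n. c j \<in> spread_curves) \<and>
     rep_iso s (scale_fun (*)) UNIV W (rep_sum n (\<lambda>j. spread_rep (c j)))"
proof -
  have "finite starts" using finite_E by (rule rev_finite_subset) (auto simp: starts_def)
  then obtain \<sigma> where bij: "bij_betw \<sigma> {0..<card starts} starts" using ex_bij_betw_nat_finite by blast
  define n where "n = card starts"
  have \<sigma>: "\<sigma> j \<in> starts" if "j < n" for j using bij that by (auto simp: bij_betw_def n_def)
  then have \<sigma>E: "\<sigma> j \<in> E" if "j < n" for j using that by (auto simp: starts_def)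
  let ?c = "\<lambda>j. curve (\<sigma> j)"
  let ?N = "rep_sum n (\<lambda>j. spread_rep (?c j)) :: (int \<times> int, nat \<Rightarrow> 'a) poset_rep"
  define \<phi> where "\<phi> p v j = (if v \<in> V p \<and> j < n then coord (\<sigma> j) p v else 0)" for p v j
  interpret Q: vector_space "scale_fun ((*) :: 'a \<Rightarrow> 'a \<Rightarrow> 'a)"
    by (intro vector_space_scale_fun vector_space_field)
  interpret Q: vector_space_pair s "scale_fun (*)" by unfold_locales
  have lin: "linear_on s (scale_fun (*)) (V p) (\<phi> p)" for p
    using linear_coord[of p] subspace_add[OF sub_V, of _ p] subspace_scale[OF sub_V, of _ p]
    unfolding linear_on_def \<phi>_def by (auto simp: fun_eq_iff scale_fun_def)
  have hom: "\<phi> \<in> rep_hom s (scale_fun (*)) UNIV W ?N"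
    unfolding rep_hom_def
  proof (intro CollectI conjI ballI allI impI lin)
    show "\<phi> p ` V p \<subseteq> vs_at ?N p" for p
      by (auto simp: rep_sum_def spread_rep_def \<phi>_def coord_def)
    show "\<phi> q (m p q v) = map_at ?N p q (\<phi> p v)" if "p \<le> q" "v \<in> V p" for p q v
    proof
      fix j
      have "m p q v \<in> V q" by (rule m_in[OF that])
      then show "\<phi> q (m p q v) j = map_at ?N p q (\<phi> p v) j"
        using coord_natural[OF \<sigma> that, of j] that
        by (simp add: rep_sum_def spread_rep_def \<phi>_def)
    qed
    show "\<phi> p v = 0" if "p \<notin> UNIV \<or> v \<notin> V p" for p v
      using that by (auto simp: \<phi>_def fun_eq_iff)
  qed
  have bij: "bij_betw (\<phi> p) (V p) (vs_at ?N p)" for p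
  proof -
    have ex: "\<exists>j<n. (\<sigma> j, (p, b)) \<in> nxt\<^sup>*" if b: "b \<in> B p" for b
    proof -
      obtain s where "s \<in> starts" "(s, (p, b)) \<in> nxt\<^sup>*" using start_exists[of "(p, b)"] b by (auto simp: E_def)
      then show ?thesis using bij unfolding bij_betw_def n_def by (metis atLeastLessThan_iff imageE)
    qed
    then obtain J where J: "\<And>b. b \<in> B p \<Longrightarrow> J b < n" "\<And>b. b \<in> B p \<Longrightarrow> (\<sigma> (J b), (p, b)) \<in> nxt\<^sup>*"
      by metis
    have J_eq: "J b = j" if "b \<in> B p" "(\<sigma> j, (p, b)) \<in> nxt\<^sup>*" "j < n" for b j
    proof -
      have "\<sigma> (J b) = \<sigma> j" using start_unique J[OF that(1)] \<sigma> that by blast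
      then show ?thesis using bij J(1)[OF that(1)] that(3) by (auto simp: bij_betw_def n_def inj_on_def)
    qed
    have "inj_on (\<phi> p) (V p)"
    proof (subst Q.linear_on_inj_iff[OF lin sub_V], intro ballI impI)
      fix v assume v: "v \<in> V p" "\<phi> p v = 0"
      have "representation (B p) v b = 0" if b: "b \<in> B p" for b
      proof -
        have "p \<in> curve (\<sigma> (J b))" using J(2)[OF b] by (auto simp: curve_def)
        then show ?thesis using fun_cong[OF v(2), of "J b"] J[OF b] v(1) pt_eq[OF J(2)[OF b]]
          by (simp add: \<phi>_def coord_def)
      qed
      then have "representation (B p) v b = 0" for b using representation_ne_zero by blast
      then show "v = 0" using sum_nonzero_representation_eq[OF indep, of v p] v spanB by simp
    qed
    moreover have "\<phi> p ` V p = vs_at ?N p"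
    proof
      show "\<phi> p ` V p \<subseteq> vs_at ?N p" using hom by (auto simp: rep_hom_def)
      show "vs_at ?N p \<subseteq> \<phi> p ` V p"
      proof
        fix f assume f: "f \<in> vs_at ?N p"
        \<comment> \<open>The preimage of \<open>f\<close> takes as coefficient of \<open>b\<close>
          the component of \<open>f\<close> at the index \<open>J b\<close> of the string through
          \<open>b\<close>.\<close>
        define v where "v = (\<Sum>b\<in>B p. s (f (J b)) b)"
        have v: "v \<in> V p" unfolding v_def using B_V sub_V by (intro subspace_sum subspace_scale)
        have "\<phi> p v j = f j" for j
        proof (cases "j < n")
          case False
          then show ?thesis using f by (simp add: \<phi>_def rep_sum_def)
        next
          case True
          interpret F: vector_space "(*) :: 'a \<Rightarrow> 'a \<Rightarrow> 'a" by (rule vector_space_field)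
          interpret F: vector_space_pair s "(*)" by unfold_locales
          have "\<phi> p v j = coord (\<sigma> j) p v" using v True by (simp add: \<phi>_def)
          also have "\<dots> = (\<Sum>b\<in>B p. coord (\<sigma> j) p (s (f (J b)) b))"
            unfolding v_def by (rule F.linear_on_sum[OF linear_coord sub_V]) (intro subspace_scale sub_V B_V)
          also have "\<dots> = (\<Sum>b\<in>B p. f (J b) * coord (\<sigma> j) p b)"
            using F.linear_on_scale[OF linear_coord] B_V by (intro sum.cong) auto
          also have "\<dots> = (\<Sum>b\<in>B p. if (\<sigma> j, (p, b)) \<in> nxt\<^sup>* then f j else 0)"
            using J_eq True by (intro sum.cong) (auto simp: coord_basis)
          also have "\<dots> = f j"
          proof (cases "p \<in> ?c j")
            case False
            then have "(\<Sum>b\<in>B p. if (\<sigma> j, (p, b)) \<in> nxt\<^sup>* then f j else 0) = 0"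
              by (intro sum.neutral) (auto simp: curve_def)
            then show ?thesis using f True False by (auto simp: rep_sum_def spread_rep_def)
          next
            case in_c: True
            have "(\<sigma> j, (p, b)) \<in> nxt\<^sup>* \<longleftrightarrow> b = pt (\<sigma> j) p" for b
              using pt_path[OF in_c] pt_eq[of "\<sigma> j" p b] by blast
            then show ?thesis using pt_B[OF \<sigma>E[OF True] in_c] finite_B by simp
          qed
          finally show ?thesis .
        qed
        then have "f = \<phi> p v" by (intro ext) (rule sym)
        then show "f \<in> \<phi> p ` V p" using v by blast
      qed
    qed
    ultimately show ?thesis by (simp add: bij_betw_def)
  qed
  have "rep_iso s (scale_fun (*)) UNIV W ?N"
    unfolding rep_iso_def using hom bij by blast
  then show ?thesis using curve_spread by (intro exI[of _ n] exI[of _ ?c]) auto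
qed

end

lemma (in thin_rep) curve_decomposition:
  "\<exists>n c. (\<forall>j<n. c j \<in> spread_curves) \<and>
     rep_iso s (scale_fun (*)) UNIV W (rep_sum n (\<lambda>j. spread_rep (c j)))"
proof (rule string_basis_exists)
  fix B
  assume B: "\<And>p. independent (B p)" "\<And>p. span (B p) = V p"
    "\<And>p b. b \<in> B p \<Longrightarrow> X p b \<noteq> 0 \<Longrightarrow> X p b \<in> B (p + (1, 0))"
    "\<And>p. inj_on (X p) {b \<in> B p. X p b \<noteq> 0}"
    "\<And>p b. b \<in> B p \<Longrightarrow> Y p b \<noteq> 0 \<Longrightarrow> Y p b \<in> B (p + (0, 1))"
    "\<And>p. inj_on (Y p) {b \<in> B p. Y p b \<noteq> 0}"
  interpret string_rep s W B by unfold_locales (fact B)+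
  show ?thesis by (rule decomposition)
qed

section \<open>Euler characteristics of rank functions\<close>

lemma map_rank_refl:
  assumes "is_rep s P M" "p \<in> P"
  shows "map_rank s M p p = vector_space.dim s (vs_at M p)"
proof -
  have "map_at M p p ` vs_at M p = (\<lambda>v. v) ` vs_at M p"
    by (intro image_cong refl is_repD(4)[OF assms])
  then show ?thesis by (simp add: map_rank_def)
qed

text \<open>The second conclusion carries finite dimensionality over to \<open>N\<close>;
  \<open>summand_bound\<close> uses it for direct sums.\<close>

lemma map_rank_iso:
  fixes s :: "'k::field \<Rightarrow> 'v::ab_group_add \<Rightarrow> 'v" and t :: "'k \<Rightarrow> 'w::ab_group_add \<Rightarrow> 'w"
  assumes s: "vector_space s" and t: "vector_space t" and M: "is_rep s P M"
    and iso: "rep_iso s t P M N" and pq: "p \<in> P" "q \<in> P" "p \<le> q"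
  shows "map_rank s M p q = map_rank t N p q" and "fin_dim t (map_at N p q ` vs_at N p)"
proof -
  interpret vector_space_pair s t using s t by (simp add: vector_space_pair_def)
  obtain \<phi> where \<phi>: "\<phi> \<in> rep_hom s t P M N" "\<And>p. p \<in> P \<Longrightarrow> bij_betw (\<phi> p) (vs_at M p) (vs_at N p)"
    using iso by (auto simp: rep_iso_def)
  have nat: "\<phi> q (map_at M p q v) = map_at N p q (\<phi> p v)" if "v \<in> vs_at M p" for v
    using \<phi>(1) pq that by (simp add: rep_hom_def)
  have lin: "linear_on s t (vs_at M q) (\<phi> q)" using \<phi>(1) pq by (simp add: rep_hom_def)
  have "map_at N p q ` vs_at N p = map_at N p q ` \<phi> p ` vs_at M p"
    using \<phi>(2)[OF pq(1)] by (simp add: bij_betw_def)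
  also have "\<dots> = \<phi> q ` map_at M p q ` vs_at M p"
    unfolding image_image by (rule image_cong) (auto simp: nat)
  finally have eq: "map_at N p q ` vs_at N p = \<phi> q ` map_at M p q ` vs_at M p" .
  interpret S: vector_space_pair s s by unfold_locales
  show "fin_dim t (map_at N p q ` vs_at N p)"
    unfolding eq
    by (rule fin_dim_image[OF linear_on_subset[OF lin is_repD(2)[OF M pq]]
          S.fin_dim_image[OF is_repD(3)[OF M pq] is_repD(1)[OF M pq(1)]]])
  have "map_rank t N p q = vs2.dim (\<phi> q ` map_at M p q ` vs_at M p)"
    by (simp add: map_rank_def eq)
  also have "\<dots> = vs1.dim (map_at M p q ` vs_at M p)"
    using \<phi>(2)[OF pq(2)] is_repD(2)[OF M pq]
    by (intro dim_image_inj_on[OF lin vs1.fin_dim_subspace[OF is_repD(1)[OF M pq(2)]]]) (simp_all add: bij_betw_def)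
  finally show "map_rank s M p q = map_rank t N p q" by (simp add: map_rank_def)
qed

lemma dim_field: "vector_space.dim ((*) :: 'k::field \<Rightarrow> 'k \<Rightarrow> 'k) UNIV = 1"
  and fin_dim_field: "fin_dim ((*) :: 'k::field \<Rightarrow> 'k \<Rightarrow> 'k) UNIV"
proof -
  interpret vector_space "(*) :: 'k \<Rightarrow> 'k \<Rightarrow> 'k" by (rule vector_space_field)
  have "span {1} = (UNIV :: 'k set)" by (auto simp: span_singleton)
  then show "dim UNIV = 1" "fin_dim (*) (UNIV :: 'k set)"
    using dim_span_eq_card_independent[of "{1}"] fin_dim_span[of "{1}"] by (auto simp: dependent_single)
qed

lemma map_rank_spread:
  "map_rank ((*) :: 'k::field \<Rightarrow> 'k \<Rightarrow> 'k) (spread_rep J) p q = of_bool (p \<in> J \<and> q \<in> J)"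
proof -
  interpret vector_space "(*) :: 'k \<Rightarrow> 'k \<Rightarrow> 'k" by (rule vector_space_field)
  have "map_at (spread_rep J :: (_, 'k) poset_rep) p q ` vs_at (spread_rep J) p =
    (if p \<in> J \<and> q \<in> J then UNIV else {0})" by (auto simp: spread_rep_def)
  then show ?thesis using dim_field[where 'k='k] dim_zero_space by (simp add: map_rank_def)
qed

lemma map_rank_spread_sum:
  "map_rank (scale_fun ((*) :: 'k::field \<Rightarrow> 'k \<Rightarrow> 'k)) (rep_sum n (\<lambda>j. spread_rep (c j))) p q =
     card {j. j < n \<and> p \<in> c j \<and> q \<in> c j}" (is "map_rank ?s ?N p q = card ?J")
proof -
  have "map_at ?N p q ` vs_at ?N p = {f. \<forall>j. j \<notin> ?J \<longrightarrow> f j = 0}" (is "?L = ?R")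
  proof
    show "?L \<subseteq> ?R" by (auto simp: rep_sum_def spread_rep_def)
    show "?R \<subseteq> ?L"
    proof
      fix f :: "nat \<Rightarrow> 'k" assume f: "f \<in> ?R"
      then have "f \<in> vs_at ?N p" by (auto simp: rep_sum_def spread_rep_def)
      moreover have "map_at ?N p q f = f" using f by (auto simp: rep_sum_def spread_rep_def fun_eq_iff)
      ultimately show "f \<in> ?L" by (metis imageI)
    qed
  qed
  then show ?thesis using fin_dim_funs(2)[of ?J] by (simp add: map_rank_def)
qed

section \<open>The number L and its value on spreads\<close>

definition euler :: "(int \<times> int) set \<Rightarrow> (int \<times> int \<Rightarrow> int \<times> int \<Rightarrow> int) \<Rightarrow> int" where
  "euler A r = (\<Sum>p\<in>A. r p p - r (p - (1, 0)) p - r (p - (0, 1)) p + r (p - (1, 1)) p)"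

lemma euler_cong: "(\<And>p q. p \<le> q \<Longrightarrow> r p q = r' p q) \<Longrightarrow> euler A r = euler A r'"
  unfolding euler_def by (intro sum.cong refl) (simp add: less_eq_prod_def)

lemma euler_sum: "euler A (\<lambda>p q. \<Sum>i\<in>I. c i * r i p q) = (\<Sum>i\<in>I. c i * euler A (r i))"
proof -
  have "euler A (\<lambda>p q. \<Sum>i\<in>I. c i * r i p q) =
    (\<Sum>p\<in>A. \<Sum>i\<in>I. c i * (r i p p - r i (p - (1, 0)) p - r i (p - (0, 1)) p + r i (p - (1, 1)) p))"
    unfolding euler_def by (intro sum.cong) (simp_all add: sum.distrib sum_subtractf algebra_simps)
  also have "\<dots> = (\<Sum>i\<in>I. c i * euler A (r i))"
    unfolding euler_def by (subst sum.swap) (simp add: sum_distrib_left)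
  finally show ?thesis .
qed

text \<open>
  The lowest elements of the columns of \<open>I\<close> and of \<open>{p \<in> I. p - (1, 0) \<in> I}\<close> correspond to the
  nonempty columns, and to the nonempty columns except the leftmost one.
\<close>

lemma bottoms_card:
  fixes J :: "(int \<times> int) set"
  assumes fin: "finite J" and conv: "\<And>i j j' l. (i, j) \<in> J \<Longrightarrow> (i, l) \<in> J \<Longrightarrow> j \<le> j' \<Longrightarrow> j' \<le> l \<Longrightarrow> (i, j') \<in> J"
  shows "int (card J) - int (card {p \<in> J. p - (0, 1) \<in> J}) = int (card (fst ` J))"
proof -
  let ?U = "{p \<in> J. p - (0, 1) \<in> J}" and ?L = "{p \<in> J. p - (0, 1) \<notin> J}"
  have "J = ?U \<union> ?L" by auto
  then have "card J = card ?U + card ?L" using fin by (metis (no_types, lifting) card_Un_disjoint finite_Un Int_emptyI mem_Collect_eq)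
  moreover have "bij_betw fst ?L (fst ` J)"
    unfolding bij_betw_def
  proof
    show "inj_on fst ?L"
    proof (rule inj_onI)
      fix p q assume pq: "p \<in> ?L" "q \<in> ?L" "fst p = fst q"
      \<comment> \<open>Of two elements in one column the upper one has its lower neighbour in
        \<open>J\<close> by convexity, so it is not a lowest element.\<close>
      have *: "\<not> j < l" if "(i, j) \<in> ?L" "(i, l) \<in> ?L" for i j l
        using conv[of i j l "l - 1"] that by auto
      obtain i j l where "p = (i, j)" "q = (i, l)" using pq(3) by (metis prod.collapse)
      then show "p = q" using *[of i j l] *[of i l j] pq(1,2) by simp
    qed
    show "fst ` ?L = fst ` J"
    proof
      show "fst ` J \<subseteq> fst ` ?L"
      proof
        fix i assume "i \<in> fst ` J"
        let ?S = "{j. (i, j) \<in> J}"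
        have "?S \<subseteq> snd ` J" by force
        then have "finite ?S" using fin by (meson finite_imageI finite_subset)
        moreover have "?S \<noteq> {}" using \<open>i \<in> fst ` J\<close> by auto
        ultimately have "Min ?S \<in> ?S" by (rule Min_in)
        moreover have "Min ?S - 1 \<notin> ?S" using Min_le[OF \<open>finite ?S\<close>, of "Min ?S - 1"] by auto
        ultimately have "(i, Min ?S) \<in> ?L" by simp
        then show "i \<in> fst ` ?L" by force
      qed
    qed auto
  qed
  then have "card ?L = card (fst ` J)" by (rule bij_betw_same_card)
  ultimately show ?thesis by simp
qed

text \<open>The first and third terms count the columns of \<open>I\<close>; the second and fourth
  count the columns of \<open>?H\<close>, the points with a left neighbour in \<open>I\<close>.
  Connectedness ensures that only the leftmost column has no such point.\<close>

lemma spread_euler_card: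
  assumes I: "I \<in> spreads (UNIV :: (int \<times> int) set)" and fin: "finite I"
  shows "int (card I) - int (card {p \<in> I. p - (1, 0) \<in> I}) - int (card {p \<in> I. p - (0, 1) \<in> I})
    + int (card {p \<in> I. p - (1, 1) \<in> I}) = 1"
proof -
  have ne: "I \<noteq> {}" and con: "poset_connected I"
    and cvx: "\<And>x y z. x \<in> I \<Longrightarrow> z \<in> I \<Longrightarrow> x \<le> y \<Longrightarrow> y \<le> z \<Longrightarrow> y \<in> I"
    using I unfolding spreads_def poset_convex_def by blast+
  let ?H = "{p \<in> I. p - (1, 0) \<in> I}"
  have colI: "(i, j') \<in> I" if "(i, j) \<in> I" "(i, l) \<in> I" "j \<le> j'" "j' \<le> l" for i j j' l
    using cvx[OF that(1,2), of "(i, j')"] that by simp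
  have 1: "int (card I) - int (card {p \<in> I. p - (0, 1) \<in> I}) = int (card (fst ` I))"
    using colI by (rule bottoms_card[OF fin])
  have 2: "int (card ?H) - int (card {p \<in> ?H. p - (0, 1) \<in> ?H}) = int (card (fst ` ?H))"
    using fin colI by (intro bottoms_card) auto
  have "{p \<in> ?H. p - (0, 1) \<in> ?H} = {p \<in> I. p - (1, 1) \<in> I}"
  proof -
    have D: "p - (0, 1) - (1, 0) = p - (1, 1)" for p :: "int \<times> int" by (simp add: prod_eq_iff)
    have "p - (1, 0) \<in> I" "p - (0, 1) \<in> I" if "p \<in> I" "p - (1, 1) \<in> I" for p
      by (rule cvx[OF that(2,1)]; simp add: less_eq_prod_def)+
    then show ?thesis unfolding mem_Collect_eq D by blast
  qed
  moreover have "fst ` ?H = fst ` I - {Min (fst ` I)}"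
  proof
    show "fst ` ?H \<subseteq> fst ` I - {Min (fst ` I)}"
    proof
      fix i assume "i \<in> fst ` ?H"
      then obtain p where p: "i = fst p" "p \<in> I" "p - (1, 0) \<in> I" by auto
      then have "fst (p - (1, 0)) \<in> fst ` I" by blast
      then have "Min (fst ` I) \<le> fst (p - (1, 0))" using fin by (intro Min_le) auto
      then have "Min (fst ` I) \<le> i - 1" using p by simp
      then show "i \<in> fst ` I - {Min (fst ` I)}" using p by auto
    qed
    show "fst ` I - {Min (fst ` I)} \<subseteq> fst ` ?H"
    proof
      fix i assume i: "i \<in> fst ` I - {Min (fst ` I)}"
      then obtain x where x: "x \<in> I" "fst x = i" by auto
      have "Min (fst ` I) \<in> fst ` I" using fin ne by (intro Min_in) auto
      then obtain y where y: "y \<in> I" "fst y = Min (fst ` I)" by auto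
      have "Min (fst ` I) \<le> i" using i fin by auto
      then have "fst y < i" using i y by auto
      let ?R = "{(u, v). u \<in> I \<and> v \<in> I \<and> (u \<le> v \<or> v \<le> u)}"
      have "(y, x) \<in> ?R\<^sup>*" using con x y by (simp add: poset_connected_def)
      \<comment> \<open>On the way from the leftmost column to column \<open>i\<close> some
        comparable pair crosses from columns left of \<open>i\<close> to columns from
        \<open>i\<close> on; its left member must be the smaller one.\<close>
      then have "i \<le> fst x \<longrightarrow> (\<exists>u\<in>I. \<exists>v\<in>I. u \<le> v \<and> fst u < i \<and> i \<le> fst v)"
      proof (induction rule: rtrancl_induct)
        case base then show ?case using \<open>fst y < i\<close> by simp
      next
        case (step u v)
        show ?case
        proof (cases "i \<le> fst u")
          case True then show ?thesis using step by blast
        next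
          case False
          have "u \<le> v" if "i \<le> fst v" using step(2) False that by (auto simp: less_eq_prod_def)
          then show ?thesis using step(2) False by (intro impI bexI[of _ u] bexI[of _ v] conjI) auto
        qed
      qed
      then obtain u v where uv: "u \<in> I" "v \<in> I" "u \<le> v" "fst u < i" "i \<le> fst v" using x by auto
      \<comment> \<open>Moving right from \<open>u\<close> within its own row stays below
        \<open>v\<close>, so convexity provides two adjacent points.\<close>
      have "(i, snd u) \<in> I" "(i - 1, snd u) \<in> I"
        using uv by (auto intro!: cvx[OF uv(1,2)] simp: less_eq_prod_def)
      then have "(i, snd u) \<in> ?H" by auto
      then show "i \<in> fst ` ?H" by force
    qed
  qed
  then have "card (fst ` ?H) = card (fst ` I) - 1"
    using fin ne by (simp add: card_Diff_singleton_if Min_in)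
  moreover have "card (fst ` I) > 0" using fin ne by (simp add: card_gt_0_iff)
  ultimately show ?thesis using 1 2 by simp
qed

lemma euler_spread:
  assumes "I \<in> spreads UNIV" "finite A" "I \<subseteq> A"
  shows "euler A (\<lambda>p q. of_bool (p \<in> I \<and> q \<in> I)) = 1"
proof -
  have *: "(\<Sum>p\<in>A. of_bool (p - e \<in> I \<and> p \<in> I)) = int (card {p \<in> I. p - e \<in> I})" for e :: "int \<times> int"
  proof -
    have "(\<Sum>p\<in>A. of_bool (p - e \<in> I \<and> p \<in> I)) = int (card {p \<in> A. p - e \<in> I \<and> p \<in> I})"
      using assms(2) by (simp add: sum_of_bool_eq Int_def conj_commute)
    also have "{p \<in> A. p - e \<in> I \<and> p \<in> I} = {p \<in> I. p - e \<in> I}" using assms(3) by auto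
    finally show ?thesis .
  qed
  have "finite I" using assms by (auto intro: finite_subset)
  from spread_euler_card[OF assms(1) this] show ?thesis
    unfolding euler_def sum.distrib sum_subtractf * using *[of 0] by simp
qed

text \<open>Each summand contributes 1 to L, so every decomposition has the same number of summands.
  This makes the \<open>THE\<close> in \<open>curve_count\<close> well defined as soon as one
  decomposition exists.\<close>

lemma (in thin_rep) curve_count_euler:
  assumes A: "finite A" "{p. V p \<noteq> {0}} \<subseteq> A"
  shows "int (curve_count s W) = euler A (\<lambda>p q. int (map_rank s W p q))"
proof -
  let ?Q = "\<lambda>n c. (\<forall>j<n. c j \<in> spread_curves) \<and>
     rep_iso s (scale_fun (*)) UNIV W (rep_sum n (\<lambda>j. spread_rep (c j)))"
  have eq: "int n = euler A (\<lambda>p q. int (map_rank s W p q))" if Q: "?Q n c" for n c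
  proof -
    interpret W: vector_space "scale_fun ((*) :: 'k \<Rightarrow> 'k \<Rightarrow> 'k)"
      by (intro vector_space_scale_fun vector_space_field)
    have rank: "map_rank s W p q = card {j. j < n \<and> p \<in> c j \<and> q \<in> c j}" if "p \<le> q" for p q
      using map_rank_iso(1)[OF vector_space_axioms W.vector_space_axioms rep conjunct2[OF Q] _ _ that]
      by (simp add: map_rank_spread_sum)
    have sub: "c j \<subseteq> A" if "j < n" for j
    proof
      fix p assume "p \<in> c j"
      then have "map_rank s W p p \<noteq> 0" using rank[of p p] that by auto
      then have "V p \<noteq> {0}" using map_rank_refl[OF rep, of p] dim_zero_space by auto
      then show "p \<in> A" using A by auto
    qed
    have "euler A (\<lambda>p q. int (map_rank s W p q)) = euler A (\<lambda>p q. \<Sum>j<n. 1 * of_bool (p \<in> c j \<and> q \<in> c j))"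
    proof (rule euler_cong)
      fix p q :: "int \<times> int" assume "p \<le> q"
      have "{j. j < n \<and> p \<in> c j \<and> q \<in> c j} = {..<n} \<inter> {j. p \<in> c j \<and> q \<in> c j}" by auto
      then show "int (map_rank s W p q) = (\<Sum>j<n. 1 * of_bool (p \<in> c j \<and> q \<in> c j))"
        by (simp add: rank[OF \<open>p \<le> q\<close>] sum_of_bool_eq)
    qed
    also have "\<dots> = (\<Sum>j<n. 1 * euler A (\<lambda>p q. of_bool (p \<in> c j \<and> q \<in> c j)))" by (rule euler_sum)
    also have "\<dots> = (\<Sum>j<n. 1)"
      using Q sub by (intro sum.cong refl) (auto simp: spread_curves_def intro!: euler_spread A)
    finally show ?thesis by simp
  qed
  obtain n c where nc: "?Q n c" using curve_decomposition by blast
  have "curve_count s W = n"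
    unfolding curve_count_def
  proof (rule the_equality)
    show "\<exists>c. ?Q n c" using nc by blast
    fix m assume "\<exists>c. ?Q m c"
    then obtain d where "?Q m d" by blast
    then have "int m = int n" using eq[of m d] eq[OF nc] by simp
    then show "m = n" by simp
  qed
  then show ?thesis using eq[OF nc] by simp
qed

section \<open>The cokernel and the kernel of xy\<close>

context fin_rep
begin

abbreviation rk where "rk p q \<equiv> int (map_rank s W p q)"

definition d :: "int \<times> int \<Rightarrow> int \<times> int" where "d p = p + (- 1, - 1)"

lemma d_le: "d p \<le> p" and d_mono: "p \<le> q \<Longrightarrow> d p \<le> d q"
  by (auto simp: d_def less_eq_prod_def)

definition coker where "coker = coker_rep s (shift_rep W (- 1, - 1)) W (mult_xy W)"
definition ker where "ker = ker_rep (shift_rep W (- 1, - 1)) (mult_xy W)"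
definition U where "U p = m (d p) p ` V (d p)"
definition \<pi> where "\<pi> p = quot_map s (U p)"

lemma coker_simps: "vs_at coker p = \<pi> p ` V p" "map_at coker p q w = \<pi> q (m p q w)"
  by (simp_all add: coker_def coker_rep_def shift_rep_def mult_xy_def \<pi>_def U_def d_def)

lemma ker_simps: "vs_at ker p = {v \<in> V (d p). m (d p) p v = 0}" "map_at ker p q = m (d p) (d q)"
  by (simp_all add: ker_def ker_rep_def shift_rep_def mult_xy_def d_def)

lemma U_sub: "subspace (U p)" and U_V: "U p \<subseteq> V p"
  using P.subspace_image_on[OF lin[OF d_le[of p]] sub_V sub_V] m_in[OF d_le[of p]] by (auto simp: U_def)

lemma m_U: "p \<le> q \<Longrightarrow> u \<in> U p \<Longrightarrow> m p q u \<in> U q"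
proof -
  assume pq: "p \<le> q" "u \<in> U p"
  then obtain w where w: "w \<in> V (d p)" "u = m (d p) p w" by (auto simp: U_def)
  have "m p q u = m (d p) q w" using m_comp[OF d_le pq(1) w(1)] w by simp
  also have "\<dots> = m (d q) q (m (d p) (d q) w)" using m_comp[OF d_mono[OF pq(1)] d_le w(1)] by simp
  finally show ?thesis using m_in[OF d_mono[OF pq(1)] w(1)] by (auto simp: U_def)
qed

text \<open>The map xy into \<open>q\<close> factors through every point between \<open>d q\<close>
  and \<open>q\<close>, in particular through the four points that \<open>euler\<close> pairs with
  \<open>q\<close>.\<close>

lemma m_step_U: "d q \<le> p \<Longrightarrow> p \<le> q \<Longrightarrow> U q \<subseteq> m p q ` V p"
  unfolding U_def using m_comp m_in by (metis (mono_tags, lifting) image_eqI image_subsetI)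

lemma lin_\<pi>: "Vector_Spaces.linear s s (\<pi> p)"
  and \<pi>_idem: "\<pi> p (\<pi> p v) = \<pi> p v" and \<pi>_zero: "\<pi> p v = 0 \<longleftrightarrow> v \<in> U p"
  unfolding \<pi>_def by (rule quot_map[OF U_sub])+

lemma \<pi>_diff: "v - \<pi> p v \<in> U p"
  using \<pi>_zero[of p "v - \<pi> p v"] P.linear_diff[OF lin_\<pi>] \<pi>_idem by simp

lemma \<pi>_V: "v \<in> V p \<Longrightarrow> \<pi> p v \<in> V p"
  using subspace_diff[OF sub_V, of v p "v - \<pi> p v"] \<pi>_diff[of v p] U_V[of p] by auto

text \<open>The structure map descends to the quotients: projecting the argument first changes the
  result by an element of \<open>U q\<close>, which the outer projection kills.\<close>

lemma \<pi>_m_\<pi>: "p \<le> q \<Longrightarrow> v \<in> V p \<Longrightarrow> \<pi> q (m p q (\<pi> p v)) = \<pi> q (m p q v)"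
proof -
  assume pq: "p \<le> q" and v: "v \<in> V p"
  have "m p q (v - \<pi> p v) \<in> U q" by (rule m_U[OF pq \<pi>_diff])
  moreover have "m p q (v - \<pi> p v) = m p q v - m p q (\<pi> p v)"
    by (rule P.linear_on_diff[OF lin[OF pq] sub_V v \<pi>_V[OF v]])
  ultimately have "\<pi> q (m p q v - m p q (\<pi> p v)) = 0" using \<pi>_zero by simp
  then show ?thesis using P.linear_diff[OF lin_\<pi>] by simp
qed

lemma coker_thin: "thin_rep s coker"
proof unfold_locales
  show "is_rep s UNIV coker"
  proof (rule is_repI)
    show "fin_dim s (vs_at coker p)" for p
      unfolding coker_simps by (rule P.fin_dim_image[OF linear_on_linear[OF lin_\<pi>] fin_dim_V])
    show "map_at coker p q v \<in> vs_at coker q" if "p \<le> q" "v \<in> vs_at coker p" for p q v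
      using that(2) by (auto simp: coker_simps intro!: imageI m_in[OF that(1)] \<pi>_V)
    show "linear_on s s (vs_at coker p) (map_at coker p q)" if "p \<le> q" for p q
    proof -
      have "linear_on s s (V p) (\<lambda>v. \<pi> q (m p q v))"
        using m_in[OF that] by (intro linear_on_compose[OF lin[OF that], where W="V q"] linear_on_linear[OF lin_\<pi>]) auto
      then have "linear_on s s (V p) (map_at coker p q)" by (simp add: coker_simps[abs_def])
      then show ?thesis by (rule linear_on_subset) (auto simp: coker_simps \<pi>_V)
    qed
    show "map_at coker p p v = v" if "v \<in> vs_at coker p" for p v
      using that by (auto simp: coker_simps m_refl \<pi>_V \<pi>_idem)
    show "map_at coker q r (map_at coker p q v) = map_at coker p r v"
      if "p \<le> q" "q \<le> r" "v \<in> vs_at coker p" for p q r v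
    proof -
      have v: "v \<in> V p" using that by (auto simp: coker_simps \<pi>_V)
      show ?thesis using \<pi>_m_\<pi>[OF that(2) m_in[OF that(1) v]] m_comp[OF that(1,2) v] by (simp add: coker_simps)
    qed
  qed
  show "map_at coker p (p + (1, 1)) v = 0" if "v \<in> vs_at coker p" for p v
  proof -
    have "v \<in> V p" using that by (auto simp: coker_simps \<pi>_V)
    moreover have "d (p + (1, 1)) = p" by (simp add: d_def prod_eq_iff)
    ultimately show ?thesis using \<pi>_zero by (simp add: coker_simps U_def)
  qed
  have "vs_at coker p = {0}" if "V p = {0}" for p
    using that P.linear_0[OF lin_\<pi>] by (simp add: coker_simps)
  then have "{p. vs_at coker p \<noteq> {0}} \<subseteq> {p. V p \<noteq> {0}}" by auto
  then show "finite {p. vs_at coker p \<noteq> {0}}" using fin by (rule finite_subset)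
qed

section \<open>The kernel as a representation, and ranks in kernel and cokernel\<close>

lemma ker_sub: "vs_at ker p \<subseteq> V (d p)"
  by (auto simp: ker_simps)

lemma ker_fin_dim: "fin_dim s (vs_at ker p)"
  unfolding ker_simps
  by (rule fin_dim_subset[OF fin_dim_V P.subspace_kernel_on[OF lin[OF d_le] sub_V]]) auto

lemma ker_thin: "thin_rep s ker"
proof unfold_locales
  show "is_rep s UNIV ker"
  proof (rule is_repI)
    show "fin_dim s (vs_at ker p)" for p by (rule ker_fin_dim)
    show "map_at ker p q v \<in> vs_at ker q" if pq: "p \<le> q" and v: "v \<in> vs_at ker p" for p q v
    proof -
      have v: "v \<in> V (d p)" "m (d p) p v = 0" using v by (auto simp: ker_simps)
      have "m (d q) q (m (d p) (d q) v) = m p q (m (d p) p v)"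
        using m_comp[OF d_mono[OF pq] d_le v(1)] m_comp[OF d_le pq v(1)] by simp
      also have "\<dots> = 0" using v P.linear_on_zero[OF lin[OF pq] sub_V] by simp
      finally show ?thesis using m_in[OF d_mono[OF pq] v(1)] by (simp add: ker_simps)
    qed
    show "linear_on s s (vs_at ker p) (map_at ker p q)" if "p \<le> q" for p q
      unfolding ker_simps(2) by (rule linear_on_subset[OF lin[OF d_mono[OF that]] ker_sub])
    show "map_at ker p p v = v" if "v \<in> vs_at ker p" for p v
      using that m_refl by (simp add: ker_simps)
    show "map_at ker q r (map_at ker p q v) = map_at ker p r v"
      if "p \<le> q" "q \<le> r" "v \<in> vs_at ker p" for p q r v
      unfolding ker_simps(2)
      by (rule m_comp[OF d_mono[OF that(1)] d_mono[OF that(2)]]) (rule subsetD[OF ker_sub that(3)])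
  qed
  show "map_at ker p (p + (1, 1)) v = 0" if "v \<in> vs_at ker p" for p v
  proof -
    have "d (p + (1, 1)) = p" by (simp add: d_def prod_eq_iff)
    then show ?thesis using that by (simp add: ker_simps)
  qed
  have "vs_at ker p = {0}" if "V (d p) = {0}" for p
    using that subspace_0[OF fin_dim_subspace[OF ker_fin_dim[of p]]] ker_sub[of p] by auto
  then have "{p. vs_at ker p \<noteq> {0}} \<subseteq> (\<lambda>p. p + (1, 1)) ` {p. V p \<noteq> {0}}"
    by (force simp: d_def prod_eq_iff image_iff)
  then show "finite {p. vs_at ker p \<noteq> {0}}" using fin by (meson finite_imageI finite_subset)
qed

text \<open>For these \<open>p\<close> the image in \<open>V q\<close> contains \<open>U q\<close>,
  so passing to the quotient removes exactly the rank of xy at \<open>q\<close>.\<close>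

lemma map_rank_coker:
  assumes "d q \<le> p" "p \<le> q"
  shows "int (map_rank s coker p q) = rk p q - rk (d q) q"
proof -
  have "map_at coker p q ` vs_at coker p = \<pi> q ` m p q ` V p"
    unfolding coker_simps image_image by (rule image_cong) (auto simp: \<pi>_m_\<pi>[OF assms(2)] coker_simps)
  moreover have "dim (m p q ` V p) = dim (\<pi> q ` m p q ` V p) + dim {v \<in> m p q ` V p. \<pi> q v = 0}"
    by (rule P.dim_image_kernel[OF linear_on_linear[OF lin_\<pi>] P.fin_dim_image[OF lin[OF assms(2)] fin_dim_V]])
  moreover have "{v \<in> m p q ` V p. \<pi> q v = 0} = U q" using m_step_U[OF assms] \<pi>_zero by auto
  ultimately show ?thesis by (simp add: map_rank_def U_def)
qed

text \<open>In degree \<open>p\<close> the kernel lives in \<open>V (d p)\<close>. Since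
  \<open>d q \<le> p\<close>, whatever dies on the way from \<open>d p\<close> to \<open>d q\<close>
  has died at \<open>p\<close> as well, so the restricted map has the full kernel. The formula
  combines three instances of rank-nullity.\<close>

lemma map_rank_ker:
  assumes "d q \<le> p" "p \<le> q"
  shows "int (map_rank s ker p q) = rk (d p) (d q) - rk (d p) p"
proof -
  have 1: "dim (vs_at ker p) = dim (map_at ker p q ` vs_at ker p) + dim {v \<in> vs_at ker p. map_at ker p q v = 0}"
    unfolding ker_simps(2)
    by (rule P.dim_image_kernel[OF linear_on_subset[OF lin[OF d_mono[OF assms(2)]] ker_sub] ker_fin_dim])
  have "m (d p) p v = 0" if "v \<in> V (d p)" "m (d p) (d q) v = 0" for v
    using m_comp[OF d_mono[OF assms(2)] assms(1) that(1)] that(2) P.linear_on_zero[OF lin[OF assms(1)] sub_V] by simp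
  then have 2: "{v \<in> vs_at ker p. map_at ker p q v = 0} = {v \<in> V (d p). m (d p) (d q) v = 0}"
    by (auto simp: ker_simps)
  have 3: "dim (V (d p)) = dim (m (d p) p ` V (d p)) + dim (vs_at ker p)"
    unfolding ker_simps by (rule P.dim_image_kernel[OF lin[OF d_le] fin_dim_V])
  have 4: "dim (V (d p)) = dim (m (d p) (d q) ` V (d p)) + dim {v \<in> V (d p). m (d p) (d q) v = 0}"
    by (rule P.dim_image_kernel[OF lin[OF d_mono[OF assms(2)]] fin_dim_V])
  show ?thesis using 1 2 3 4 by (simp add: map_rank_def)
qed

text \<open>The correction \<open>rk (d q) q\<close> is the same in the four terms at
  \<open>q\<close>, and their signs add up to 0.\<close>

lemma curve_count_coker:
  assumes "finite A" "{p. V p \<noteq> {0}} \<subseteq> A"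
  shows "int (curve_count s coker) = euler A rk"
proof -
  interpret C: thin_rep s coker by (rule coker_thin)
  have "vs_at coker p = {0}" if "V p = {0}" for p
    using that P.linear_0[OF lin_\<pi>] by (simp add: coker_simps)
  then have "{p. vs_at coker p \<noteq> {0}} \<subseteq> A" using assms by auto
  then have "int (curve_count s coker) = euler A (\<lambda>p q. int (map_rank s coker p q))"
    by (rule C.curve_count_euler[OF assms(1)])
  also have "\<dots> = euler A rk"
    unfolding euler_def
  proof (intro sum.cong refl)
    fix q
    have 1: "d q = q - (1, 1)" by (simp add: d_def prod_eq_iff)
    have *: "int (map_rank s coker (q - e) q) = rk (q - e) q - rk (q - (1, 1)) q"
      if "e \<in> {0, (1, 0), (0, 1), (1, 1)}" for e
      using map_rank_coker[of q "q - e"] that unfolding 1[symmetric] by (auto simp: d_def less_eq_prod_def)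
    show "int (map_rank s coker q q) - int (map_rank s coker (q - (1, 0)) q) -
      int (map_rank s coker (q - (0, 1)) q) + int (map_rank s coker (q - (1, 1)) q) =
      rk q q - rk (q - (1, 0)) q - rk (q - (0, 1)) q + rk (q - (1, 1)) q"
      using *[of 0] *[of "(1, 0)"] *[of "(0, 1)"] *[of "(1, 1)"] by simp
  qed
  finally show ?thesis .
qed

lemma rk_zero:
  assumes "p \<le> q" "V q = {0}"
  shows "rk p q = 0"
proof -
  have "m p q ` V p \<subseteq> {0}" using m_in[OF assms(1)] assms(2) by auto
  moreover have "0 \<in> V p" using subspace_0[OF sub_V] .
  ultimately have "m p q ` V p = {0}" by auto
  then show ?thesis using dim_zero_space by (simp add: map_rank_def)
qed

text \<open>Here the correction depends on the term, and the equality holds only after summation and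
  reindexing.\<close>

lemma curve_count_ker:
  assumes A: "finite A" "{p. V p \<noteq> {0}} \<subseteq> A"
  shows "int (curve_count s ker) = euler A rk"
proof -
  interpret C: thin_rep s ker by (rule ker_thin)
  \<comment> \<open>The translates of \<open>A\<close> that occur are collected so that all
    reindexed sums run over one finite set.\<close>
  define B where "B = (\<Union>e\<in>{0, (1, 0), (0, 1), (1, 1)}. (\<lambda>p. p + e) ` A)"
  have finB: "finite B" using A by (simp add: B_def)
  have AB: "p + e \<in> B" if "p \<in> A" "e \<in> {0, (1, 0), (0, 1), (1, 1)}" for p e
    using that unfolding B_def by blast
  have shift: "(\<Sum>q\<in>B. f (q - e)) = sum f A"
    if "e \<in> {0, (1, 0), (0, 1), (1, 1)}" "\<And>p. V p = {0} \<Longrightarrow> f p = 0" for f :: "int \<times> int \<Rightarrow> int" and e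
  proof -
    have "(\<Sum>q\<in>B. f (q - e)) = (\<Sum>q\<in>(\<lambda>p. p + e) ` A. f (q - e))"
    proof (rule sum.mono_neutral_right[OF finB])
      show "(\<lambda>p. p + e) ` A \<subseteq> B" by (rule image_subsetI) (rule AB[OF _ that(1)])
      show "\<forall>q\<in>B - (\<lambda>p. p + e) ` A. f (q - e) = 0"
      proof
        fix q assume "q \<in> B - (\<lambda>p. p + e) ` A"
        then have "q - e \<notin> A" using imageI[of "q - e" A "\<lambda>p. p + e"] by auto
        then have "V (q - e) = {0}" using A(2) by blast
        then show "f (q - e) = 0" by (rule that(2))
      qed
    qed
    also have "\<dots> = sum f A" by (subst sum.reindex) (auto simp: inj_on_def)
    finally show ?thesis .
  qed
  have "vs_at ker p = {0}" if "V (d p) = {0}" for p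
    using that subspace_0[OF fin_dim_subspace[OF ker_fin_dim[of p]]] ker_sub[of p] by auto
  moreover have "p \<in> B" if "d p \<in> A" for p
    using AB[OF that, of "(1, 1)"] by (simp add: d_def add.assoc zero_prod_def[symmetric])
  ultimately have "{p. vs_at ker p \<noteq> {0}} \<subseteq> B" using A by blast
  then have "int (curve_count s ker) = euler B (\<lambda>p q. int (map_rank s ker p q))"
    by (rule C.curve_count_euler[OF finB])
  \<comment> \<open>The pair with difference (1,1) leaves no term: its two ranks in
    \<open>map_rank_ker\<close> coincide, in accordance with xy = 0 on the kernel.\<close>
  also have "\<dots> = (\<Sum>q\<in>B. rk (q - (1, 1)) (q - (1, 1)) - rk ((q - 0) - (1, 1)) (q - 0)
      - rk ((q - (1, 1)) - (1, 0)) (q - (1, 1)) + rk ((q - (1, 0)) - (1, 1)) (q - (1, 0))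
      - rk ((q - (1, 1)) - (0, 1)) (q - (1, 1)) + rk ((q - (0, 1)) - (1, 1)) (q - (0, 1)))"
    unfolding euler_def
  proof (intro sum.cong refl)
    fix q :: "int \<times> int"
    have d: "d r = r - (1, 1)" for r by (simp add: d_def prod_eq_iff)
    have comm: "q - e - f = q - f - e" for e f :: "int \<times> int" by simp
    have *: "int (map_rank s ker (q - e) q) = rk (q - e - (1, 1)) (q - (1, 1)) - rk (q - e - (1, 1)) (q - e)"
      if "e \<in> {0, (1, 0), (0, 1), (1, 1)}" for e
      using map_rank_ker[of q "q - e"] that unfolding d by (auto simp: less_eq_prod_def)
    show "int (map_rank s ker q q) - int (map_rank s ker (q - (1, 0)) q) -
      int (map_rank s ker (q - (0, 1)) q) + int (map_rank s ker (q - (1, 1)) q) =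
      rk (q - (1, 1)) (q - (1, 1)) - rk ((q - 0) - (1, 1)) (q - 0)
      - rk ((q - (1, 1)) - (1, 0)) (q - (1, 1)) + rk ((q - (1, 0)) - (1, 1)) (q - (1, 0))
      - rk ((q - (1, 1)) - (0, 1)) (q - (1, 1)) + rk ((q - (0, 1)) - (1, 1)) (q - (0, 1))"
      using *[of 0] *[of "(1, 0)"] *[of "(0, 1)"] *[of "(1, 1)"]
      unfolding comm[of "(1, 0)" "(1, 1)"] comm[of "(0, 1)" "(1, 1)"] by simp
  qed
  \<comment> \<open>After reindexing, the sum of \<open>rk (q - (1, 1)) q\<close> occurs with signs
    -, +, + and one copy survives.\<close>
  also have "\<dots> = (\<Sum>q\<in>A. rk q q) - (\<Sum>q\<in>A. rk (q - (1, 1)) q) - (\<Sum>q\<in>A. rk (q - (1, 0)) q)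
      + (\<Sum>q\<in>A. rk (q - (1, 1)) q) - (\<Sum>q\<in>A. rk (q - (0, 1)) q) + (\<Sum>q\<in>A. rk (q - (1, 1)) q)"
  proof -
    have z: "rk (q - e) q = 0" if "V q = {0}" "(0, 0) \<le> e" for q e
      using that by (intro rk_zero) (auto simp: less_eq_prod_def)
    have s0: "(\<Sum>q\<in>B. rk (q - (1, 1)) (q - (1, 1))) = (\<Sum>q\<in>A. rk q q)"
      by (rule shift[where f="\<lambda>q. rk q q"]) (simp, rule rk_zero[OF order_refl])
    have sh: "(\<Sum>q\<in>B. rk (q - e - f) (q - e)) = (\<Sum>q\<in>A. rk (q - f) q)"
      if "e \<in> {0, (1, 0), (0, 1), (1, 1)}" "(0, 0) \<le> f" for e f
      by (rule shift[where f="\<lambda>q. rk (q - f) q", OF that(1)]) (rule z[OF _ that(2)])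
    show ?thesis
      using sh[of 0 "(1, 1)"] sh[of "(1, 1)" "(1, 0)"] sh[of "(1, 0)" "(1, 1)"]
        sh[of "(1, 1)" "(0, 1)"] sh[of "(0, 1)" "(1, 1)"]
      unfolding sum.distrib sum_subtractf s0 by simp
  qed
  also have "\<dots> = euler A rk" by (simp add: euler_def sum.distrib sum_subtractf)
  finally show ?thesis .
qed

lemma total_dim_eq:
  assumes "finite A" "\<And>p. p \<notin> A \<Longrightarrow> dim (F p) = 0"
  shows "total_dim s F = (\<Sum>p\<in>A. dim (F p))"
  unfolding total_dim_def by (rule Sum_any.expand_superset[OF assms(1)]) (rule subsetI, rule ccontr, simp add: assms(2))

lemma total_dims:
  assumes A: "finite A" "{p. V p \<noteq> {0}} \<subseteq> A"
  shows "int (total_dim s V) - int (total_dim s (mult_image W (1, 0)))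
      - int (total_dim s (mult_image W (0, 1))) + int (total_dim s (mult_image W (1, 1))) = euler A rk"
proof -
  have 0: "dim (V p) = map_rank s W p p" for p by (rule map_rank_refl[OF rep, symmetric]) simp
  have 1: "int (total_dim s (mult_image W e)) = (\<Sum>p\<in>A. rk (p - e) p)" if "(0, 0) \<le> e" for e
  proof -
    have "dim (mult_image W e p) = 0" if "p \<notin> A" for p
      using that A \<open>(0, 0) \<le> e\<close> rk_zero[of "p - e" p] by (auto simp: mult_image_def map_rank_def less_eq_prod_def)
    then show ?thesis by (simp add: total_dim_eq[OF A(1)] mult_image_def map_rank_def)
  qed
  have "dim (V p) = 0" if "p \<notin> A" for p
  proof -
    have "V p = {0}" using that A by auto
    then show ?thesis using dim_zero_space by simp
  qed
  then have "int (total_dim s V) = (\<Sum>p\<in>A. rk p p)" by (simp add: total_dim_eq[OF A(1)] 0)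
  then show ?thesis using 1[of "(1, 0)"] 1[of "(0, 1)"] 1[of "(1, 1)"]
    by (simp add: euler_def sum.distrib sum_subtractf)
qed

end

section \<open>From the plane to the grid\<close>

lemma grid_convex: "p \<in> grid a b \<Longrightarrow> r \<in> grid a b \<Longrightarrow> p \<le> q \<Longrightarrow> q \<le> r \<Longrightarrow> q \<in> grid a b"
  by (auto simp: grid_def less_eq_prod_def mem_Times_iff)

lemma finite_grid: "finite (grid a b)"
  by (simp add: grid_def)

text \<open>Padding respects composition because the grid is convex: between two grid points no map
  passes through a padded zero.\<close>

lemma pad_rep:
  assumes s: "vector_space s" and M: "is_rep s (grid a b) M"
  shows "is_rep s UNIV (pad (grid a b) M)"
proof -
  interpret vector_space_pair s s using s by (simp add: vector_space_pair_def)
  note D = is_repD[OF M]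
  have z: "map_at M p q 0 = 0" if "p \<in> grid a b" "q \<in> grid a b" "p \<le> q" for p q
    by (rule linear_on_zero[OF D(3)[OF that] vs1.fin_dim_subspace[OF D(1)[OF that(1)]]])
  show ?thesis
  proof (rule is_repI)
    show "fin_dim s (vs_at (pad (grid a b) M) p)" for p
      using D(1) vs1.fin_dim_zero by (simp add: pad_def)
    show "map_at (pad (grid a b) M) p q v \<in> vs_at (pad (grid a b) M) q"
      if "p \<le> q" "v \<in> vs_at (pad (grid a b) M) p" for p q v
      using that D(2)[of p q] vs1.subspace_0[OF vs1.fin_dim_subspace[OF D(1)[of q]]] by (auto simp: pad_def image_subset_iff)
    show "linear_on s s (vs_at (pad (grid a b) M) p) (map_at (pad (grid a b) M) p q)" if "p \<le> q" for p q
      using that D(3)[of p q] by (auto simp: pad_def linear_on_def)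
    show "map_at (pad (grid a b) M) p p v = v" if "v \<in> vs_at (pad (grid a b) M) p" for p v
      using that D(4) by (auto simp: pad_def split: if_splits)
    show "map_at (pad (grid a b) M) q r (map_at (pad (grid a b) M) p q v) = map_at (pad (grid a b) M) p r v"
      if "p \<le> q" "q \<le> r" "v \<in> vs_at (pad (grid a b) M) p" for p q r v
      using that D(5)[of p q r v] grid_convex[of p a b r q] z[of q r] by (auto simp: pad_def split: if_splits)
  qed
qed

text \<open>The padding is moved from the representation to the rank function, so that ranks are
  taken in the grid representation itself.\<close>

definition grid_euler where
  "grid_euler P r = euler P (\<lambda>p q. if p \<in> P \<and> q \<in> P then r p q else (0::int))"

lemma
  assumes s: "vector_space s" and M: "is_rep s (grid a b) M"
  shows N_sq_euler: "N_sq s (grid a b) M = grid_euler (grid a b) (\<lambda>p q. int (map_rank s M p q))" (is ?sq)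
    and N_Bth_euler: "N_Bth s (grid a b) M = grid_euler (grid a b) (\<lambda>p q. int (map_rank s M p q))" (is ?B)
    and N_Dth_euler: "N_Dth s (grid a b) M = grid_euler (grid a b) (\<lambda>p q. int (map_rank s M p q))" (is ?D)
proof -
  let ?P = "grid a b"
  interpret vector_space s by (rule s)
  have sub: "{p. vs_at (pad ?P M) p \<noteq> {0}} \<subseteq> ?P" by (auto simp: pad_def)
  interpret W: fin_rep s "pad ?P M"
    using pad_rep[OF s M] finite_subset[OF sub finite_grid] by unfold_locales
  have "map_rank s (pad ?P M) p q = (if p \<in> ?P \<and> q \<in> ?P then map_rank s M p q else 0)" if "p \<le> q" for p q
  proof (cases "p \<in> ?P \<and> q \<in> ?P")
    case False
    have "map_at (pad ?P M) p q ` vs_at (pad ?P M) p = {0}"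
      using False subspace_0[OF W.sub_V[of p]] by (auto simp: pad_def)
    then show ?thesis using dim_zero_space by (simp only: map_rank_def if_not_P[OF False])
  qed (simp add: pad_def map_rank_def)
  then have "euler ?P (\<lambda>p q. int (map_rank s (pad ?P M) p q)) = grid_euler ?P (\<lambda>p q. int (map_rank s M p q))"
    unfolding grid_euler_def by (intro euler_cong) simp
  then show ?sq ?B ?D
    using W.total_dims[OF finite_grid sub] W.curve_count_coker[OF finite_grid sub] W.curve_count_ker[OF finite_grid sub]
    by (simp_all add: N_sq_def N_Bth_def N_Dth_def Let_def W.coker_def W.ker_def)
qed

lemma spreads_grid_UNIV: "I \<in> spreads (grid a b) \<Longrightarrow> I \<in> spreads UNIV"
proof -
  assume I: "I \<in> spreads (grid a b)"
  then have sub: "I \<subseteq> grid a b" and cvx: "poset_convex (grid a b) I" by (simp_all add: spreads_def)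
  have "poset_convex UNIV I"
    unfolding poset_convex_def
  proof (intro ballI impI, elim conjE)
    fix x y z assume xyz: "x \<in> I" "z \<in> I" "x \<le> y" "y \<le> z"
    then have "y \<in> grid a b" using grid_convex[OF _ _ xyz(3,4)] sub by blast
    then show "y \<in> I" using xyz cvx unfolding poset_convex_def by blast
  qed
  then show ?thesis using I by (simp add: spreads_def)
qed

text \<open>The common end of all five counts defined by bases: L is linear and equals 1 on each
  spread, so it reads off the sum of the coefficients.\<close>

lemma grid_euler_expand:
  assumes "finite B" "B \<subseteq> spreads (grid a b)"
    and r: "\<And>p q. p \<in> grid a b \<Longrightarrow> q \<in> grid a b \<Longrightarrow> p \<le> q \<Longrightarrow> r p q = (\<Sum>I\<in>B. c I * of_bool (p \<in> I \<and> q \<in> I))"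
  shows "grid_euler (grid a b) r = (\<Sum>I\<in>B. c I)"
proof -
  let ?P = "grid a b"
  have "(if p \<in> ?P \<and> q \<in> ?P then r p q else 0) = (\<Sum>I\<in>B. c I * of_bool (p \<in> I \<and> q \<in> I))" if "p \<le> q" for p q
  proof (cases "p \<in> ?P \<and> q \<in> ?P")
    case False
    have "\<not> (p \<in> I \<and> q \<in> I)" if "I \<in> B" for I
      using assms(2) that False unfolding spreads_def by blast
    then have "(\<Sum>I\<in>B. c I * of_bool (p \<in> I \<and> q \<in> I)) = 0" by (intro sum.neutral) simp
    then show ?thesis by (simp only: if_not_P[OF False])
  qed (simp add: r that)
  then have "grid_euler ?P r = euler ?P (\<lambda>p q. \<Sum>I\<in>B. c I * of_bool (p \<in> I \<and> q \<in> I))"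
    unfolding grid_euler_def by (intro euler_cong) simp
  also have "\<dots> = (\<Sum>I\<in>B. c I * euler ?P (\<lambda>p q. of_bool (p \<in> I \<and> q \<in> I)))" by (rule euler_sum)
  also have "\<dots> = (\<Sum>I\<in>B. c I)"
  proof (intro sum.cong refl)
    fix I assume "I \<in> B"
    then have "I \<in> spreads ?P" using assms by auto
    then have "I \<subseteq> ?P" "I \<in> spreads UNIV" using spreads_grid_UNIV by (auto simp: spreads_def)
    then show "c I * euler ?P (\<lambda>p q. of_bool (p \<in> I \<and> q \<in> I)) = c I"
      using euler_spread[OF _ finite_grid] by simp
  qed
  finally show ?thesis .
qed

section \<open>Unitriangular systems and basis expansions\<close>

text \<open>Add an index \<open>x\<close> of largest \<open>f\<close>. Its unknown is absent from
  the equations of the other indices, and its own equation, with diagonal entry 1, determines it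
  over the integers.\<close>

lemma unitriangular_unique:
  fixes A :: "'i \<Rightarrow> 'i \<Rightarrow> int" and f :: "'i \<Rightarrow> 'b::linorder"
  assumes "finite B" "\<And>i. i \<in> B \<Longrightarrow> A i i = 1"
    and "\<And>i j. i \<in> B \<Longrightarrow> j \<in> B \<Longrightarrow> i \<noteq> j \<Longrightarrow> A i j \<noteq> 0 \<Longrightarrow> f j < f i"
  shows "\<exists>!c. (\<forall>i. i \<notin> B \<longrightarrow> c i = 0) \<and> (\<forall>i\<in>B. v i = (\<Sum>j\<in>B. c j * A i j))"
  using assms
proof (induction B rule: finite_ranking_induct[where f=f])
  case empty
  show ?case by (rule ex1I[of _ "\<lambda>_. 0"]) auto
next
  case (insert x S)
  show ?case
  proof (cases "x \<in> S")
    case True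
    then have "insert x S = S" by auto
    then show ?thesis using insert by auto
  next
    case False
    have "\<exists>!c. (\<forall>i. i \<notin> S \<longrightarrow> c i = 0) \<and> (\<forall>i\<in>S. v i = (\<Sum>j\<in>S. c j * A i j))"
      using insert by auto
    then obtain c where c: "\<And>i. i \<notin> S \<Longrightarrow> c i = 0" "\<And>i. i \<in> S \<Longrightarrow> v i = (\<Sum>j\<in>S. c j * A i j)"
      and un: "\<And>c'. (\<forall>i. i \<notin> S \<longrightarrow> c' i = 0) \<and> (\<forall>i\<in>S. v i = (\<Sum>j\<in>S. c' j * A i j)) \<Longrightarrow> c' = c"
      by (elim ex1E) blast
    have zero: "A i x = 0" if "i \<in> S" for i
      using insert.prems(2)[of i x] insert.hyps(2)[OF that] that False by force
    have one: "A x x = 1" using insert.prems by simp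
    have expand: "(\<Sum>j\<in>insert x S. e j * A i j) = e x * A i x + (\<Sum>j\<in>S. e j * A i j)" for e i
      using insert.hyps(1) False by simp
    show ?thesis
    proof (rule ex1I[of _ "c(x := v x - (\<Sum>j\<in>S. c j * A x j))"], goal_cases)
      case 1
      have upd: "(\<Sum>j\<in>S. (c(x := y)) j * A i j) = (\<Sum>j\<in>S. c j * A i j)" for y i
        using False by (intro sum.cong) auto
      show ?case unfolding expand upd using c zero one by auto
    next
      case (2 e)
      have upd: "(\<Sum>j\<in>S. (e(x := 0)) j * A i j) = (\<Sum>j\<in>S. e j * A i j)" for i
        using False by (intro sum.cong) auto
      have "e(x := 0) = c"
      proof (intro un conjI allI impI ballI)
        show "(e(x := 0)) i = 0" if "i \<notin> S" for i using 2 that by auto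
        show "v i = (\<Sum>j\<in>S. (e(x := 0)) j * A i j)" if "i \<in> S" for i
          using 2 that zero unfolding expand upd by simp
      qed
      moreover have "e x = v x - (\<Sum>j\<in>S. c j * A x j)"
        using 2 one upd[of x] unfolding expand \<open>e(x := 0) = c\<close> by simp
      ultimately show ?case by (metis fun_upd_triv fun_upd_upd)
    qed
  qed
qed

lemma zeta_unique:
  fixes v :: "'a set \<Rightarrow> int"
  assumes "finite B" "\<And>I. I \<in> B \<Longrightarrow> finite I"
  shows "\<exists>!c. (\<forall>I. I \<notin> B \<longrightarrow> c I = 0) \<and> (\<forall>I\<in>B. v I = (\<Sum>J\<in>B. c J * of_bool (I \<subseteq> J)))"
  by (rule unitriangular_unique[where f="\<lambda>I. - int (card I)"])
    (use assms in \<open>auto simp: of_bool_def psubset_card_mono split: if_splits\<close>)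

text \<open>Handles \<open>basis_expansion\<close> and its \<open>THE\<close> once and for all. What
  remains for each count is a uniquely solvable finite system and the coefficient sum of a
  solution.\<close>

lemma basis_count_eq:
  assumes B: "finite B"
    and ex1: "\<exists>!c. (\<forall>i. i \<notin> B \<longrightarrow> c i = 0) \<and> (\<forall>x\<in>T. \<alpha>M x = (\<Sum>i\<in>B. c i * \<alpha>B i x))"
    and N: "\<And>c. (\<And>x. x \<in> T \<Longrightarrow> \<alpha>M x = (\<Sum>i\<in>B. c i * \<alpha>B i x)) \<Longrightarrow> (\<Sum>i\<in>B. c i) = N"
  shows "basis_count B T \<alpha>B \<alpha>M = N"
proof -
  have restrict: "(\<Sum>i | c i \<noteq> 0. c i * g i) = (\<Sum>i\<in>B. c i * g i)" if "\<And>i. i \<notin> B \<Longrightarrow> c i = 0" for c g :: "'a \<Rightarrow> int"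
    using that B by (intro sum.mono_neutral_left) auto
  have "basis_expansion B T \<alpha>B \<alpha>M c \<longleftrightarrow> (\<forall>i. i \<notin> B \<longrightarrow> c i = 0) \<and> (\<forall>x\<in>T. \<alpha>M x = (\<Sum>i\<in>B. c i * \<alpha>B i x))" for c
  proof (cases "\<forall>i. i \<notin> B \<longrightarrow> c i = 0")
    case True
    then have "{i. c i \<noteq> 0} \<subseteq> B" by auto
    with True show ?thesis using restrict[of c] finite_subset[OF _ B] by (auto simp: basis_expansion_def)
  qed (auto simp: basis_expansion_def)
  then have *: "\<exists>!c. basis_expansion B T \<alpha>B \<alpha>M c" and **: "\<And>c. basis_expansion B T \<alpha>B \<alpha>M c \<Longrightarrow>
      (\<forall>i. i \<notin> B \<longrightarrow> c i = 0) \<and> (\<forall>x\<in>T. \<alpha>M x = (\<Sum>i\<in>B. c i * \<alpha>B i x))" using ex1 by auto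
  define c where "c = (THE c. basis_expansion B T \<alpha>B \<alpha>M c)"
  have c: "\<And>i. i \<notin> B \<Longrightarrow> c i = 0" "\<And>x. x \<in> T \<Longrightarrow> \<alpha>M x = (\<Sum>i\<in>B. c i * \<alpha>B i x)"
    using **[OF theI'[OF *], folded c_def] by auto
  have "basis_count B T \<alpha>B \<alpha>M = (\<Sum>i | c i \<noteq> 0. c i * 1)" by (simp add: basis_count_def c_def Let_def)
  also have "\<dots> = (\<Sum>i\<in>B. c i)" using restrict[of c "\<lambda>_. 1", OF c(1)] by simp
  finally show ?thesis using N[OF c(2)] by simp
qed

section \<open>Spreads and segments of a finite poset\<close>

lemma finite_spreads: "finite P \<Longrightarrow> finite (spreads P)"
  by (rule finite_subset[of _ "Pow P"]) (auto simp: spreads_def)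

lemma spreads_finite: "finite P \<Longrightarrow> I \<in> spreads P \<Longrightarrow> finite I"
  by (auto simp: spreads_def intro: finite_subset)

lemma connected_least:
  assumes "x \<in> I" "\<And>z. z \<in> I \<Longrightarrow> x \<le> z"
  shows "poset_connected I"
  unfolding poset_connected_def
proof (intro ballI)
  fix y z assume "y \<in> I" "z \<in> I"
  then have "(y, x) \<in> {(u, v). u \<in> I \<and> v \<in> I \<and> (u \<le> v \<or> v \<le> u)}"
    "(x, z) \<in> {(u, v). u \<in> I \<and> v \<in> I \<and> (u \<le> v \<or> v \<le> u)}" using assms by auto
  then show "(y, z) \<in> {(u, v). u \<in> I \<and> v \<in> I \<and> (u \<le> v \<or> v \<le> u)}\<^sup>*"
    by (meson r_into_rtrancl rtrancl_trans)
qed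

lemma segment_ends: "p \<in> P \<Longrightarrow> q \<in> P \<Longrightarrow> p \<le> q \<Longrightarrow> p \<in> segment P p q \<and> q \<in> segment P p q"
  by (simp add: segment_def)

lemma segment_spread:
  assumes "p \<in> P" "q \<in> P" "p \<le> q"
  shows "segment P p q \<in> spreads P"
proof -
  have "poset_connected (segment P p q)"
    by (rule connected_least[of p]) (use assms in \<open>auto simp: segment_def\<close>)
  moreover have "poset_convex P (segment P p q)"
    unfolding poset_convex_def segment_def using order_trans by blast
  ultimately show ?thesis using segment_ends[OF assms] by (auto simp: spreads_def segment_def)
qed

text \<open>By convexity. At a segment, the inclusion matrix therefore contains the ranks of the
  spread representations.\<close>

lemma segment_subset_iff:
  assumes "p \<in> P" "q \<in> P" "p \<le> q" "J \<in> spreads P"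
  shows "segment P p q \<subseteq> J \<longleftrightarrow> p \<in> J \<and> q \<in> J"
  using segment_ends[OF assms(1-3)] assms(4) unfolding spreads_def poset_convex_def segment_def by blast

text \<open>Generalized ranks and compressed multiplicities both have the inclusion matrix on spread
  representations. The values of \<open>\<alpha>M\<close> at other spreads affect the coefficients
  but not their sum.\<close>

lemma zeta_count:
  assumes "\<And>I J. I \<in> spreads (grid a b) \<Longrightarrow> J \<in> spreads (grid a b) \<Longrightarrow> \<alpha>B J I = of_bool (I \<subseteq> J)"
    and "\<And>p q. p \<in> grid a b \<Longrightarrow> q \<in> grid a b \<Longrightarrow> p \<le> q \<Longrightarrow> \<alpha>M (segment (grid a b) p q) = r p q"
  shows "basis_count (spreads (grid a b)) (spreads (grid a b)) \<alpha>B \<alpha>M = grid_euler (grid a b) r"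
proof (rule basis_count_eq)
  let ?B = "spreads (grid a b)"
  have eq: "(\<Sum>J\<in>?B. c J * \<alpha>B J I) = (\<Sum>J\<in>?B. c J * of_bool (I \<subseteq> J))" if "I \<in> ?B" for c I
    using assms(1)[OF that] by (intro sum.cong) auto
  show "finite ?B" by (rule finite_spreads[OF finite_grid])
  show "\<exists>!c. (\<forall>i. i \<notin> ?B \<longrightarrow> c i = 0) \<and> (\<forall>I\<in>?B. \<alpha>M I = (\<Sum>J\<in>?B. c J * \<alpha>B J I))"
    using zeta_unique[of ?B \<alpha>M] finite_spreads[OF finite_grid] spreads_finite[OF finite_grid] by (simp add: eq)
  fix c assume c: "\<And>I. I \<in> ?B \<Longrightarrow> \<alpha>M I = (\<Sum>J\<in>?B. c J * \<alpha>B J I)"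
  have "grid_euler (grid a b) r = (\<Sum>J\<in>?B. c J)"
  proof (rule grid_euler_expand)
    fix p q assume pq: "p \<in> grid a b" "q \<in> grid a b" "p \<le> q"
    have "r p q = (\<Sum>J\<in>?B. c J * of_bool (segment (grid a b) p q \<subseteq> J))"
      using c[OF segment_spread[OF pq]] assms(2)[OF pq] eq[OF segment_spread[OF pq]] by simp
    also have "\<dots> = (\<Sum>J\<in>?B. c J * of_bool (p \<in> J \<and> q \<in> J))"
      by (intro sum.cong refl) (simp add: segment_subset_iff[OF pq])
    finally show "r p q = (\<Sum>J\<in>?B. c J * of_bool (p \<in> J \<and> q \<in> J))" .
  qed (use finite_spreads[OF finite_grid] in auto)
  then show "(\<Sum>J\<in>?B. c J) = grid_euler (grid a b) r" by simp
qed

lemma N_sign_barc_euler: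
  fixes s :: "'k::field \<Rightarrow> 'v::ab_group_add \<Rightarrow> 'v"
  shows "N_sign_barc s (grid a b) M = grid_euler (grid a b) (\<lambda>p q. int (map_rank s M p q))"
  unfolding N_sign_barc_def
proof (rule basis_count_eq)
  let ?P = "grid a b"
  let ?B = "segments ?P" and ?T = "{(p, q). p \<in> ?P \<and> q \<in> ?P \<and> p \<le> q}"
  let ?h = "\<lambda>(p, q). segment ?P p q" and ?r = "\<lambda>(p, q). int (map_rank s M p q)"
  have B: "?B = ?h ` ?T" by (auto simp: segments_def)
  have sub: "?B \<subseteq> spreads ?P" using segment_spread by (auto simp: segments_def)
  then show fin: "finite ?B" using finite_spreads[OF finite_grid] finite_subset by blast
  have inj: "inj_on ?h ?T"
  proof (rule inj_onI, clarify)
    fix p q p' q' :: "int \<times> int"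
    assume "p \<in> ?P" "q \<in> ?P" "p \<le> q" "p' \<in> ?P" "q' \<in> ?P" "p' \<le> q'" "segment ?P p q = segment ?P p' q'"
    then have "p \<in> segment ?P p' q' \<and> q \<in> segment ?P p' q'" "p' \<in> segment ?P p q \<and> q' \<in> segment ?P p q"
      using segment_ends[of p ?P q] segment_ends[of p' ?P q'] by auto
    then show "p = p' \<and> q = q'" by (auto simp: segment_def intro: antisym)
  qed
  have \<alpha>B: "(case (p, q) of (p, q) \<Rightarrow> int (map_rank ((*) :: 'k \<Rightarrow> 'k \<Rightarrow> 'k) (spread_rep J) p q)) = of_bool (?h (p, q) \<subseteq> J)"
    if "(p, q) \<in> ?T" "J \<in> ?B" for p q J
    using that sub segment_subset_iff[of p ?P q J] by (auto simp: map_rank_spread)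
  \<comment> \<open>The equations are indexed by pairs and the unknowns by segments; inverting the
    injective map from pairs to segments gives the square system of
    \<open>zeta_unique\<close>.\<close>
  let ?v = "\<lambda>I. ?r (the_inv_into ?T ?h I)"
  have v: "?v (?h x) = ?r x" if "x \<in> ?T" for x using the_inv_into_f_f[OF inj that] by simp
  have ball_B: "(\<forall>I\<in>?B. Q I) \<longleftrightarrow> (\<forall>x\<in>?T. Q (?h x))" for Q unfolding B by blast
  have "(\<forall>I\<in>?B. ?v I = (\<Sum>J\<in>?B. c J * of_bool (I \<subseteq> J))) \<longleftrightarrow>
    (\<forall>x\<in>?T. ?r x = (\<Sum>J\<in>?B. c J * (case x of (p, q) \<Rightarrow> int (map_rank ((*) :: 'k \<Rightarrow> 'k \<Rightarrow> 'k) (spread_rep J) p q))))" for c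
    unfolding ball_B
  proof (rule ball_cong[OF refl])
    fix x assume x: "x \<in> ?T"
    have "(\<Sum>J\<in>?B. c J * (case x of (p, q) \<Rightarrow> int (map_rank ((*) :: 'k \<Rightarrow> 'k \<Rightarrow> 'k) (spread_rep J) p q)))
      = (\<Sum>J\<in>?B. c J * of_bool (?h x \<subseteq> J))"
      using x \<alpha>B by (cases x) (intro sum.cong, auto)
    then show "?v (?h x) = (\<Sum>J\<in>?B. c J * of_bool (?h x \<subseteq> J)) \<longleftrightarrow>
      ?r x = (\<Sum>J\<in>?B. c J * (case x of (p, q) \<Rightarrow> int (map_rank ((*) :: 'k \<Rightarrow> 'k \<Rightarrow> 'k) (spread_rep J) p q)))"
      by (simp only: v[OF x])
  qed
  moreover have "finite I" if "I \<in> ?B" for I using that sub spreads_finite[OF finite_grid] by auto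
  ultimately show "\<exists>!c. (\<forall>i. i \<notin> ?B \<longrightarrow> c i = 0) \<and>
    (\<forall>x\<in>?T. ?r x = (\<Sum>J\<in>?B. c J * (case x of (p, q) \<Rightarrow> int (map_rank ((*) :: 'k \<Rightarrow> 'k \<Rightarrow> 'k) (spread_rep J) p q))))"
    using zeta_unique[OF fin, of ?v] by simp
  fix c
  assume c: "\<And>x. x \<in> ?T \<Longrightarrow> ?r x = (\<Sum>J\<in>?B. c J * (case x of (p, q) \<Rightarrow> int (map_rank ((*) :: 'k \<Rightarrow> 'k \<Rightarrow> 'k) (spread_rep J) p q)))"
  have "grid_euler ?P (\<lambda>p q. int (map_rank s M p q)) = (\<Sum>J\<in>?B. c J)"
  proof (rule grid_euler_expand[OF fin sub])
    fix p q assume "p \<in> ?P" "q \<in> ?P" "p \<le> q"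
    then show "int (map_rank s M p q) = (\<Sum>J\<in>?B. c J * of_bool (p \<in> J \<and> q \<in> J))"
      using c[of "(p, q)"] by (simp add: map_rank_spread)
  qed
  then show "(\<Sum>J\<in>?B. c J) = grid_euler ?P (\<lambda>p q. int (map_rank s M p q))" by simp
qed

section \<open>Generalized ranks\<close>

lemma is_rep_subset:
  assumes M: "is_rep s P M" and Q: "Q \<subseteq> P"
  shows "is_rep s Q M"
proof (rule is_repI)
  note sub = subsetD[OF Q]
  show "fin_dim s (vs_at M p)" if "p \<in> Q" for p by (rule is_repD(1)[OF M sub[OF that]])
  show "map_at M p q v \<in> vs_at M q" if "p \<in> Q" "q \<in> Q" "p \<le> q" "v \<in> vs_at M p" for p q v
    using is_repD(2)[OF M sub[OF that(1)] sub[OF that(2)] that(3)] that(4) by (rule subsetD[OF _ imageI])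
  show "linear_on s s (vs_at M p) (map_at M p q)" if "p \<in> Q" "q \<in> Q" "p \<le> q" for p q
    by (rule is_repD(3)[OF M sub[OF that(1)] sub[OF that(2)] that(3)])
  show "map_at M p p v = v" if "p \<in> Q" "v \<in> vs_at M p" for p v
    by (rule is_repD(4)[OF M sub[OF that(1)] that(2)])
  show "map_at M q r (map_at M p q v) = map_at M p r v"
    if "p \<in> Q" "q \<in> Q" "r \<in> Q" "p \<le> q" "q \<le> r" "v \<in> vs_at M p" for p q r v
    by (rule is_repD(5)[OF M sub[OF that(1)] sub[OF that(2)] sub[OF that(3)] that(4-6)])
qed

lemma spread_is_rep:
  assumes "poset_convex P J"
  shows "is_rep ((*) :: 'k::field \<Rightarrow> 'k \<Rightarrow> 'k) P (spread_rep J)"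
proof (rule is_repI)
  interpret vector_space "(*) :: 'k \<Rightarrow> 'k \<Rightarrow> 'k" by (rule vector_space_field)
  show "fin_dim ((*) :: 'k \<Rightarrow> 'k \<Rightarrow> 'k) (vs_at (spread_rep J) p)" for p
    using fin_dim_field[where 'k='k] fin_dim_zero by (simp add: spread_rep_def)
  show "map_at (spread_rep J) q r (map_at (spread_rep J) p q v) = map_at (spread_rep J) p r (v :: 'k)"
    if "p \<in> P" "q \<in> P" "r \<in> P" "p \<le> q" "q \<le> r" "v \<in> vs_at (spread_rep J) p" for p q r v
  proof -
    have "q \<in> J" if "p \<in> J" "r \<in> J"
      using assms that \<open>q \<in> P\<close> \<open>p \<le> q\<close> \<open>q \<le> r\<close> unfolding poset_convex_def by blast
    then show ?thesis using that(6) by (auto simp: spread_rep_def)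
  qed
qed (auto simp: spread_rep_def linear_on_def)

lemma spreads_is_rep: "J \<in> spreads P \<Longrightarrow> is_rep ((*) :: 'k::field \<Rightarrow> 'k \<Rightarrow> 'k) P (spread_rep J)"
  by (rule spread_is_rep) (simp add: spreads_def)

text \<open>A cocone \<open>t\<close> induces a map on the direct sum that kills the generating
  relations. This part of the universal property detects nonzero elements of the colimit. Membership
  in the spaces is carried along because \<open>t\<close> is linear only there.\<close>

lemma colim_relations_cocone:
  fixes s :: "'k::field \<Rightarrow> 'v::ab_group_add \<Rightarrow> 'v" and u :: "'k \<Rightarrow> 'w::ab_group_add \<Rightarrow> 'w"
  assumes s: "vector_space s" and u: "vector_space u" and I: "finite I" and M: "is_rep s I M"
    and t: "\<And>p. p \<in> I \<Longrightarrow> linear_on s u (vs_at M p) (t p)"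
    and cocone: "\<And>p q v. p \<in> I \<Longrightarrow> q \<in> I \<Longrightarrow> p \<le> q \<Longrightarrow> v \<in> vs_at M p \<Longrightarrow> t q (map_at M p q v) = t p v"
    and g: "g \<in> colim_relations s I M"
  shows "(\<forall>z\<in>I. g z \<in> vs_at M z) \<and> (\<Sum>z\<in>I. t z (g z)) = 0"
proof -
  interpret vector_space_pair s u using s u by (simp add: vector_space_pair_def)
  interpret F: vector_space "scale_fun s" by (rule vector_space_scale_fun[OF s])
  note sub = vs1.fin_dim_subspace[OF is_repD(1)[OF M]]
  note t0 = linear_on_zero[OF t sub]
  show ?thesis
    using g unfolding colim_relations_def
  proof (induction rule: F.span_induct_alt)
    case base
    show ?case using t0 vs1.subspace_0[OF sub] by simp
  next
    case (step c x y)
    then obtain p q v where x: "x = single p v - single q (map_at M p q v)"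
      and pq: "p \<in> I" "q \<in> I" "p \<le> q" "v \<in> vs_at M p" by auto
    have q: "map_at M p q v \<in> vs_at M q" using is_repD(2)[OF M pq(1-3)] pq(4) by auto
    have in1: "single p v z \<in> vs_at M z" "single q (map_at M p q v) z \<in> vs_at M z" if "z \<in> I" for z
      using pq q vs1.subspace_0[OF sub[OF that]] by (auto simp: single_def)
    then have xin: "x z \<in> vs_at M z" if "z \<in> I" for z
      using that vs1.subspace_diff[OF sub[OF that]] by (simp add: x)
    have "(\<Sum>z\<in>I. t z (x z)) = (\<Sum>z\<in>I. (if z = p then t p v else 0) - (if z = q then t q (map_at M p q v) else 0))"
    proof (intro sum.cong refl)
      fix z assume z: "z \<in> I"
      have "t z (x z) = t z (single p v z) - t z (single q (map_at M p q v) z)"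
        using linear_on_diff[OF t sub in1] z by (simp add: x)
      then show "t z (x z) = (if z = p then t p v else 0) - (if z = q then t q (map_at M p q v) else 0)"
        using t0[OF z z] by (auto simp: single_def)
    qed
    also have "\<dots> = 0" using I pq cocone[OF pq] by (simp add: sum_subtractf)
    finally have x0: "(\<Sum>z\<in>I. t z (x z)) = 0" .
    have cx: "s c (x z) \<in> vs_at M z" if "z \<in> I" for z using vs1.subspace_scale[OF sub[OF that] xin[OF that]] .
    have "(\<Sum>z\<in>I. t z ((scale_fun s c x + y) z)) = (\<Sum>z\<in>I. u c (t z (x z)) + t z (y z))"
      using step.IH linear_on_add[OF t cx] linear_on_scale[OF t xin]
      by (intro sum.cong refl) (simp add: scale_fun_def)
    also have "\<dots> = 0" using step.IH x0 by (simp add: sum.distrib vs2.scale_sum_right[symmetric])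
    finally show ?case using step.IH cx vs1.subspace_add[OF sub] by (simp add: scale_fun_def)
  qed
qed

context
  fixes s :: "'k::field \<Rightarrow> 'v::ab_group_add \<Rightarrow> 'v" and I :: "'p::order set" and M :: "('p, 'v) poset_rep"
  assumes s: "vector_space s"
begin

interpretation vector_space_pair s "scale_fun s"
  using s vector_space_scale_fun[OF s] by (simp add: vector_space_pair_def)

interpretation Q: vector_space_pair "scale_fun s" "scale_fun s"
  by unfold_locales

lemma linear_colim_inj: "Vector_Spaces.linear s (scale_fun s) (colim_inj s I M p)"
proof -
  have "Vector_Spaces.linear s (scale_fun s) (single p)"
    unfolding Vector_Spaces.linear_iff
    by (auto simp: single_def scale_fun_def fun_eq_iff vs1.vector_space_axioms vs2.vector_space_axioms)
  from Vector_Spaces.linear_compose[OF this vs2.quot_map(1)[of "colim_relations s I M"]]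
  show ?thesis unfolding colim_inj_def colim_relations_def comp_def by simp
qed

lemma colim_inj_zero_iff: "colim_inj s I M p v = 0 \<longleftrightarrow> single p v \<in> colim_relations s I M"
  unfolding colim_inj_def by (rule vs2.quot_map(3)) (simp add: colim_relations_def)

text \<open>For comparable points the two families differ by a generating relation; a path in
  \<open>I\<close> then moves the arbitrarily chosen base point to \<open>p\<close>.\<close>

lemma lim_to_colim_eq:
  assumes con: "poset_connected I" and f: "f \<in> lim_space I M" and p: "p \<in> I"
  shows "lim_to_colim s I M f = colim_inj s I M p (f p)"
proof -
  have le: "colim_inj s I M x (f x) = colim_inj s I M y (f y)" if "x \<in> I" "y \<in> I" "x \<le> y" for x y
  proof -
    have "f y = map_at M x y (f x)" "f x \<in> vs_at M x" using f that by (simp_all add: lim_space_def)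
    then have "single x (f x) - single y (f y) \<in> colim_relations s I M"
      unfolding colim_relations_def using that
      by (intro vs2.span_base CollectI exI[of _ x] exI[of _ y] exI[of _ "f x"]) simp
    moreover have "vs2.subspace (colim_relations s I M)" by (simp add: colim_relations_def)
    ultimately have "quot_map (scale_fun s) (colim_relations s I M) (single x (f x) - single y (f y)) = 0"
      using vs2.quot_map(3) by blast
    then show ?thesis
      using Q.linear_diff[OF vs2.quot_map(1)[OF \<open>vs2.subspace (colim_relations s I M)\<close>]]
      by (simp add: colim_inj_def)
  qed
  define x where "x = (SOME p. p \<in> I)"
  have "x \<in> I" unfolding x_def using p by (rule someI)
  then have "(x, p) \<in> {(u, v). u \<in> I \<and> v \<in> I \<and> (u \<le> v \<or> v \<le> u)}\<^sup>*"
    using con p by (simp add: poset_connected_def)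
  then have "colim_inj s I M x (f x) = colim_inj s I M p (f p)"
  proof (induction rule: rtrancl_induct)
    case (step y z)
    from step(2) have "y \<in> I" "z \<in> I" "y \<le> z \<or> z \<le> y" by simp_all
    then have "colim_inj s I M y (f y) = colim_inj s I M z (f z)" by (metis le)
    with step.IH show ?case by (rule trans)
  qed (rule refl)
  then show ?thesis by (simp add: lim_to_colim_def x_def)
qed

text \<open>The cocone factors through the colimit, so injectivity of its component at
  \<open>p\<close> passes to the canonical map there.\<close>

lemma colim_inj_inj_on:
  fixes u :: "'k \<Rightarrow> 'w::ab_group_add \<Rightarrow> 'w"
  assumes I: "finite I" and M: "is_rep s I M" and u: "vector_space u"
    and t: "\<And>p. p \<in> I \<Longrightarrow> linear_on s u (vs_at M p) (t p)"
    and cocone: "\<And>p q v. p \<in> I \<Longrightarrow> q \<in> I \<Longrightarrow> p \<le> q \<Longrightarrow> v \<in> vs_at M p \<Longrightarrow> t q (map_at M p q v) = t p v"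
    and p: "p \<in> I" and inj: "inj_on (t p) (vs_at M p)"
  shows "inj_on (colim_inj s I M p) (vs_at M p)"
proof -
  interpret U: vector_space_pair s u using s u by (simp add: vector_space_pair_def)
  note sub = vs1.fin_dim_subspace[OF is_repD(1)[OF M]]
  have "v = 0" if v: "v \<in> vs_at M p" "colim_inj s I M p v = 0" for v
  proof -
    have "single p v \<in> colim_relations s I M" using v(2) colim_inj_zero_iff by simp
    then have "(\<Sum>z\<in>I. t z (single p v z)) = 0"
      using colim_relations_cocone[OF s u I M t cocone] by blast
    moreover have "(\<Sum>z\<in>I. t z (single p v z)) = (\<Sum>z\<in>I. if z = p then t p v else 0)"
      using U.linear_on_zero[OF t sub] by (intro sum.cong) (auto simp: single_def)
    ultimately have "t p v = 0" using I p by simp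
    then show "v = 0" using inj v(1) U.linear_on_inj_iff[OF t[OF p] sub[OF p]] by auto
  qed
  then show ?thesis
    by (subst linear_on_inj_iff[OF linear_on_linear[OF linear_colim_inj] sub[OF p]]) auto
qed

end

text \<open>A compatible family is determined by its value at the least point \<open>p\<close>, and
  the maps into the space at the greatest point \<open>q\<close> form a cocone that is the identity
  there. Read at \<open>q\<close>, the map from limit to colimit is the structure map from
  \<open>p\<close> to \<open>q\<close>.\<close>

lemma generalized_rank_segment:
  assumes s: "vector_space s" and M: "is_rep s P M" and P: "finite P"
    and pq: "p \<in> P" "q \<in> P" "p \<le> q"
  shows "generalized_rank s (segment P p q) M = map_rank s M p q"
proof -
  interpret vector_space_pair s "scale_fun s"
    using s vector_space_scale_fun[OF s] by (simp add: vector_space_pair_def)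
  let ?I = "segment P p q"
  have IP: "?I \<subseteq> P" by (auto simp: segment_def)
  have MI: "is_rep s ?I M" by (rule is_rep_subset[OF M IP])
  have ends: "p \<in> ?I" "q \<in> ?I" using segment_ends[OF pq] by auto
  have bd: "p \<le> z" "z \<le> q" if "z \<in> ?I" for z using that by (auto simp: segment_def)
  have con: "poset_connected ?I" using segment_spread[OF pq] by (simp add: spreads_def)
  have "lim_to_colim s ?I M ` lim_space ?I M = colim_inj s ?I M q ` map_at M p q ` vs_at M p" (is "?L = ?R")
  proof
    show "?L \<subseteq> ?R"
    proof (rule image_subsetI)
      fix f assume f: "f \<in> lim_space ?I M"
      then have "f p \<in> vs_at M p" "f q = map_at M p q (f p)" using ends pq by (auto simp: lim_space_def)
      moreover from this have "lim_to_colim s ?I M f = colim_inj s ?I M q (map_at M p q (f p))"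
        using lim_to_colim_eq[OF s con f ends(2)] by simp
      ultimately show "lim_to_colim s ?I M f \<in> ?R" by simp
    qed
    show "?R \<subseteq> ?L"
    proof (clarify)
      fix v assume v: "v \<in> vs_at M p"
      define f where "f z = (if z \<in> ?I then map_at M p z v else 0)" for z
      have f: "f \<in> lim_space ?I M"
        unfolding lim_space_def f_def using is_repD(2)[OF MI ends(1) _ bd(1)] is_repD(5)[OF MI ends(1) _ _ bd(1)] v
        by auto
      have "lim_to_colim s ?I M f = colim_inj s ?I M q (map_at M p q v)"
        using lim_to_colim_eq[OF s con f ends(2)] ends by (simp add: f_def)
      then show "colim_inj s ?I M q (map_at M p q v) \<in> ?L" using f by (metis imageI)
    qed
  qed
  moreover have "inj_on (colim_inj s ?I M q) (vs_at M q)"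
  proof (rule colim_inj_inj_on[OF s _ MI s, where t="\<lambda>z. map_at M z q"])
    show "finite ?I" using IP P by (rule finite_subset)
    show "linear_on s s (vs_at M z) (map_at M z q)" if "z \<in> ?I" for z
      using is_repD(3)[OF MI that ends(2) bd(2)[OF that]] .
    show "map_at M y q (map_at M x y v) = map_at M x q v"
      if "x \<in> ?I" "y \<in> ?I" "x \<le> y" "v \<in> vs_at M x" for x y v
      using is_repD(5)[OF MI that(1,2) ends(2) that(3) bd(2)[OF that(2)] that(4)] .
    show "inj_on (map_at M q q) (vs_at M q)" using is_repD(4)[OF MI ends(2)] by (simp add: inj_on_def)
  qed (rule ends)
  then have "vs2.dim (colim_inj s ?I M q ` map_at M p q ` vs_at M p) = vs1.dim (map_at M p q ` vs_at M p)"
    by (intro dim_image_inj_on[OF linear_on_linear[OF linear_colim_inj[OF s]] vs1.fin_dim_subspace[OF is_repD(1)[OF MI ends(2)]]]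
        is_repD(2)[OF MI ends pq(3)])
  ultimately show ?thesis by (simp add: generalized_rank_def map_rank_def)
qed

text \<open>If \<open>I\<close> lies in \<open>J\<close>, the representation is constant on
  \<open>I\<close> and the identities form a cocone. Otherwise a point of \<open>I\<close> outside
  \<open>J\<close> can serve as base point, and every compatible family vanishes there.\<close>

lemma generalized_rank_spread:
  assumes P: "finite P" and I: "I \<in> spreads P" and J: "J \<in> spreads P"
  shows "generalized_rank ((*) :: 'k::field \<Rightarrow> 'k \<Rightarrow> 'k) I (spread_rep J) = of_bool (I \<subseteq> J)"
proof -
  let ?s = "(*) :: 'k \<Rightarrow> 'k \<Rightarrow> 'k" and ?J = "spread_rep J :: ('a, 'k) poset_rep"
  have s: "vector_space ?s" by (rule vector_space_field)
  interpret vector_space_pair ?s "scale_fun ?s"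
    using s vector_space_scale_fun[OF s] by (simp add: vector_space_pair_def)
  have con: "poset_connected I" and ne: "I \<noteq> {}" and IP: "I \<subseteq> P" using I by (auto simp: spreads_def)
  have MI: "is_rep ?s I ?J" by (rule is_rep_subset[OF spreads_is_rep[OF J] IP])
  show ?thesis
  proof (cases "I \<subseteq> J")
    case True
    obtain p where p: "p \<in> I" using ne by blast
    have "lim_to_colim ?s I ?J ` lim_space I ?J = colim_inj ?s I ?J p ` UNIV" (is "?L = ?R")
    proof
      show "?L \<subseteq> ?R"
        by (rule image_subsetI) (subst lim_to_colim_eq[OF s con _ p], assumption, rule imageI, rule UNIV_I)
      show "?R \<subseteq> ?L"
      proof clarify
        fix c :: 'k
        define f where "f z = (if z \<in> I then c else 0)" for z
        have f: "f \<in> lim_space I ?J" using True by (auto simp: lim_space_def spread_rep_def f_def)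
        have "lim_to_colim ?s I ?J f = colim_inj ?s I ?J p c"
          using lim_to_colim_eq[OF s con f p] p by (simp add: f_def)
        then show "colim_inj ?s I ?J p c \<in> ?L" using f by (metis imageI)
      qed
    qed
    moreover have "inj_on (colim_inj ?s I ?J p) (vs_at ?J p)"
    proof (rule colim_inj_inj_on[OF s _ MI s, where t="\<lambda>z v. v"])
      show "finite I" using IP P by (rule finite_subset)
    qed (use p True in \<open>auto simp: linear_on_def spread_rep_def\<close>)
    then have "vs2.dim (colim_inj ?s I ?J p ` UNIV) = vs1.dim UNIV"
      using p True
      by (intro dim_image_inj_on[OF linear_on_linear[OF linear_colim_inj[OF s]] vs1.subspace_UNIV])
        (auto simp: spread_rep_def)
    ultimately show ?thesis using True dim_field[where 'k='k] by (simp add: generalized_rank_def)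
  next
    case False
    then obtain p where p: "p \<in> I" "p \<notin> J" by blast
    have "lim_to_colim ?s I ?J f = 0" if f: "f \<in> lim_space I ?J" for f
    proof -
      have "f p = 0" using f p by (auto simp: lim_space_def spread_rep_def)
      then show ?thesis using lim_to_colim_eq[OF s con f p(1)] linear_0[OF linear_colim_inj[OF s]] by simp
    qed
    moreover have "(\<lambda>_. 0) \<in> lim_space I ?J" by (auto simp: lim_space_def spread_rep_def)
    ultimately have "lim_to_colim ?s I ?J ` lim_space I ?J = (\<lambda>_. 0) ` lim_space I ?J" "lim_space I ?J \<noteq> {}"
      by (simp_all cong: image_cong) blast
    then have "lim_to_colim ?s I ?J ` lim_space I ?J = {0}" by (simp add: image_constant_conv)
    then show ?thesis using False vs2.dim_zero_space by (simp add: generalized_rank_def)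
  qed
qed

lemma N_gen_pers_diag_euler:
  fixes s :: "'k::field \<Rightarrow> 'v::ab_group_add \<Rightarrow> 'v"
  assumes "vector_space s" "is_rep s (grid a b) M"
  shows "N_gen_pers_diag s (grid a b) M = grid_euler (grid a b) (\<lambda>p q. int (map_rank s M p q))"
  unfolding N_gen_pers_diag_def
  by (rule zeta_count)
    (simp_all add: generalized_rank_segment[OF assms finite_grid] generalized_rank_spread[OF finite_grid])

section \<open>Compressed multiplicities\<close>

abbreviation summand_iso ::
    "('k::field \<Rightarrow> 'v::ab_group_add \<Rightarrow> 'v) \<Rightarrow> 'p::order set \<Rightarrow> ('p, 'v) poset_rep \<Rightarrow> nat \<Rightarrow>
     ('p, 'k) poset_rep \<Rightarrow> ('p, 'v) poset_rep \<Rightarrow> bool" where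
  "summand_iso s Q M n N M' \<equiv>
     rep_iso s (scale_prod (scale_fun (*)) s) Q M (rep_plus (rep_sum n (\<lambda>_. N)) M')"

text \<open>On \<open>Q\<close> every copy of the spread representation is constant, so
  \<open>n\<close> copies contribute an \<open>n\<close>-dimensional subspace to the image.\<close>

lemma summand_bound:
  fixes s :: "'k::field \<Rightarrow> 'v::ab_group_add \<Rightarrow> 'v" and I :: "'p::order set"
  assumes s: "vector_space s" and M: "is_rep s Q M" and M': "is_rep s Q M'"
    and iso: "summand_iso s Q M n (spread_rep I) M'"
    and pq: "p \<in> Q" "q \<in> Q" "p \<le> q" and I: "Q \<subseteq> I"
  shows "n \<le> map_rank s M p q"
proof -
  let ?f = "scale_fun ((*) :: 'k \<Rightarrow> 'k \<Rightarrow> 'k)"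
  let ?t = "scale_prod ?f s"
  let ?N = "rep_plus (rep_sum n (\<lambda>_. spread_rep I)) M'"
  have f: "vector_space ?f" by (intro vector_space_scale_fun vector_space_field)
  have t: "vector_space ?t" by (rule vector_space_scale_prod[OF f s])
  interpret vector_space_pair ?f ?t using f t by (simp add: vector_space_pair_def)
  interpret S: vector_space_pair s s using s by (simp add: vector_space_pair_def)
  define X where "X = {g :: nat \<Rightarrow> 'k. \<forall>i. i \<notin> {..<n} \<longrightarrow> g i = 0}"
  have dimX: "vs1.dim X = n" unfolding X_def using fin_dim_funs(2)[of "{..<n}"] by simp
  have subX: "vs1.subspace X" unfolding X_def by (rule subspace_funs)
  have 0: "0 \<in> vs_at M' p" "map_at M' p q 0 = 0"
    using S.vs1.subspace_0[OF S.vs1.fin_dim_subspace[OF is_repD(1)[OF M' pq(1)]]]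
      S.linear_on_zero[OF is_repD(3)[OF M' pq] S.vs1.fin_dim_subspace[OF is_repD(1)[OF M' pq(1)]]] by auto
  have lin: "linear_on ?f ?t X (\<lambda>g. (g, 0))"
    by (auto simp: linear_on_def scale_prod_def)
  have "(\<lambda>g. (g, 0)) ` X \<subseteq> map_at ?N p q ` vs_at ?N p"
  proof clarify
    fix g assume g: "g \<in> X"
    have "(g, 0) \<in> vs_at ?N p" using g I pq 0 by (auto simp: X_def rep_plus_def rep_sum_def spread_rep_def)
    moreover have "map_at ?N p q (g, 0) = (g, 0)"
      using g I pq 0 by (auto simp: X_def rep_plus_def rep_sum_def spread_rep_def fun_eq_iff)
    ultimately show "(g, 0) \<in> map_at ?N p q ` vs_at ?N p" by (metis imageI)
  qed
  then have "vs2.dim ((\<lambda>g. (g, 0)) ` X) \<le> map_rank ?t ?N p q"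
    unfolding map_rank_def by (rule vs2.fin_dim_dim_mono[OF map_rank_iso(2)[OF s t M iso pq]])
  moreover have "vs2.dim ((\<lambda>g. (g, 0)) ` X) = vs1.dim X"
    by (rule dim_image_inj_on[OF lin subX]) (auto simp: inj_on_def)
  ultimately show ?thesis using dimX map_rank_iso(1)[OF s t M iso pq] by simp
qed

lemma summand_multiplicity_eq:
  fixes s :: "'k::field \<Rightarrow> 'v::ab_group_add \<Rightarrow> 'v"
  assumes "is_rep s Q M'" "summand_iso s Q M n N M'"
    and "\<And>m M'. is_rep s Q M' \<Longrightarrow> summand_iso s Q M m N M' \<Longrightarrow> m \<le> n"
  shows "summand_multiplicity (*) s Q N M = n"
  unfolding summand_multiplicity_def
  by (rule Greatest_equality) (use assms in blast)+

text \<open>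
  Copies of \<open>k\<^sub>I\<close> are split off by functionals dual to a basis of the image of \<open>M\<^sub>p \<rightarrow> M\<^sub>q\<close>.
\<close>

lemma summand_multiplicity_segment:
  fixes s :: "'k::field \<Rightarrow> 'v::ab_group_add \<Rightarrow> 'v" and I :: "'p::order set"
  assumes s: "vector_space s" and M: "is_rep s Q M" and QI: "Q \<subseteq> I"
    and pq: "p \<in> Q" "q \<in> Q" and bd: "\<And>z. z \<in> Q \<Longrightarrow> p \<le> z \<and> z \<le> q"
  shows "summand_multiplicity (*) s Q (spread_rep I) M = map_rank s M p q"
proof -
  interpret vector_space_pair s "(*) :: 'k \<Rightarrow> 'k \<Rightarrow> 'k"
    using s vector_space_field by (simp add: vector_space_pair_def)
  interpret S: vector_space_pair s s using s by (simp add: vector_space_pair_def)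
  let ?f = "scale_fun ((*) :: 'k \<Rightarrow> 'k \<Rightarrow> 'k)"
  let ?t = "scale_prod ?f s"
  have f: "vector_space ?f" by (intro vector_space_scale_fun vector_space_field)
  have t: "vector_space ?t" by (rule vector_space_scale_prod[OF f s])
  interpret T: vector_space_pair s ?t using s t by (simp add: vector_space_pair_def)
  note sub = vs1.fin_dim_subspace[OF is_repD(1)[OF M]]
  have le: "p \<le> q" using bd pq by blast
  have inV: "map_at M x y v \<in> vs_at M y" if "x \<in> Q" "y \<in> Q" "x \<le> y" "v \<in> vs_at M x" for x y v
    using is_repD(2)[OF M that(1-3)] that(4) by auto
  note comp = is_repD(5)[OF M] and lin = is_repD(3)[OF M]
  define n where "n = map_rank s M p q"
  obtain E where E: "finite E" "vs1.independent E" "vs1.span E = map_at M p q ` vs_at M p"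
    by (rule vs1.fin_dim_basis[OF S.fin_dim_image[OF lin[OF pq le] is_repD(1)[OF M pq(1)]]])
  have "card E = n" unfolding n_def map_rank_def E(3)[symmetric]
    using vs1.dim_span_eq_card_independent[OF E(2)] by simp
  then obtain e where e: "bij_betw e {0..<n} E" using ex_bij_betw_nat_finite[OF E(1)] by auto
  have eE: "e i \<in> E" if "i < n" for i using e that by (auto simp: bij_betw_def)
  have e_inj: "e i = e j \<longleftrightarrow> i = j" if "i < n" "j < n" for i j
    using e that by (auto simp: bij_betw_def inj_on_def)
  have "\<exists>v\<in>vs_at M p. map_at M p q v = e i" if "i < n" for i
    using eE[OF that] vs1.span_base[of "e i" E] E(3) by force
  then obtain v where v: "\<And>i. i < n \<Longrightarrow> v i \<in> vs_at M p" "\<And>i. i < n \<Longrightarrow> map_at M p q (v i) = e i" by metis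
  have "\<exists>g. Vector_Spaces.linear s (*) g \<and> (\<forall>x\<in>E. g x = of_bool (x = e i))" for i
    by (rule linear_independent_extend[OF E(2)])
  then obtain l where l: "\<And>i. Vector_Spaces.linear s (*) (l i)" "\<And>i x. x \<in> E \<Longrightarrow> l i x = of_bool (x = e i)"
    by metis
  \<comment> \<open>\<open>L z\<close> takes coordinates of the image at \<open>q\<close>, and
    \<open>w z\<close> spreads the lifts \<open>v i\<close> from \<open>p\<close> to
    \<open>z\<close>. Since \<open>L z\<close> after \<open>w z\<close> is the identity on the first
    \<open>n\<close> coordinates, the space at \<open>z\<close> splits into the image of
    \<open>w z\<close> and the kernel of \<open>L z\<close>; both parts are compatible with the
    structure maps.\<close>
  define L where "L z i u = (if i < n then l i (map_at M z q u) else 0)" for z i u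
  define w where "w z c = (\<Sum>i<n. s (c i) (map_at M p z (v i)))" for z c
  have lq: "z \<le> q" and pz: "p \<le> z" if "z \<in> Q" for z using bd that by auto
  have Llin: "linear_on s (*) (vs_at M z) (L z i)" if z: "z \<in> Q" for z i
  proof -
    have "linear_on s (*) (vs_at M z) (\<lambda>u. l i (map_at M z q u))"
      by (rule linear_on_compose[OF lin[OF z pq(2) lq[OF z]] is_repD(2)[OF M z pq(2) lq[OF z]] linear_on_linear[OF l(1)]])
    then show ?thesis by (simp add: linear_on_def L_def)
  qed
  have Lnat: "L y i (map_at M x y u) = L x i u" if "x \<in> Q" "y \<in> Q" "x \<le> y" "u \<in> vs_at M x" for x y i u
    using comp[OF that(1,2) pq(2) that(3) lq[OF that(2)] that(4)] by (simp add: L_def)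
  have pv: "map_at M p z (v i) \<in> vs_at M z" if "i < n" "z \<in> Q" for i z
    using inV[OF pq(1) that(2) pz[OF that(2)] v(1)[OF that(1)]] .
  have wV: "w z c \<in> vs_at M z" if z: "z \<in> Q" for z c
    unfolding w_def using pv z by (intro vs1.subspace_sum sub vs1.subspace_scale) auto
  have wnat: "map_at M x y (w x c) = w y c" if xy: "x \<in> Q" "y \<in> Q" "x \<le> y" for x y c
  proof -
    have "map_at M x y (w x c) = (\<Sum>i<n. map_at M x y (s (c i) (map_at M p x (v i))))"
      unfolding w_def using pv xy
      by (intro S.linear_on_sum[OF lin[OF xy] sub[OF xy(1)]] vs1.subspace_scale sub) auto
    also have "\<dots> = w y c"
      unfolding w_def using S.linear_on_scale[OF lin[OF xy] pv[OF _ xy(1)]] comp[OF pq(1) xy(1,2) pz[OF xy(1)] xy(3) v(1)]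
      by (intro sum.cong) auto
    finally show ?thesis .
  qed
  have Lw: "L z j (w z c) = c j" if z: "z \<in> Q" and j: "j < n" for z j c
  proof -
    have "map_at M z q (w z c) = (\<Sum>i<n. s (c i) (e i))"
      unfolding wnat[OF z pq(2) lq[OF z]] by (simp add: w_def v(2))
    then have "L z j (w z c) = (\<Sum>i<n. c i * l j (e i))"
      using j by (simp add: L_def linear_sum[OF l(1)] linear_scale[OF l(1)])
    also have "\<dots> = (\<Sum>i<n. if i = j then c j else 0)"
      using eE l(2) e_inj j by (intro sum.cong) auto
    finally show ?thesis using j by simp
  qed
  define M' where "M' = \<lparr>vs_at = (\<lambda>z. {u \<in> vs_at M z. \<forall>i<n. L z i u = 0}), map_at = map_at M\<rparr>"
  have M'M: "vs_at M' z \<subseteq> vs_at M z" for z by (auto simp: M'_def)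
  have sub': "vs1.subspace (vs_at M' z)" if z: "z \<in> Q" for z
  proof (rule vs1.subspaceI)
    show "0 \<in> vs_at M' z"
      using vs1.subspace_0[OF sub[OF z]] linear_on_zero[OF Llin[OF z] sub[OF z]] by (simp add: M'_def)
    show "x + y \<in> vs_at M' z" if "x \<in> vs_at M' z" "y \<in> vs_at M' z" for x y
      using that vs1.subspace_add[OF sub[OF z]] linear_on_add[OF Llin[OF z]] by (simp add: M'_def)
    show "s c x \<in> vs_at M' z" if "x \<in> vs_at M' z" for c x
      using that vs1.subspace_scale[OF sub[OF z]] linear_on_scale[OF Llin[OF z]] by (simp add: M'_def)
  qed
  have M': "is_rep s Q M'"
  proof (rule is_repI)
    show "fin_dim s (vs_at M' z)" if "z \<in> Q" for z
      by (rule vs1.fin_dim_subset[OF is_repD(1)[OF M that] sub'[OF that] M'M])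
    show "map_at M' x y u \<in> vs_at M' y" if xy: "x \<in> Q" "y \<in> Q" "x \<le> y" and u: "u \<in> vs_at M' x" for x y u
      using u inV[OF xy] Lnat[OF xy] by (simp add: M'_def)
    show "linear_on s s (vs_at M' x) (map_at M' x y)" if "x \<in> Q" "y \<in> Q" "x \<le> y" for x y
      using linear_on_subset[OF lin[OF that] M'M] by (simp add: M'_def)
    show "map_at M' x x u = u" if "x \<in> Q" "u \<in> vs_at M' x" for x u
      using is_repD(4)[OF M that(1)] that(2) by (simp add: M'_def)
    show "map_at M' y z (map_at M' x y u) = map_at M' x z u"
      if "x \<in> Q" "y \<in> Q" "z \<in> Q" "x \<le> y" "y \<le> z" "u \<in> vs_at M' x" for x y z u
      using comp[OF that(1-5)] that(6) by (simp add: M'_def)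
  qed
  let ?N = "rep_plus (rep_sum n (\<lambda>_. spread_rep I)) M' :: ('p, (nat \<Rightarrow> 'k) \<times> 'v) poset_rep"
  have N_vs: "vs_at ?N z = {g. \<forall>i\<ge>n. g i = 0} \<times> vs_at M' z" if "z \<in> Q" for z
    using that QI by (auto simp: rep_plus_def rep_sum_def spread_rep_def)
  \<comment> \<open>Coordinates together with the remainder in the kernel of \<open>L z\<close>;
    outside its domain the morphism is 0, as \<open>rep_hom\<close> demands.\<close>
  define \<phi> where "\<phi> z u = (if z \<in> Q \<and> u \<in> vs_at M z then (\<lambda>i. L z i u, u - w z (\<lambda>i. L z i u)) else 0)" for z u
  have wadd: "w z (\<lambda>i. c i + d i) = w z c + w z d" and wscale: "w z (\<lambda>i. a * c i) = s a (w z c)" for z c d a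
    by (simp_all add: w_def vs1.scale_left_distrib sum.distrib vs1.scale_sum_right)
  have \<phi>lin: "linear_on s ?t (vs_at M z) (\<phi> z)" if z: "z \<in> Q" for z
    unfolding linear_on_def
  proof (intro conjI ballI allI)
    fix x y assume "x \<in> vs_at M z" "y \<in> vs_at M z"
    then show "\<phi> z (x + y) = \<phi> z x + \<phi> z y"
      using z vs1.subspace_add[OF sub[OF z]] linear_on_add[OF Llin[OF z]]
      by (simp add: \<phi>_def wadd plus_fun_def)
  next
    fix c x assume "x \<in> vs_at M z"
    then show "\<phi> z (s c x) = ?t c (\<phi> z x)"
      using z vs1.subspace_scale[OF sub[OF z]] linear_on_scale[OF Llin[OF z]]
      by (simp add: \<phi>_def wscale scale_prod_def scale_fun_def vs1.scale_right_diff_distrib)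
  qed
  have \<phi>in: "\<phi> z u \<in> vs_at ?N z" if z: "z \<in> Q" and u: "u \<in> vs_at M z" for z u
  proof -
    have "u - w z (\<lambda>i. L z i u) \<in> vs_at M z" using vs1.subspace_diff[OF sub[OF z] u wV[OF z]] .
    moreover have "L z j (u - w z (\<lambda>i. L z i u)) = 0" if "j < n" for j
      using linear_on_diff[OF Llin[OF z] sub[OF z] u wV[OF z]] Lw[OF z that] by simp
    ultimately show ?thesis using z u unfolding N_vs[OF z] by (simp add: \<phi>_def M'_def L_def)
  qed
  have hom: "\<phi> \<in> rep_hom s ?t Q M ?N"
    unfolding rep_hom_def
  proof (intro CollectI conjI ballI allI impI \<phi>lin)
    show "\<phi> z ` vs_at M z \<subseteq> vs_at ?N z" if "z \<in> Q" for z using \<phi>in[OF that] by auto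
    show "\<phi> y (map_at M x y u) = map_at ?N x y (\<phi> x u)" if xy: "x \<in> Q" "y \<in> Q" "x \<le> y" and u: "u \<in> vs_at M x" for x y u
    proof -
      have "map_at M x y (u - w x (\<lambda>i. L x i u)) = map_at M x y u - w y (\<lambda>i. L x i u)"
        using S.linear_on_diff[OF lin[OF xy] sub[OF xy(1)] u wV[OF xy(1)]] wnat[OF xy] by simp
      then have "map_at ?N x y (\<phi> x u) = (\<lambda>i. L x i u, map_at M x y u - w y (\<lambda>i. L x i u))"
        using u xy QI by (auto simp: \<phi>_def rep_plus_def rep_sum_def spread_rep_def M'_def L_def fun_eq_iff)
      then show ?thesis using inV[OF xy u] xy Lnat[OF xy u] by (simp add: \<phi>_def)
    qed
    show "\<phi> x u = 0" if "x \<notin> Q \<or> u \<notin> vs_at M x" for x u using that by (auto simp: \<phi>_def)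
  qed
  have bij: "bij_betw (\<phi> z) (vs_at M z) (vs_at ?N z)" if z: "z \<in> Q" for z
    unfolding bij_betw_def
  proof
    have "u = 0" if u: "u \<in> vs_at M z" "\<phi> z u = 0" for u
    proof -
      have "\<phi> z u = (\<lambda>i. L z i u, u - w z (\<lambda>i. L z i u))" using u(1) z by (simp add: \<phi>_def)
      then have pair: "(\<lambda>i. L z i u, u - w z (\<lambda>i. L z i u)) = (\<lambda>i. 0, 0)"
        using u(2) by (simp only: zero_prod_def zero_fun_def)
      have 1: "(\<lambda>i. L z i u) = (\<lambda>i. 0)" and 2: "u - w z (\<lambda>i. L z i u) = 0"
        using arg_cong[OF pair, of fst] arg_cong[OF pair, of snd] by (simp_all only: fst_conv snd_conv)
      have "u - w z (\<lambda>i. 0) = 0" using 2 unfolding 1 .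
      then show ?thesis by (simp add: w_def)
    qed
    then show "inj_on (\<phi> z) (vs_at M z)"
      by (subst T.linear_on_inj_iff[OF \<phi>lin[OF z] sub[OF z]]) auto
    show "\<phi> z ` vs_at M z = vs_at ?N z"
    proof
      show "\<phi> z ` vs_at M z \<subseteq> vs_at ?N z" using \<phi>in[OF z] by auto
      show "vs_at ?N z \<subseteq> \<phi> z ` vs_at M z"
      proof
        fix x assume "x \<in> vs_at ?N z"
        then obtain g u where x: "x = (g, u)" "\<And>i. i \<ge> n \<Longrightarrow> g i = 0" "u \<in> vs_at M' z"
          unfolding N_vs[OF z] by auto
        have uM: "u \<in> vs_at M z" using x(3) M'M by auto
        have y: "u + w z g \<in> vs_at M z" using vs1.subspace_add[OF sub[OF z] uM wV[OF z]] .
        have "L z i (u + w z g) = g i" for i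
        proof (cases "i < n")
          case True
          then show ?thesis using linear_on_add[OF Llin[OF z] uM wV[OF z]] Lw[OF z True] x(3) by (simp add: M'_def)
        qed (simp add: L_def x(2))
        then have "\<phi> z (u + w z g) = x" using y z x(1) by (simp add: \<phi>_def)
        then show "x \<in> \<phi> z ` vs_at M z" using y by blast
      qed
    qed
  qed
  have "summand_iso s Q M n (spread_rep I) M'"
    unfolding rep_iso_def using hom bij by blast
  moreover have "m \<le> n" if "is_rep s Q M''" "summand_iso s Q M m (spread_rep I) M''" for m M''
    unfolding n_def by (rule summand_bound[OF s M that pq le QI])
  ultimately show ?thesis using summand_multiplicity_eq[OF M'] n_def by blast
qed

text \<open>The rank at a single point bounds the multiplicity by 1, and by 0 if the point lies
  outside \<open>J\<close>. The bound is attained with zero complement in the first case and with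
  the empty sum in the second.\<close>

lemma summand_multiplicity_spread:
  fixes I J :: "'p::order set"
  assumes Q: "Q \<subseteq> I" "Q \<noteq> {}" and J: "poset_convex Q J"
  shows "summand_multiplicity (*) ((*) :: 'k::field \<Rightarrow> 'k \<Rightarrow> 'k) Q (spread_rep I) (spread_rep J) = of_bool (Q \<subseteq> J)"
proof -
  let ?s = "(*) :: 'k \<Rightarrow> 'k \<Rightarrow> 'k" and ?M = "spread_rep J :: ('p, 'k) poset_rep"
  have s: "vector_space ?s" by (rule vector_space_field)
  have M: "is_rep ?s Q ?M" by (rule spread_is_rep[OF J])
  note bound = summand_bound[OF s M]
  show ?thesis
  proof (cases "Q \<subseteq> J")
    case True
    obtain p where p: "p \<in> Q" using Q by blast
    let ?M' = "\<lparr>vs_at = (\<lambda>_. {0}), map_at = (\<lambda>_ _ _. 0)\<rparr> :: ('p, 'k) poset_rep"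
    have M': "is_rep ?s Q ?M'"
      by (rule is_repI) (use vector_space.fin_dim_zero[OF s] in \<open>auto simp: linear_on_def\<close>)
    let ?N = "rep_plus (rep_sum 1 (\<lambda>_. spread_rep I)) ?M' :: ('p, (nat \<Rightarrow> 'k) \<times> 'k) poset_rep"
    define \<phi> :: "'p \<Rightarrow> 'k \<Rightarrow> (nat \<Rightarrow> 'k) \<times> 'k"
      where "\<phi> z c = (if z \<in> Q then (\<lambda>i. if i = 0 then c else 0, 0) else 0)" for z c
    have "\<phi> \<in> rep_hom ?s (scale_prod (scale_fun ?s) ?s) Q ?M ?N"
      using True Q unfolding rep_hom_def
      by (auto simp: \<phi>_def linear_on_def rep_plus_def rep_sum_def spread_rep_def scale_prod_def scale_fun_def fun_eq_iff)
    moreover have "bij_betw (\<phi> z) (vs_at ?M z) (vs_at ?N z)" if z: "z \<in> Q" for z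
    proof (rule bij_betw_byWitness[where f'="\<lambda>x. fst x 0"])
      show "\<forall>x\<in>vs_at ?N z. \<phi> z (fst x 0) = x"
        using z True Q by (auto simp: \<phi>_def rep_plus_def rep_sum_def spread_rep_def fun_eq_iff)
      show "\<phi> z ` vs_at ?M z \<subseteq> vs_at ?N z"
        using z True Q by (auto simp: \<phi>_def rep_plus_def rep_sum_def spread_rep_def)
    qed (use z True in \<open>auto simp: \<phi>_def spread_rep_def\<close>)
    ultimately have "summand_iso ?s Q ?M 1 (spread_rep I) ?M'" unfolding rep_iso_def by blast
    moreover have "m \<le> 1" if "is_rep ?s Q M''" "summand_iso ?s Q ?M m (spread_rep I) M''" for m M''
      using bound[OF that p p order_refl Q(1)] p True by (auto simp: map_rank_spread)
    ultimately show ?thesis using summand_multiplicity_eq[OF M'] True by simp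
  next
    case False
    then obtain p where p: "p \<in> Q" "p \<notin> J" by blast
    let ?N = "rep_plus (rep_sum 0 (\<lambda>_. spread_rep I)) ?M :: ('p, (nat \<Rightarrow> 'k) \<times> 'k) poset_rep"
    define \<phi> :: "'p \<Rightarrow> 'k \<Rightarrow> (nat \<Rightarrow> 'k) \<times> 'k"
      where "\<phi> z c = (if z \<in> Q \<and> c \<in> vs_at ?M z then (0, c) else 0)" for z c
    have "\<phi> \<in> rep_hom ?s (scale_prod (scale_fun ?s) ?s) Q ?M ?N"
      unfolding rep_hom_def
      by (auto simp: \<phi>_def linear_on_def rep_plus_def rep_sum_def spread_rep_def scale_prod_def scale_fun_def fun_eq_iff)
    moreover have "bij_betw (\<phi> z) (vs_at ?M z) (vs_at ?N z)" if z: "z \<in> Q" for z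
      by (rule bij_betw_byWitness[where f'=snd])
        (use z in \<open>auto simp: \<phi>_def rep_plus_def rep_sum_def spread_rep_def fun_eq_iff\<close>)
    ultimately have "summand_iso ?s Q ?M 0 (spread_rep I) ?M" unfolding rep_iso_def by blast
    moreover have "m \<le> 0" if "is_rep ?s Q M''" "summand_iso ?s Q ?M m (spread_rep I) M''" for m M''
      using bound[OF that p(1) p(1) order_refl Q(1)] p by (auto simp: map_rank_spread)
    ultimately show ?thesis using summand_multiplicity_eq[OF M] False by simp
  qed
qed

section \<open>Compressions and the extremal points they keep\<close>

lemma extremal_subset: "extremal_points I \<subseteq> I"
  by (auto simp: extremal_points_def)

lemma compress_bounds: "extremal_points I \<subseteq> compress star I" "compress star I \<subseteq> I"
  using extremal_subset[of I] by (cases star; force)+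

lemma extremal_segment:
  assumes "p \<in> P" "q \<in> P" "p \<le> q"
  shows "p \<in> extremal_points (segment P p q)" "q \<in> extremal_points (segment P p q)"
  using assms by (auto simp: extremal_points_def segment_def)

text \<open>In a finite spread every point lies between a minimal and a maximal element. All
  compressions keep these, and convexity of \<open>J\<close> fills in the points between
  them.\<close>

lemma compress_subset_iff:
  assumes P: "finite P" and I: "I \<in> spreads P" and J: "J \<in> spreads P"
  shows "compress star I \<subseteq> J \<longleftrightarrow> I \<subseteq> J"
proof
  assume sub: "compress star I \<subseteq> J"
  show "I \<subseteq> J"
  proof
    fix x assume x: "x \<in> I"
    have fin: "finite I" by (rule spreads_finite[OF P I])
    obtain l where l: "l \<in> I" "l \<le> x" "\<forall>b\<in>I. b \<le> l \<longrightarrow> l = b"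
      using finite_has_minimal2[OF fin x] by blast
    obtain u where u: "u \<in> I" "x \<le> u" "\<forall>b\<in>I. u \<le> b \<longrightarrow> u = b"
      using finite_has_maximal2[OF fin x] by blast
    have "l \<in> extremal_points I" "u \<in> extremal_points I"
      using l u unfolding extremal_points_def by (auto simp: less_le)
    then have "l \<in> J" "u \<in> J" using compress_bounds(1)[of I star] sub by auto
    moreover have "x \<in> P" using x I by (auto simp: spreads_def)
    ultimately show "x \<in> J" using J l(2) u(2) unfolding spreads_def poset_convex_def by blast
  qed
qed (use compress_bounds(2) in blast)

text \<open>All three compressions of a segment keep its two ends as least and greatest element, so
  its compressed multiplicity is a rank.\<close>

lemma N_int_dec_repl_euler:
  fixes s :: "'k::field \<Rightarrow> 'v::ab_group_add \<Rightarrow> 'v"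
  assumes s: "vector_space s" and M: "is_rep s (grid a b) M"
  shows "N_int_dec_repl s star (grid a b) M = grid_euler (grid a b) (\<lambda>p q. int (map_rank s M p q))"
  unfolding N_int_dec_repl_def
proof (rule zeta_count)
  let ?P = "grid a b"
  fix I J assume I: "I \<in> spreads ?P" and J: "J \<in> spreads ?P"
  have IP: "I \<subseteq> ?P" "I \<noteq> {}" using I by (auto simp: spreads_def)
  have "compress star I \<noteq> {}"
  proof
    assume "compress star I = {}"
    then have "extremal_points I = {}" using compress_bounds(1)[of I star] by auto
    moreover obtain l where "l \<in> I" "\<forall>b\<in>I. b \<le> l \<longrightarrow> l = b"
      using finite_has_minimal[OF spreads_finite[OF finite_grid I] IP(2)] by blast
    ultimately show False unfolding extremal_points_def by (auto simp: less_le)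
  qed
  moreover have "poset_convex (compress star I) J"
    using J compress_bounds(2)[of star I] IP(1) unfolding spreads_def poset_convex_def by blast
  ultimately show "int (summand_multiplicity ((*) :: 'k \<Rightarrow> 'k \<Rightarrow> 'k) ((*) :: 'k \<Rightarrow> 'k \<Rightarrow> 'k)
      (compress star I) (spread_rep I) (spread_rep J)) = of_bool (I \<subseteq> J)"
    using summand_multiplicity_spread[where 'k='k, OF compress_bounds(2)] compress_subset_iff[OF finite_grid I J] by simp
next
  let ?P = "grid a b"
  fix p q assume pq: "p \<in> ?P" "q \<in> ?P" "p \<le> q"
  let ?I = "segment ?P p q"
  have "?I \<subseteq> ?P" by (auto simp: segment_def)
  then have "is_rep s (compress star ?I) M"
    using compress_bounds(2)[of star ?I] by (intro is_rep_subset[OF M]) auto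
  moreover have "p \<in> compress star ?I" "q \<in> compress star ?I"
    using extremal_segment[OF pq] compress_bounds(1)[of ?I star] by auto
  moreover have "p \<le> z \<and> z \<le> q" if "z \<in> compress star ?I" for z
    using that compress_bounds(2)[of star ?I] by (auto simp: segment_def)
  ultimately show "int (summand_multiplicity (*) s (compress star ?I) (spread_rep ?I) M) = int (map_rank s M p q)"
    using summand_multiplicity_segment[OF s _ compress_bounds(2)] by simp
qed

section \<open>Morphisms out of hooks\<close>

lemma rep_homD:
  assumes "\<phi> \<in> rep_hom s t P M N"
  shows "p \<in> P \<Longrightarrow> v \<in> vs_at M p \<Longrightarrow> \<phi> p v \<in> vs_at N p"
    and "p \<in> P \<Longrightarrow> linear_on s t (vs_at M p) (\<phi> p)"
    and "p \<in> P \<Longrightarrow> q \<in> P \<Longrightarrow> p \<le> q \<Longrightarrow> v \<in> vs_at M p \<Longrightarrow> \<phi> q (map_at M p q v) = map_at N p q (\<phi> p v)"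
    and "p \<notin> P \<or> v \<notin> vs_at M p \<Longrightarrow> \<phi> p v = 0"
  using assms by (auto simp: rep_hom_def image_subset_iff)

lemma rep_hom_subspace:
  fixes t :: "'k::field \<Rightarrow> 'w::ab_group_add \<Rightarrow> 'w"
  assumes t: "vector_space t" and N: "is_rep t P N"
  shows "module.subspace (\<lambda>c \<phi> p v. t c (\<phi> p v)) (rep_hom s t P M N)"
proof -
  interpret t: vector_space_pair t t using t by (simp add: vector_space_pair_def)
  interpret H: vector_space "\<lambda>c \<phi> p v. t c (\<phi> p v)" by (rule vector_space_scale_fun2[OF t])
  note sub = t.vs1.fin_dim_subspace[OF is_repD(1)[OF N]]
  note lin = is_repD(3)[OF N]
  show ?thesis
  proof (rule H.subspaceI)
    show "0 \<in> rep_hom s t P M N"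
      unfolding rep_hom_def
      using t.vs1.subspace_0[OF sub] t.linear_on_zero[OF lin sub] by (auto simp: linear_on_def)
  next
    fix \<phi> \<psi> assume \<phi>: "\<phi> \<in> rep_hom s t P M N" and \<psi>: "\<psi> \<in> rep_hom s t P M N"
    show "\<phi> + \<psi> \<in> rep_hom s t P M N"
      unfolding rep_hom_def
    proof (intro CollectI conjI ballI allI impI)
      show "(\<phi> + \<psi>) p ` vs_at M p \<subseteq> vs_at N p" if "p \<in> P" for p
        using rep_homD(1)[OF \<phi> that] rep_homD(1)[OF \<psi> that] t.vs1.subspace_add[OF sub[OF that]] by auto
      show "linear_on s t (vs_at M p) ((\<phi> + \<psi>) p)" if "p \<in> P" for p
        using rep_homD(2)[OF \<phi> that] rep_homD(2)[OF \<psi> that]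
        by (simp add: linear_on_def t.vs1.scale_right_distrib)
      show "(\<phi> + \<psi>) q (map_at M p q v) = map_at N p q ((\<phi> + \<psi>) p v)"
        if "p \<in> P" "q \<in> P" "p \<le> q" "v \<in> vs_at M p" for p q v
        using rep_homD(3)[OF \<phi> that] rep_homD(3)[OF \<psi> that]
          t.linear_on_add[OF lin[OF that(1-3)] rep_homD(1)[OF \<phi> that(1,4)] rep_homD(1)[OF \<psi> that(1,4)]] by simp
      show "(\<phi> + \<psi>) p v = 0" if "p \<notin> P \<or> v \<notin> vs_at M p" for p v
        using rep_homD(4)[OF \<phi> that] rep_homD(4)[OF \<psi> that] by simp
    qed
  next
    fix c \<phi> assume \<phi>: "\<phi> \<in> rep_hom s t P M N"
    show "(\<lambda>p v. t c (\<phi> p v)) \<in> rep_hom s t P M N"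
      unfolding rep_hom_def
    proof (intro CollectI conjI ballI allI impI)
      show "(\<lambda>v. t c (\<phi> p v)) ` vs_at M p \<subseteq> vs_at N p" if "p \<in> P" for p
        using rep_homD(1)[OF \<phi> that] t.vs1.subspace_scale[OF sub[OF that]] by auto
      show "linear_on s t (vs_at M p) (\<lambda>v. t c (\<phi> p v))" if "p \<in> P" for p
        using rep_homD(2)[OF \<phi> that]
        by (simp add: linear_on_def t.vs1.scale_right_distrib mult.commute)
      show "t c (\<phi> q (map_at M p q v)) = map_at N p q (t c (\<phi> p v))"
        if "p \<in> P" "q \<in> P" "p \<le> q" "v \<in> vs_at M p" for p q v
        using rep_homD(3)[OF \<phi> that] t.linear_on_scale[OF lin[OF that(1-3)] rep_homD(1)[OF \<phi> that(1,4)]] by simp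
      show "t c (\<phi> p v) = 0" if "p \<notin> P \<or> v \<notin> vs_at M p" for p v
        using rep_homD(4)[OF \<phi> that] by simp
    qed
  qed
qed

text \<open>Morphisms are parametrised by few data \<open>F\<close>: the value at one point for
  hooks, and one scalar for each possible image for spreads.\<close>

lemma hom_dim_eqI:
  fixes t :: "'k::field \<Rightarrow> 'w::ab_group_add \<Rightarrow> 'w" and u :: "'k \<Rightarrow> 'x::ab_group_add \<Rightarrow> 'x"
  assumes t: "vector_space t" and u: "vector_space u" and N: "is_rep t P N"
    and lin: "linear_on (\<lambda>c \<phi> p v. t c (\<phi> p v)) u (rep_hom s t P M N) F"
    and inj: "\<And>\<phi>. \<phi> \<in> rep_hom s t P M N \<Longrightarrow> F \<phi> = 0 \<Longrightarrow> \<phi> = 0"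
    and im: "F ` rep_hom s t P M N = X"
  shows "hom_dim s t P M N = vector_space.dim u X"
proof -
  interpret vector_space_pair "\<lambda>c \<phi> p v. t c (\<phi> p v)" u
    using vector_space_scale_fun2[OF t] u by (simp add: vector_space_pair_def)
  note sub = rep_hom_subspace[OF t N, of s M]
  have "inj_on F (rep_hom s t P M N)" using inj by (subst linear_on_inj_iff[OF lin sub]) auto
  then have "vs2.dim (F ` rep_hom s t P M N) = vs1.dim (rep_hom s t P M N)"
    by (intro dim_image_inj_on[OF lin sub]) auto
  then show ?thesis by (simp add: hom_dim_def im)
qed

lemma spread_hom_zero:
  assumes t: "vector_space t" and \<phi>: "\<phi> \<in> rep_hom ((*) :: 'k::field \<Rightarrow> 'k \<Rightarrow> 'k) t P (spread_rep I) N" and z: "z \<notin> I \<or> z \<notin> P \<or> c = 0"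
  shows "\<phi> z c = 0"
proof (cases "z \<in> P \<and> c \<in> vs_at (spread_rep I) z")
  case True
  interpret t: vector_space t by (rule t)
  have "c = 0" using True z by (auto simp: spread_rep_def split: if_splits)
  moreover have "\<phi> z (0 * c) = t 0 (\<phi> z c)"
    using rep_homD(2)[OF \<phi>, of z] True by (simp only: linear_on_def)
  ultimately show ?thesis by (simp add: t.scale_zero_left)
next
  case False
  then show ?thesis using rep_homD(4)[OF \<phi>] by blast
qed

lemma spread_hom_scale:
  assumes "\<phi> \<in> rep_hom ((*) :: 'k::field \<Rightarrow> 'k \<Rightarrow> 'k) t P (spread_rep I) N" "z \<in> I" "z \<in> P"
  shows "\<phi> z c = t c (\<phi> z 1)"
  using rep_homD(2)[OF assms(1,3)] assms(2) unfolding linear_on_def spread_rep_def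
  by (metis (mono_tags, lifting) UNIV_I mult.right_neutral poset_rep.select_convs(1))

text \<open>The source is the representation generated freely at \<open>x\<close> modulo its part on
  the up-closed set \<open>E\<close>. A morphism is therefore the image of the generator, which has
  to die on \<open>E\<close>. Both kinds of hooks have this form.\<close>

lemma hom_dim_cyclic:
  fixes t :: "'k::field \<Rightarrow> 'w::ab_group_add \<Rightarrow> 'w" and E :: "'p::order \<Rightarrow> bool"
  assumes t: "vector_space t" and N: "is_rep t P N" and x: "x \<in> P" "\<not> E x"
    and E: "\<And>z w. z \<in> P \<Longrightarrow> w \<in> P \<Longrightarrow> z \<le> w \<Longrightarrow> E z \<Longrightarrow> E w"
  shows "hom_dim ((*) :: 'k \<Rightarrow> 'k \<Rightarrow> 'k) t P (spread_rep {z \<in> P. x \<le> z \<and> \<not> E z}) N =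
    vector_space.dim t {v \<in> vs_at N x. \<forall>w\<in>P. x \<le> w \<longrightarrow> E w \<longrightarrow> map_at N x w v = 0}"
proof -
  interpret t: vector_space_pair t t using t by (simp add: vector_space_pair_def)
  let ?I = "{z \<in> P. x \<le> z \<and> \<not> E z}"
  let ?K = "{v \<in> vs_at N x. \<forall>w\<in>P. x \<le> w \<longrightarrow> E w \<longrightarrow> map_at N x w v = 0}"
  let ?hom = "rep_hom ((*) :: 'k \<Rightarrow> 'k \<Rightarrow> 'k) t P (spread_rep ?I) N"
  have xI: "x \<in> ?I" using x by simp
  note sub = t.vs1.fin_dim_subspace[OF is_repD(1)[OF N]]
  note lin = is_repD(3)[OF N]
  have N_in: "map_at N z w v \<in> vs_at N w" if "z \<in> P" "w \<in> P" "z \<le> w" "v \<in> vs_at N z" for z w v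
    using is_repD(2)[OF N that(1-3)] that(4) by auto
  have val: "\<phi> z c = map_at N x z (\<phi> x c)" if \<phi>: "\<phi> \<in> ?hom" and z: "z \<in> ?I" for \<phi> z c
    using rep_homD(3)[OF \<phi> x(1), of z c] z xI by (simp add: spread_rep_def)
  show ?thesis
  proof (rule hom_dim_eqI[OF t t N, where F="\<lambda>\<phi>. \<phi> x 1"])
    show "linear_on (\<lambda>c \<phi> p v. t c (\<phi> p v)) t ?hom (\<lambda>\<phi>. \<phi> x 1)" by (simp add: linear_on_def)
    fix \<phi> assume \<phi>: "\<phi> \<in> ?hom" "\<phi> x 1 = 0"
    have x0: "\<phi> x c = 0" for c using spread_hom_scale[OF \<phi>(1) xI x(1), of c] \<phi>(2) by simp
    have "\<phi> z c = 0" for z c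
    proof (cases "z \<in> ?I")
      case True
      then show ?thesis using val[OF \<phi>(1) True, of c] t.linear_on_zero[OF lin[OF x(1)] sub[OF x(1)]] by (simp add: x0)
    next
      case False
      then show ?thesis by (intro spread_hom_zero[OF t \<phi>(1)]) blast
    qed
    then show "\<phi> = 0" by (intro ext) simp
  next
    show "(\<lambda>\<phi>. \<phi> x 1) ` ?hom = ?K"
    proof
      show "(\<lambda>\<phi>. \<phi> x 1) ` ?hom \<subseteq> ?K"
      proof (rule image_subsetI)
        fix \<phi> assume \<phi>: "\<phi> \<in> ?hom"
        have "map_at N x w (\<phi> x 1) = 0" if w: "w \<in> P" "x \<le> w" "E w" for w
          using rep_homD(3)[OF \<phi> x(1) w(1,2), of 1] xI w spread_hom_zero[OF t \<phi>, of w 0] by (simp add: spread_rep_def)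
        moreover have "\<phi> x 1 \<in> vs_at N x" using rep_homD(1)[OF \<phi> x(1), of 1] xI by (simp add: spread_rep_def)
        ultimately show "\<phi> x 1 \<in> ?K" by blast
      qed
      show "?K \<subseteq> (\<lambda>\<phi>. \<phi> x 1) ` ?hom"
      proof
        fix v assume v: "v \<in> ?K"
        define \<phi> where "\<phi> z c = (if z \<in> ?I then t c (map_at N x z v) else 0)" for z c
        have zin: "map_at N x z v \<in> vs_at N z" if "z \<in> ?I" for z using N_in[OF x(1)] v that by auto
        have "\<phi> \<in> ?hom"
          unfolding rep_hom_def
        proof (intro CollectI conjI ballI allI impI)
          show "\<phi> z ` vs_at (spread_rep ?I) z \<subseteq> vs_at N z" if "z \<in> P" for z
            using zin t.vs1.subspace_scale[OF sub[OF that]] t.vs1.subspace_0[OF sub[OF that]] by (auto simp: \<phi>_def)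
          show "linear_on (*) t (vs_at (spread_rep ?I) z) (\<phi> z)" for z
            unfolding linear_on_def \<phi>_def by (auto simp: t.vs1.scale_left_distrib)
          show "\<phi> w (map_at (spread_rep ?I) z w c) = map_at N z w (\<phi> z c)"
            if zw: "z \<in> P" "w \<in> P" "z \<le> w" and c: "c \<in> vs_at (spread_rep ?I) z" for z w c
          proof (cases "z \<in> ?I")
            case True
            have eq: "map_at N z w (\<phi> z c) = t c (map_at N x w v)"
              using True t.linear_on_scale[OF lin[OF zw] zin[OF True]] is_repD(5)[OF N x(1) zw(1,2) _ zw(3), of v] v
              by (simp add: \<phi>_def)
            show ?thesis
            proof (cases "w \<in> ?I")
              case True
              then show ?thesis using eq \<open>z \<in> ?I\<close> by (simp add: \<phi>_def spread_rep_def)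
            next
              case False
              then have "x \<le> w" "E w" using True zw by (auto intro: order_trans)
              then have "map_at N x w v = 0" using v zw by simp
              then show ?thesis using eq False by (simp add: \<phi>_def)
            qed
          next
            case False
            then show ?thesis using t.linear_on_zero[OF lin[OF zw] sub[OF zw(1)]]
              by (auto simp: \<phi>_def spread_rep_def)
          qed
          show "\<phi> z c = 0" if "z \<notin> P \<or> c \<notin> vs_at (spread_rep ?I) z" for z c
            using that by (auto simp: \<phi>_def spread_rep_def)
        qed
        moreover have "\<phi> x 1 = v" using xI v is_repD(4)[OF N x(1), of v] by (simp add: \<phi>_def)
        ultimately show "v \<in> (\<lambda>\<phi>. \<phi> x 1) ` ?hom" by blast
      qed
    qed
  qed
qed

section \<open>Hooks, and ranks as differences of Hom dimensions\<close>

definition hook_inf :: "'p::order set \<Rightarrow> 'p \<Rightarrow> 'p set" where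
  "hook_inf P x = {z \<in> P. x \<le> z}"

definition hook :: "'p::order set \<Rightarrow> 'p \<Rightarrow> 'p \<Rightarrow> 'p set" where
  "hook P x y = {z \<in> P. x \<le> z \<and> \<not> y \<le> z}"

lemma hooks_eq: "hooks P = {hook P x y | x y. x \<in> P \<and> y \<in> P \<and> x < y} \<union> {hook_inf P x | x. x \<in> P}"
  by (simp add: hooks_def hook_def hook_inf_def)

text \<open>Rank-nullity: Hom from the infinite hook at \<open>p\<close> is the space at
  \<open>p\<close>, and Hom from the hook with ends \<open>p\<close> and \<open>q\<close> is the
  kernel of the map to \<open>q\<close>. For \<open>p = q\<close> there is no such hook, and the
  kernel is 0.\<close>

lemma map_rank_hom_dim:
  fixes t :: "'k::field \<Rightarrow> 'w::ab_group_add \<Rightarrow> 'w"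
  assumes t: "vector_space t" and N: "is_rep t P N" and pq: "p \<in> P" "q \<in> P" "p \<le> q"
  shows "int (map_rank t N p q) =
    int (hom_dim ((*) :: 'k \<Rightarrow> 'k \<Rightarrow> 'k) t P (spread_rep (hook_inf P p)) N) -
    (if p = q then 0 else int (hom_dim ((*) :: 'k \<Rightarrow> 'k \<Rightarrow> 'k) t P (spread_rep (hook P p q)) N))"
proof -
  interpret t: vector_space_pair t t using t by (simp add: vector_space_pair_def)
  have inf: "hom_dim ((*) :: 'k \<Rightarrow> 'k \<Rightarrow> 'k) t P (spread_rep (hook_inf P p)) N = t.vs1.dim (vs_at N p)"
    using hom_dim_cyclic[OF t N pq(1), where E="\<lambda>_. False"] by (simp add: hook_inf_def)
  show ?thesis
  proof (cases "p = q")
    case True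
    then show ?thesis using inf map_rank_refl[OF N pq(1)] by simp
  next
    case False
    have "hom_dim ((*) :: 'k \<Rightarrow> 'k \<Rightarrow> 'k) t P (spread_rep (hook P p q)) N =
      t.vs1.dim {v \<in> vs_at N p. \<forall>w\<in>P. p \<le> w \<longrightarrow> q \<le> w \<longrightarrow> map_at N p w v = 0}"
      unfolding hook_def
      by (rule hom_dim_cyclic[OF t N pq(1), where E="\<lambda>z. q \<le> z"]) (use False pq in \<open>auto intro: order_trans antisym\<close>)
    also have "{v \<in> vs_at N p. \<forall>w\<in>P. p \<le> w \<longrightarrow> q \<le> w \<longrightarrow> map_at N p w v = 0} = {v \<in> vs_at N p. map_at N p q v = 0}"
    proof -
      have "map_at N p w v = 0" if "v \<in> vs_at N p" "map_at N p q v = 0" "w \<in> P" "q \<le> w" for v w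
        using is_repD(5)[OF N pq(1,2) that(3) pq(3) that(4,1)] that(2)
          t.linear_on_zero[OF is_repD(3)[OF N pq(2) that(3,4)] t.vs1.fin_dim_subspace[OF is_repD(1)[OF N pq(2)]]] by simp
      then show ?thesis using pq by auto
    qed
    finally show ?thesis
      using t.dim_image_kernel[OF is_repD(3)[OF N pq] is_repD(1)[OF N pq(1)]] inf False by (simp add: map_rank_def)
  qed
qed

lemma hook_inf_spread:
  assumes "p \<in> P" shows "hook_inf P p \<in> spreads P"
proof -
  have "poset_connected (hook_inf P p)"
    by (rule connected_least[of p]) (use assms in \<open>auto simp: hook_inf_def\<close>)
  moreover have "poset_convex P (hook_inf P p)"
    unfolding poset_convex_def hook_inf_def using order_trans by blast
  ultimately show ?thesis using assms by (auto simp: spreads_def hook_inf_def)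
qed

lemma hook_spread:
  assumes "p \<in> P" "p < q" shows "hook P p q \<in> spreads P"
proof -
  have p: "p \<in> hook P p q" using assms by (auto simp: hook_def)
  then have "poset_connected (hook P p q)"
    by (rule connected_least) (auto simp: hook_def)
  moreover have "poset_convex P (hook P p q)"
    unfolding poset_convex_def hook_def using order_trans by blast
  ultimately show ?thesis using p by (auto simp: spreads_def hook_def)
qed

lemma hooks_spreads: "hooks P \<subseteq> spreads P"
  using hook_spread hook_inf_spread by (auto simp: hooks_eq)

text \<open>The same differences express ranks for \<open>M\<close> and for the spread
  representations, so an expansion of Hom dimensions at hooks is an expansion of ranks. Leaving
  \<open>B\<close> open serves both Hom-based counts, with hooks or all spreads as basis.\<close>

lemma hook_expansion:
  fixes s :: "'k::field \<Rightarrow> 'v::ab_group_add \<Rightarrow> 'v"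
  assumes s: "vector_space s" and M: "is_rep s (grid a b) M"
    and B: "finite B" "B \<subseteq> spreads (grid a b)"
    and c: "\<And>I. I \<in> hooks (grid a b) \<Longrightarrow>
      int (hom_dim ((*) :: 'k \<Rightarrow> 'k \<Rightarrow> 'k) s (grid a b) (spread_rep I) M) =
      (\<Sum>J\<in>B. c J * int (hom_dim ((*) :: 'k \<Rightarrow> 'k \<Rightarrow> 'k) ((*) :: 'k \<Rightarrow> 'k \<Rightarrow> 'k) (grid a b) (spread_rep I) (spread_rep J)))"
  shows "(\<Sum>J\<in>B. c J) = grid_euler (grid a b) (\<lambda>p q. int (map_rank s M p q))"
proof -
  let ?P = "grid a b"
  let ?h = "\<lambda>I J. int (hom_dim ((*) :: 'k \<Rightarrow> 'k \<Rightarrow> 'k) ((*) :: 'k \<Rightarrow> 'k \<Rightarrow> 'k) ?P (spread_rep I) (spread_rep J))"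
  have "grid_euler ?P (\<lambda>p q. int (map_rank s M p q)) = (\<Sum>J\<in>B. c J)"
  proof (rule grid_euler_expand[OF B])
    fix p q assume pq: "p \<in> ?P" "q \<in> ?P" "p \<le> q"
    have J: "?h (hook_inf ?P p) J - (if p = q then 0 else ?h (hook ?P p q) J) = of_bool (p \<in> J \<and> q \<in> J)" if "J \<in> B" for J
    proof -
      have Jr: "is_rep ((*) :: 'k \<Rightarrow> 'k \<Rightarrow> 'k) ?P (spread_rep J)" using that B by (intro spreads_is_rep) auto
      show ?thesis using map_rank_hom_dim[OF vector_space_field Jr pq, symmetric] unfolding map_rank_spread by simp
    qed
    have inf: "hook_inf ?P p \<in> hooks ?P" using pq by (auto simp: hooks_eq)
    have "int (map_rank s M p q) = (\<Sum>J\<in>B. c J * (?h (hook_inf ?P p) J - (if p = q then 0 else ?h (hook ?P p q) J)))"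
    proof (cases "p = q")
      case True
      then show ?thesis using map_rank_hom_dim[OF s M pq] c[OF inf] by simp
    next
      case False
      then have "hook ?P p q \<in> hooks ?P" using pq by (auto simp: hooks_eq less_le)
      then show ?thesis using False map_rank_hom_dim[OF s M pq] c[OF inf] c[of "hook ?P p q"]
        by (simp add: right_diff_distrib sum_subtractf)
    qed
    also have "\<dots> = (\<Sum>J\<in>B. c J * of_bool (p \<in> J \<and> q \<in> J))"
      by (intro sum.cong refl) (simp only: J)
    finally show "int (map_rank s M p q) = (\<Sum>J\<in>B. c J * of_bool (p \<in> J \<and> q \<in> J))" .
  qed
  then show ?thesis by simp
qed

section \<open>Morphisms between spreads\<close>

text \<open>The supports of quotients: under this condition the identity on \<open>C\<close>
  commutes with the structure maps out of \<open>I\<close>.\<close>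

definition quotient_part :: "'p::order set \<Rightarrow> 'p set \<Rightarrow> bool" where
  "quotient_part I C \<longleftrightarrow> C \<subseteq> I \<and> (\<forall>z\<in>I. \<forall>c\<in>C. z \<le> c \<longrightarrow> z \<in> C)"

text \<open>The dual condition, for the supports of subrepresentations.\<close>

definition sub_part :: "'p::order set \<Rightarrow> 'p set \<Rightarrow> bool" where
  "sub_part J C \<longleftrightarrow> C \<subseteq> J \<and> (\<forall>z\<in>J. \<forall>c\<in>C. c \<le> z \<longrightarrow> z \<in> C)"

text \<open>These are connected components of the intersection of \<open>I\<close> and
  \<open>J\<close>, since the two closure conditions leave no comparable point of the intersection
  outside \<open>C\<close>. Exactly on these components a morphism can be nonzero.\<close>

definition image_parts :: "'p::order set \<Rightarrow> 'p set \<Rightarrow> 'p set \<Rightarrow> 'p set set" where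
  "image_parts P I J = {C \<in> spreads P. quotient_part I C \<and> sub_part J C}"

lemma quotient_partD: "quotient_part I C \<Longrightarrow> z \<in> I \<Longrightarrow> c \<in> C \<Longrightarrow> z \<le> c \<Longrightarrow> z \<in> C"
  and sub_partD: "sub_part J C \<Longrightarrow> z \<in> J \<Longrightarrow> c \<in> C \<Longrightarrow> c \<le> z \<Longrightarrow> z \<in> C"
  unfolding quotient_part_def sub_part_def by blast+

text \<open>A path inside \<open>C\<close> stays in the intersection of \<open>I\<close> and
  \<open>J\<close>, and the closure conditions of \<open>C'\<close> pass membership along its
  steps.\<close>

lemma image_parts_subset:
  assumes "C \<in> image_parts P I J" "C' \<in> image_parts P I J" "p \<in> C" "p \<in> C'"
  shows "C \<subseteq> C'"
proof
  fix c assume "c \<in> C"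
  then have "(p, c) \<in> {(u, v). u \<in> C \<and> v \<in> C \<and> (u \<le> v \<or> v \<le> u)}\<^sup>*"
    using assms(1,3) by (simp add: image_parts_def spreads_def poset_connected_def)
  then show "c \<in> C'"
  proof (induction rule: rtrancl_induct)
    case base show ?case by (rule assms)
  next
    case (step y z)
    then have "z \<in> I" "z \<in> J" using assms(1) by (auto simp: image_parts_def quotient_part_def sub_part_def)
    then show ?case using step assms(2) by (auto simp: image_parts_def quotient_part_def sub_part_def)
  qed
qed

text \<open>A morphism is given by scalars that are constant on each component of the intersection,
  and naturality forces them to vanish on components outside \<open>image_parts\<close>. The
  remaining scalars are free.\<close>

lemma hom_dim_spreads:
  fixes I J :: "'p::order set"
  assumes P: "finite P" and I: "I \<in> spreads P" and J: "J \<in> spreads P"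
  shows "hom_dim ((*) :: 'k::field \<Rightarrow> 'k \<Rightarrow> 'k) ((*) :: 'k \<Rightarrow> 'k \<Rightarrow> 'k) P (spread_rep I) (spread_rep J) =
    card (image_parts P I J)"
proof -
  let ?s = "(*) :: 'k \<Rightarrow> 'k \<Rightarrow> 'k" and ?C = "image_parts P I J"
  let ?hom = "rep_hom ?s ?s P (spread_rep I) (spread_rep J)"
  have s: "vector_space ?s" by (rule vector_space_field)
  have u: "vector_space (scale_fun ?s)" by (rule vector_space_scale_fun[OF s])
  have IP: "I \<subseteq> P" "poset_convex P I" and JP: "J \<subseteq> P" "poset_convex P J"
    using I J by (auto simp: spreads_def)
  have finC: "finite ?C"
    by (rule finite_subset[OF _ finite_spreads[OF P]]) (auto simp: image_parts_def)
  have C: "C \<noteq> {}" "C \<subseteq> I" "C \<subseteq> J" "poset_connected C" "quotient_part I C" "sub_part J C" if "C \<in> ?C" for C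
    using that by (auto simp: image_parts_def spreads_def quotient_part_def sub_part_def)
  have eqC: "C = C'" if "C \<in> ?C" "C' \<in> ?C" "p \<in> C" "p \<in> C'" for C C' p
    using image_parts_subset[OF that] image_parts_subset[OF that(2,1,4,3)] by (rule subset_antisym)
  define pt where "pt C = (SOME z. z \<in> C)" for C :: "'p set"
  have pt: "pt C \<in> C" if "C \<in> ?C" for C
    unfolding pt_def using C(1)[OF that] by (rule some_in_eq[THEN iffD2])
  define F where "F \<phi> C = (if C \<in> ?C then \<phi> (pt C) 1 else 0)" for \<phi> :: "'p \<Rightarrow> 'k \<Rightarrow> 'k" and C
  \<comment> \<open>Naturality applied to the generator 1 at a point of \<open>I\<close>, with both
    structure maps written out; all constraints on the scalars are instances.\<close>
  have rel: "\<phi> w (if w \<in> I then 1 else 0) = (if z \<in> J \<and> w \<in> J then \<phi> z 1 else 0)"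
    if "\<phi> \<in> ?hom" "z \<in> I" "w \<in> P" "z \<le> w" for \<phi> z w
    using rep_homD(3)[OF that(1), of z w 1] that(2-4) IP by (auto simp: spread_rep_def)
  have "hom_dim ?s ?s P (spread_rep I) (spread_rep J) = vector_space.dim (scale_fun ?s) {f. \<forall>C. C \<notin> ?C \<longrightarrow> f C = 0}"
  proof (rule hom_dim_eqI[OF s u spreads_is_rep[OF J], where F=F])
    show "linear_on (\<lambda>c \<phi> p v. c * \<phi> p v) (scale_fun ?s) ?hom F"
      by (auto simp: linear_on_def F_def scale_fun_def fun_eq_iff)
  next
    fix \<phi> assume \<phi>: "\<phi> \<in> ?hom" and F0: "F \<phi> = 0"
    note rel = rel[OF \<phi>]
    have zero: "\<phi> z c = 0" if "z \<notin> I \<or> c = 0" for z c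
      by (rule spread_hom_zero[OF s \<phi>]) (use that in blast)
    have "\<phi> p 1 = 0" for p
    proof (rule ccontr)
      assume p: "\<phi> p 1 \<noteq> 0"
      then have pI: "p \<in> I" using zero by blast
      then have pJ: "p \<in> J" using p rel[OF pI subsetD[OF IP(1) pI] order_refl] by (auto split: if_splits)
      \<comment> \<open>The component of \<open>p\<close> in the intersection. If the scalar at
        \<open>p\<close> is nonzero, this component turns out to be an image part, on which
        \<open>F\<close> sees the scalar.\<close>
      define R where "R = {(x, y). x \<in> I \<inter> J \<and> y \<in> I \<inter> J \<and> (x \<le> y \<or> y \<le> x)}"
      define D where "D = {z. (p, z) \<in> R\<^sup>*}"
      have const: "\<phi> y 1 = \<phi> z 1" if "y \<in> I \<inter> J" "z \<in> I \<inter> J" "y \<le> z" for y z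
        using rel[of y z] that IP by auto
      have D: "z \<in> I \<inter> J \<and> \<phi> z 1 = \<phi> p 1" if "z \<in> D" for z
        using that unfolding D_def mem_Collect_eq
      proof (induction rule: rtrancl_induct)
        case base
        then show ?case using pI pJ by simp
      next
        case (step y z)
        then have yz: "y \<in> I \<inter> J" "z \<in> I \<inter> J" "y \<le> z \<or> z \<le> y" by (auto simp: R_def)
        then have "\<phi> y 1 = \<phi> z 1" using const by metis
        then show ?case using yz step.IH by simp
      qed
      have ext: "z \<in> D" if "c \<in> D" "z \<in> I \<inter> J" "c \<le> z \<or> z \<le> c" for c z
      proof -
        have "(c, z) \<in> R" using D[OF that(1)] that by (simp add: R_def)
        then show ?thesis using that(1) unfolding D_def mem_Collect_eq by (rule rtrancl_into_rtrancl[rotated])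
      qed
      have pD: "p \<in> D" by (simp add: D_def)
      have con: "poset_connected D"
      proof -
        let ?R = "{(u, v). u \<in> D \<and> v \<in> D \<and> (u \<le> v \<or> v \<le> u)}"
        have "(p, z) \<in> ?R\<^sup>*" if "(p, z) \<in> R\<^sup>*" for z
          using that
        proof (induction rule: rtrancl_induct)
          case (step y z)
          have "y \<in> D" "z \<in> D" using step(1,2) by (auto simp: D_def)
          then have "(y, z) \<in> ?R" using step(2) by (auto simp: R_def)
          with step.IH show ?case by (rule rtrancl_into_rtrancl)
        qed (rule rtrancl_refl)
        then have path: "(p, z) \<in> ?R\<^sup>*" if "z \<in> D" for z using that by (simp add: D_def)
        have "sym ?R" by (auto simp: sym_def)
        then have "sym (?R\<^sup>*)" by (rule sym_rtrancl)
        then show ?thesis unfolding poset_connected_def using path by (meson rtrancl_trans symD)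
      qed
      have "poset_convex P D"
        unfolding poset_convex_def
      proof (intro ballI impI, elim conjE)
        fix x z y assume xyz: "x \<in> D" "z \<in> D" "y \<in> P" "x \<le> y" "y \<le> z"
        then have "y \<in> I" "y \<in> J" using D[OF xyz(1)] D[OF xyz(2)] IP(2) JP(2) unfolding poset_convex_def by blast+
        then show "y \<in> D" using ext[OF xyz(1)] xyz by blast
      qed
      then have "D \<in> spreads P" using con pD D IP by (auto simp: spreads_def)
      moreover have "quotient_part I D"
        unfolding quotient_part_def
      proof (intro conjI ballI impI)
        show "D \<subseteq> I" using D by blast
        fix z c assume zc: "z \<in> I" "c \<in> D" "z \<le> c"
        have "z \<in> J" using rel[of z c] zc D[OF zc(2)] IP p by (auto split: if_splits)
        then show "z \<in> D" using ext[OF zc(2)] zc by blast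
      qed
      moreover have "sub_part J D"
        unfolding sub_part_def
      proof (intro conjI ballI impI)
        show "D \<subseteq> J" using D by blast
        fix z c assume zc: "z \<in> J" "c \<in> D" "c \<le> z"
        have "z \<in> I"
        proof (rule ccontr)
          assume "z \<notin> I"
          then show False using rel[of c z] zc D[OF zc(2)] JP p zero[of z 0] by auto
        qed
        then show "z \<in> D" using ext[OF zc(2)] zc by blast
      qed
      ultimately have DC: "D \<in> ?C" by (simp add: image_parts_def)
      then have "\<phi> (pt D) 1 = 0" using fun_cong[OF F0, of D] by (simp add: F_def)
      then show False using D[OF pt[OF DC]] p by simp
    qed
    then have "\<phi> p c = 0" for p c
      using spread_hom_scale[OF \<phi>, of p c] zero[of p c] IP by (cases "p \<in> I") auto
    then show "\<phi> = 0" by (intro ext) simp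
  next
    show "F ` ?hom = {f. \<forall>C. C \<notin> ?C \<longrightarrow> f C = 0}"
    proof
      show "F ` ?hom \<subseteq> {f. \<forall>C. C \<notin> ?C \<longrightarrow> f C = 0}" by (auto simp: F_def)
      show "{f. \<forall>C. C \<notin> ?C \<longrightarrow> f C = 0} \<subseteq> F ` ?hom"
      proof
        fix f :: "'p set \<Rightarrow> 'k" assume f: "f \<in> {f. \<forall>C. C \<notin> ?C \<longrightarrow> f C = 0}"
        \<comment> \<open>The scalar \<open>f C\<close> on each part and 0 elsewhere; the parts are
          disjoint, so at most one summand is nonzero.\<close>
        define g where "g p = (\<Sum>C\<in>?C. if p \<in> C then f C else 0)" for p
        have g: "g p = f C" if "C \<in> ?C" "p \<in> C" for p C
        proof -
          have "p \<in> D \<longleftrightarrow> D = C" if "D \<in> ?C" for D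
            using eqC[OF that \<open>C \<in> ?C\<close> _ \<open>p \<in> C\<close>] \<open>p \<in> C\<close> by blast
          then have "g p = (\<Sum>D\<in>?C. if D = C then f C else 0)"
            unfolding g_def by (intro sum.cong refl) simp
          then show ?thesis using finC that by simp
        qed
        have gC: "\<exists>C\<in>?C. p \<in> C" if "g p \<noteq> 0" for p
        proof (rule ccontr)
          assume "\<not> (\<exists>C\<in>?C. p \<in> C)"
          then have "g p = 0" unfolding g_def by (intro sum.neutral) auto
          with that show False by simp
        qed
        have gI: "p \<in> I" and gJ: "p \<in> J" if "g p \<noteq> 0" for p using gC[OF that] C(2,3) by blast+
        define \<phi> where "\<phi> p v = v * g p" for p v
        have "\<phi> \<in> ?hom"
          unfolding rep_hom_def
        proof (intro CollectI conjI ballI allI impI)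
          show "\<phi> p ` vs_at (spread_rep I) p \<subseteq> vs_at (spread_rep J) p" for p
            using gJ[of p] by (auto simp: \<phi>_def spread_rep_def)
          show "linear_on ?s ?s (vs_at (spread_rep I) p) (\<phi> p)" for p
            by (simp add: linear_on_def \<phi>_def algebra_simps)
          show "\<phi> w (map_at (spread_rep I) z w v) = map_at (spread_rep J) z w (\<phi> z v)"
            if zw: "z \<in> P" "w \<in> P" "z \<le> w" and v: "v \<in> vs_at (spread_rep I) z" for z w v
          proof (cases "z \<in> I")
            case False
            then have "v = 0" using v by (simp add: spread_rep_def)
            then show ?thesis by (simp add: \<phi>_def spread_rep_def)
          next
            case zI: True
            have down: "g w = g z \<and> z \<in> J" if w: "w \<in> I" "g w \<noteq> 0"
            proof -
              obtain D where D: "D \<in> ?C" "w \<in> D" using gC[OF w(2)] by blast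
              have zD: "z \<in> D" by (rule quotient_partD[OF C(5)[OF D(1)] zI D(2) zw(3)])
              then show ?thesis using g[OF D] g[OF D(1) zD] subsetD[OF C(3)[OF D(1)] zD] by simp
            qed
            have up: "w \<in> I \<and> g w = g z" if w: "w \<in> J" "g z \<noteq> 0"
            proof -
              obtain D where D: "D \<in> ?C" "z \<in> D" using gC[OF w(2)] by blast
              have wD: "w \<in> D" by (rule sub_partD[OF C(6)[OF D(1)] w(1) D(2) zw(3)])
              then show ?thesis using g[OF D] g[OF D(1) wD] subsetD[OF C(2)[OF D(1)] wD] by simp
            qed
            show ?thesis
            proof (cases "w \<in> I")
              case True
              have "g w = (if z \<in> J \<and> w \<in> J then g z else 0)"
              proof (cases "g w = 0")
                case g0: True
                then have "g z = 0" if "w \<in> J" using up[OF that] by metis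
                then show ?thesis using g0 by simp
              next
                case False
                then show ?thesis using down[OF True False] gJ[OF False] by simp
              qed
              then show ?thesis using zI True by (simp add: \<phi>_def spread_rep_def)
            next
              case False
              then have "g z = 0" if "w \<in> J" using up[OF that] by blast
              then show ?thesis using False by (simp add: \<phi>_def spread_rep_def)
            qed
          qed
          show "\<phi> p v = 0" if "p \<notin> P \<or> v \<notin> vs_at (spread_rep I) p" for p v
          proof -
            have "p \<notin> I" using that IP by (auto simp: spread_rep_def split: if_splits)
            then have "g p = 0" using gI by blast
            then show ?thesis by (simp add: \<phi>_def)
          qed
        qed
        moreover have "F \<phi> = f"
          using f g[OF _ pt] by (auto simp: F_def \<phi>_def fun_eq_iff)
        ultimately show "f \<in> F ` ?hom" by blast
      qed
    qed
  qed
  then show ?thesis using fin_dim_funs(2)[OF finC] by simp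
qed

lemma hom_dim_spreads_product:
  assumes P: "finite P" and I: "I \<in> spreads P" and J: "J \<in> spreads P"
  shows "int (hom_dim ((*) :: 'k::field \<Rightarrow> 'k \<Rightarrow> 'k) ((*) :: 'k \<Rightarrow> 'k \<Rightarrow> 'k) P (spread_rep I) (spread_rep J)) =
    (\<Sum>C\<in>spreads P. of_bool (sub_part J C) * of_bool (quotient_part I C))"
proof -
  have "image_parts P I J = spreads P \<inter> {C. sub_part J C \<and> quotient_part I C}"
    by (auto simp: image_parts_def)
  then show ?thesis
    using finite_spreads[OF P] by (simp add: hom_dim_spreads[OF assms] sum_of_bool_eq flip: of_bool_conj)
qed

lemma N_int_Eul_char_euler:
  fixes s :: "'k::field \<Rightarrow> 'v::ab_group_add \<Rightarrow> 'v"
  assumes s: "vector_space s" and M: "is_rep s (grid a b) M"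
  shows "N_int_Eul_char s (grid a b) M = grid_euler (grid a b) (\<lambda>p q. int (map_rank s M p q))"
  unfolding N_int_Eul_char_def
proof (rule basis_count_eq)
  let ?P = "grid a b"
  let ?B = "spreads ?P"
  let ?h = "\<lambda>J I. int (hom_dim ((*) :: 'k \<Rightarrow> 'k \<Rightarrow> 'k) ((*) :: 'k \<Rightarrow> 'k \<Rightarrow> 'k) ?P (spread_rep I) (spread_rep J))"
  let ?v = "\<lambda>I. int (hom_dim ((*) :: 'k \<Rightarrow> 'k \<Rightarrow> 'k) s ?P (spread_rep I) M)"
  show fin: "finite ?B" by (rule finite_spreads[OF finite_grid])
  have finI: "finite I" if "I \<in> ?B" for I by (rule spreads_finite[OF finite_grid that])
  have prod: "(\<Sum>J\<in>?B. c J * ?h J I) =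
      (\<Sum>C\<in>?B. (\<Sum>J\<in>?B. c J * of_bool (sub_part J C)) * of_bool (quotient_part I C))" if "I \<in> ?B" for c I
  proof -
    have "(\<Sum>J\<in>?B. c J * ?h J I) = (\<Sum>J\<in>?B. \<Sum>C\<in>?B. c J * of_bool (sub_part J C) * of_bool (quotient_part I C))"
      using hom_dim_spreads_product[OF finite_grid that, where 'k='k]
      by (intro sum.cong refl) (simp only: sum_distrib_left mult.assoc)
    also have "\<dots> = (\<Sum>C\<in>?B. (\<Sum>J\<in>?B. c J * of_bool (sub_part J C)) * of_bool (quotient_part I C))"
      by (subst sum.swap) (simp only: sum_distrib_right)
    finally show ?thesis .
  qed
  \<comment> \<open>The two triangular systems are solved in succession. The quotient relation leads
    to smaller sets and the sub relation, read from \<open>C\<close> to \<open>J\<close>, to larger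
    ones, so the rankings are opposite.\<close>
  have "\<exists>!d. (\<forall>C. C \<notin> ?B \<longrightarrow> d C = 0) \<and> (\<forall>I\<in>?B. ?v I = (\<Sum>C\<in>?B. d C * of_bool (quotient_part I C)))"
    by (rule unitriangular_unique[OF fin, where f=card])
      (auto simp: quotient_part_def finI intro!: psubset_card_mono)
  then obtain d where d: "\<And>C. C \<notin> ?B \<Longrightarrow> d C = 0" "\<And>I. I \<in> ?B \<Longrightarrow> ?v I = (\<Sum>C\<in>?B. d C * of_bool (quotient_part I C))"
    and d_unique: "\<And>e. (\<forall>C. C \<notin> ?B \<longrightarrow> e C = 0) \<and> (\<forall>I\<in>?B. ?v I = (\<Sum>C\<in>?B. e C * of_bool (quotient_part I C))) \<Longrightarrow> e = d"
    by (elim ex1E) blast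
  have c_unique: "\<exists>!c. (\<forall>J. J \<notin> ?B \<longrightarrow> c J = 0) \<and> (\<forall>C\<in>?B. d C = (\<Sum>J\<in>?B. c J * of_bool (sub_part J C)))"
    by (rule unitriangular_unique[OF fin, where f="\<lambda>I. - int (card I)"])
      (auto simp: sub_part_def finI intro!: psubset_card_mono)
  \<comment> \<open>Uniqueness of \<open>d\<close> lets the outer factor be cancelled, so solving
    the product system amounts to solving for \<open>d\<close> in the inner factor.\<close>
  have "(\<forall>I\<in>?B. ?v I = (\<Sum>J\<in>?B. c J * ?h J I)) \<longleftrightarrow> (\<forall>C\<in>?B. d C = (\<Sum>J\<in>?B. c J * of_bool (sub_part J C)))" for c
  proof
    assume *: "\<forall>I\<in>?B. ?v I = (\<Sum>J\<in>?B. c J * ?h J I)"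
    let ?e = "\<lambda>C. if C \<in> ?B then \<Sum>J\<in>?B. c J * of_bool (sub_part J C) else 0"
    have "?e = d"
    proof (rule d_unique, intro conjI allI impI ballI)
      fix I assume I: "I \<in> ?B"
      have "?v I = (\<Sum>C\<in>?B. (\<Sum>J\<in>?B. c J * of_bool (sub_part J C)) * of_bool (quotient_part I C))"
        using *[rule_format, OF I] unfolding prod[OF I] .
      also have "\<dots> = (\<Sum>C\<in>?B. ?e C * of_bool (quotient_part I C))" by (intro sum.cong refl) simp
      finally show "?v I = (\<Sum>C\<in>?B. ?e C * of_bool (quotient_part I C))" .
    qed simp
    then show "\<forall>C\<in>?B. d C = (\<Sum>J\<in>?B. c J * of_bool (sub_part J C))" by (auto simp: fun_eq_iff split: if_splits)
  next
    assume *: "\<forall>C\<in>?B. d C = (\<Sum>J\<in>?B. c J * of_bool (sub_part J C))"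
    show "\<forall>I\<in>?B. ?v I = (\<Sum>J\<in>?B. c J * ?h J I)"
    proof
      fix I assume I: "I \<in> ?B"
      have "?v I = (\<Sum>C\<in>?B. d C * of_bool (quotient_part I C))" by (rule d(2)[OF I])
      also have "\<dots> = (\<Sum>J\<in>?B. c J * ?h J I)" unfolding prod[OF I] using * by (intro sum.cong) auto
      finally show "?v I = (\<Sum>J\<in>?B. c J * ?h J I)" .
    qed
  qed
  then show "\<exists>!c. (\<forall>J. J \<notin> ?B \<longrightarrow> c J = 0) \<and> (\<forall>I\<in>?B. ?v I = (\<Sum>J\<in>?B. c J * ?h J I))"
    using c_unique by (simp only:)
  fix c assume c: "\<And>I. I \<in> ?B \<Longrightarrow> ?v I = (\<Sum>J\<in>?B. c J * ?h J I)"
  show "(\<Sum>J\<in>?B. c J) = grid_euler ?P (\<lambda>p q. int (map_rank s M p q))"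
    by (rule hook_expansion[OF s M fin order_refl]) (rule c, rule subsetD[OF hooks_spreads])
qed

lemma least_point:
  assumes "I \<in> hooks P"
  shows "\<exists>p\<in>I. \<forall>z\<in>I. p \<le> z"
proof -
  consider x y where "I = hook P x y" "x \<in> P" "x < y" | x where "I = hook_inf P x" "x \<in> P"
    using assms unfolding hooks_eq by blast
  then show ?thesis
  proof cases
    case 1
    then show ?thesis by (intro bexI[of _ x]) (auto simp: hook_def)
  next
    case 2
    then show ?thesis by (intro bexI[of _ x]) (auto simp: hook_inf_def)
  qed
qed

text \<open>
  The matrix is unitriangular because a nonzero morphism from \<open>k\<^sub>I\<close> to \<open>k\<^sub>J\<close> for hooks \<open>I\<close>, \<open>J\<close> forces
  the up-closure of \<open>I\<close>, and the part of it outside \<open>I\<close>, to be contained in those of \<open>J\<close>.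
\<close>

lemma N_hook_dec_euler:
  fixes s :: "'k::field \<Rightarrow> 'v::ab_group_add \<Rightarrow> 'v"
  assumes s: "vector_space s" and M: "is_rep s (grid a b) M"
  shows "N_hook_dec s (grid a b) M = grid_euler (grid a b) (\<lambda>p q. int (map_rank s M p q))"
  unfolding N_hook_dec_def
proof (rule basis_count_eq)
  let ?P = "grid a b"
  let ?B = "hooks ?P"
  let ?h = "\<lambda>J I. int (hom_dim ((*) :: 'k \<Rightarrow> 'k \<Rightarrow> 'k) ((*) :: 'k \<Rightarrow> 'k \<Rightarrow> 'k) ?P (spread_rep I) (spread_rep J))"
  let ?v = "\<lambda>I. int (hom_dim ((*) :: 'k \<Rightarrow> 'k \<Rightarrow> 'k) s ?P (spread_rep I) M)"
  have sub: "?B \<subseteq> spreads ?P" by (rule hooks_spreads)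
  then show fin: "finite ?B" by (rule finite_subset) (rule finite_spreads[OF finite_grid])
  have dim: "?h J I = int (card (image_parts ?P I J))" if "I \<in> ?B" "J \<in> ?B" for I J
    using hom_dim_spreads[OF finite_grid, where 'k='k] that sub by (simp add: subset_iff)
  define U where "U I = {z \<in> ?P. \<exists>u\<in>I. u \<le> z}" for I
  \<comment> \<open>\<open>U I\<close> is the up-closure of \<open>I\<close>. The pair
    \<open>U I\<close>, \<open>U I - I\<close> determines \<open>I\<close>, so if both sets grow
    weakly and \<open>I\<close> changes, the sum of their sizes grows strictly.\<close>
  define g where "g I = int (card (U I)) + int (card (U I - I))" for I
  have finU: "finite (U I)" for I using finite_grid by (simp add: U_def)
  have IU: "I \<subseteq> U I" if "I \<in> ?B" for I using that sub by (auto simp: U_def spreads_def)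
  show "\<exists>!c. (\<forall>J. J \<notin> ?B \<longrightarrow> c J = 0) \<and> (\<forall>I\<in>?B. ?v I = (\<Sum>J\<in>?B. c J * ?h J I))"
  proof (rule unitriangular_unique[OF fin, where f="\<lambda>I. - g I"])
    fix I assume I: "I \<in> ?B"
    obtain p where p: "p \<in> I" "\<And>z. z \<in> I \<Longrightarrow> p \<le> z" using least_point[OF I] by blast
    \<comment> \<open>A nonempty image contains the least point by closure downwards, and then all
      of \<open>I\<close> by closure upwards.\<close>
    have "image_parts ?P I I = {I}"
    proof
      show "{I} \<subseteq> image_parts ?P I I"
        using subsetD[OF sub I] by (simp add: image_parts_def quotient_part_def sub_part_def)
      show "image_parts ?P I I \<subseteq> {I}"
      proof
        fix C assume "C \<in> image_parts ?P I I"
        then have C: "C \<noteq> {}" "quotient_part I C" "sub_part I C" by (auto simp: image_parts_def spreads_def)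
        then obtain c where c: "c \<in> C" by blast
        have CI: "C \<subseteq> I" using C(2) by (simp add: quotient_part_def)
        have pC: "p \<in> C" by (rule quotient_partD[OF C(2) p(1) c p(2)[OF subsetD[OF CI c]]])
        have "I \<subseteq> C" by (rule subsetI) (rule sub_partD[OF C(3) _ pC p(2)])
        then show "C \<in> {I}" using CI by blast
      qed
    qed
    then show "?h I I = 1" by (simp add: dim[OF I I])
  next
    fix I J assume I: "I \<in> ?B" and J: "J \<in> ?B" and ne: "I \<noteq> J" and h: "?h J I \<noteq> 0"
    obtain p where p: "p \<in> I" "\<And>z. z \<in> I \<Longrightarrow> p \<le> z" using least_point[OF I] by blast
    have "image_parts ?P I J \<noteq> {}" using h by (auto simp: dim[OF I J])
    then obtain C where C: "C \<noteq> {}" "quotient_part I C" "sub_part J C" by (auto simp: image_parts_def spreads_def)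
    then obtain c where c: "c \<in> C" by blast
    have CI: "C \<subseteq> I" and CJ: "C \<subseteq> J" using C by (simp_all add: quotient_part_def sub_part_def)
    have pC: "p \<in> C" by (rule quotient_partD[OF C(2) p(1) c p(2)[OF subsetD[OF CI c]]])
    have up: "z \<in> I" if "z \<in> J" "p \<le> z" for z
      by (rule subsetD[OF CI sub_partD[OF C(3) that(1) pC that(2)]])
    have pU: "z \<in> ?P \<and> p \<le> z" if "z \<in> U I" for z
      using that p(2) unfolding U_def by (blast intro: order_trans)
    have 1: "U I \<subseteq> U J"
    proof
      fix z assume "z \<in> U I"
      then show "z \<in> U J" using pU[of z] subsetD[OF CJ pC] unfolding U_def by blast
    qed
    \<comment> \<open>A point of \<open>J\<close> above \<open>p\<close> lies in \<open>C\<close>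
      and therefore in \<open>I\<close>; so a point above \<open>p\<close> outside \<open>I\<close>
      is outside \<open>J\<close> too.\<close>
    have 2: "U I - I \<subseteq> U J - J"
    proof
      fix z assume "z \<in> U I - I"
      then show "z \<in> U J - J" using pU[of z] up[of z] subsetD[OF 1, of z] by blast
    qed
    have "U I \<noteq> U J \<or> U I - I \<noteq> U J - J" using IU[OF I] IU[OF J] ne by blast
    then have "card (U I) < card (U J) \<or> card (U I - I) < card (U J - J)"
      using 1 2 finU by (metis finite_Diff psubsetI psubset_card_mono)
    moreover have "card (U I) \<le> card (U J)" "card (U I - I) \<le> card (U J - J)"
      using 1 2 finU by (auto intro!: card_mono)
    ultimately have "g I < g J" unfolding g_def by linarith
    then show "- g J < - g I" by simp
  qed
  fix c assume c: "\<And>I. I \<in> ?B \<Longrightarrow> ?v I = (\<Sum>J\<in>?B. c J * ?h J I)"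
  show "(\<Sum>J\<in>?B. c J) = grid_euler ?P (\<lambda>p q. int (map_rank s M p q))"
    by (rule hook_expansion[OF s M fin sub]) (rule c)
qed

theorem theoremA:
  fixes s :: "'k::field \<Rightarrow> 'v::ab_group_add \<Rightarrow> 'v"
    and a b :: nat
    and M :: "(int \<times> int, 'v) poset_rep"
    and star :: compression
  assumes "vector_space s"
    and "a \<ge> 1" and "b \<ge> 1"
    and "is_rep s (grid a b) M"
  shows "N_sq s (grid a b) M = N_gen_pers_diag s (grid a b) M
       \<and> N_gen_pers_diag s (grid a b) M = N_sign_barc s (grid a b) M
       \<and> N_sign_barc s (grid a b) M = N_hook_dec s (grid a b) M
       \<and> N_hook_dec s (grid a b) M = N_int_Eul_char s (grid a b) M
       \<and> N_int_Eul_char s (grid a b) M = N_int_dec_repl s star (grid a b) M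
       \<and> N_int_dec_repl s star (grid a b) M = N_Bth s (grid a b) M
       \<and> N_Bth s (grid a b) M = N_Dth s (grid a b) M"
  using N_sq_euler[OF assms(1,4)] N_gen_pers_diag_euler[OF assms(1,4)] N_sign_barc_euler[of s a b M]
    N_hook_dec_euler[OF assms(1,4)] N_int_Eul_char_euler[OF assms(1,4)]
    N_int_dec_repl_euler[OF assms(1,4), of star] N_Bth_euler[OF assms(1,4)] N_Dth_euler[OF assms(1,4)]
  by simp

end
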